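(* Let $L>0$ and let $V:[-L/2,L/2]\to\mathbb{R}$ be a bounded convex potential. Then \[\Lambda(V,(\alpha,\beta))\ \ge\ \Lambda(0,\min\{\alpha,\beta\})\qquad\text{for each }\alpha,\beta\in[-1/L,\infty],\] with equality if $V$ is constant and $\alpha=\beta$.
   Context: For a bounded potential $V$ and $\alpha,\beta\in(-\infty,\infty]$, consider $-u''+Vu=\lambda u$ on $(-L/2,L/2)$ with boundary conditions $u'(-L/2)=\alpha u(-L/2)$ and $u'(L/2)=-\beta u(L/2)$, where a parameter equal to $\infty$ means the Dirichlet condition $u=0$ at that endpoint. The eigenvalues are simple, $\lambda_1<\lambda_2<\cdots$, and $\Lambda(V,(\alpha,\beta))=\lambda_2-\lambda_1$. We write $\Lambda(V,\alpha)=\Lambda(V,(\alpha,\alpha))$. *)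

theory Defs
  imports "HOL-Analysis.Analysis"
begin

fun bc_left :: "ereal \<Rightarrow> real \<Rightarrow> real \<Rightarrow> bool" where
  "bc_left (ereal a) u du \<longleftrightarrow> du = a * u"
| "bc_left PInfty u du \<longleftrightarrow> u = 0"
| "bc_left MInfty u du \<longleftrightarrow> False"

fun bc_right :: "ereal \<Rightarrow> real \<Rightarrow> real \<Rightarrow> bool" where
  "bc_right (ereal b) u du \<longleftrightarrow> du = - b * u"
| "bc_right PInfty u du \<longleftrightarrow> u = 0"
| "bc_right MInfty u du \<longleftrightarrow> False"

definition is_eigenvalue :: "(real \<Rightarrow> real) \<Rightarrow> real \<Rightarrow> ereal \<Rightarrow> ereal \<Rightarrow> real \<Rightarrow> bool" where
  "is_eigenvalue V L \<alpha> \<beta> lam \<longleftrightarrow>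
     (\<exists>u u'. (\<exists>x\<in>{-L/2..L/2}. u x \<noteq> 0)
        \<and> continuous_on {-L/2..L/2} u'
        \<and> (\<forall>x\<in>{-L/2..L/2}. (u has_real_derivative u' x) (at x within {-L/2..L/2}))
        \<and> (\<forall>x\<in>{-L/2<..<L/2}. (u' has_real_derivative (V x - lam) * u x) (at x))
        \<and> bc_left \<alpha> (u (-L/2)) (u' (-L/2))
        \<and> bc_right \<beta> (u (L/2)) (u' (L/2)))"

definition eig1 :: "(real \<Rightarrow> real) \<Rightarrow> real \<Rightarrow> ereal \<Rightarrow> ereal \<Rightarrow> real" where
  "eig1 V L \<alpha> \<beta> = Inf {lam. is_eigenvalue V L \<alpha> \<beta> lam}"

definition eig2 :: "(real \<Rightarrow> real) \<Rightarrow> real \<Rightarrow> ereal \<Rightarrow> ereal \<Rightarrow> real" where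
  "eig2 V L \<alpha> \<beta> = Inf ({lam. is_eigenvalue V L \<alpha> \<beta> lam} - {eig1 V L \<alpha> \<beta>})"

definition gap :: "(real \<Rightarrow> real) \<Rightarrow> real \<Rightarrow> ereal \<Rightarrow> ereal \<Rightarrow> real" where
  "gap V L \<alpha> \<beta> = eig2 V L \<alpha> \<beta> - eig1 V L \<alpha> \<beta>"

end

theory Submission
  imports Defs
begin

text \<open>
  With \<open>R = L / 2\<close>, write both boundary conditions with Pruefer angles \<open>A, B\<close>, where \<open>cot A = \<alpha>\<close> and
  \<open>cot B = \<beta>\<close>; let \<open>D\<close> be the larger one. Along the family \<open>t V + s x\<close> of potentials, with angles
  moving linearly from \<open>D, D\<close> at \<open>t = 0\<close> to \<open>A, B\<close> at \<open>t = 1\<close>, the gap has derivatives given by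
  integrals against \<open>q = u2\<^sup>2 - u1\<^sup>2\<close> and by the boundary values of \<open>q\<close> (\<open>u1, u2\<close> normalised).
  Minimise the gap over \<open>s\<close>. At a minimum \<open>q\<close> is orthogonal to \<open>1\<close> and \<open>x\<close>, and since \<open>u2 / u1\<close> is
  increasing, \<open>q\<close> has exactly the signs \<open>+, -, +\<close>. Subtracting from \<open>V\<close> the chord through the two
  sign changes shows that the derivative in \<open>t\<close> is nonnegative, so the minimal gap is smallest at
  \<open>t = 0\<close>. It remains to see that for the linear potential \<open>s x\<close> with \<open>s > 0\<close> the integral of \<open>x q\<close>
  is positive, so that the minimum at \<open>t = 0\<close> is attained for \<open>s = 0\<close>. Here \<open>\<alpha> \<ge> -1/L\<close> forces the node
  \<open>m\<close> of \<open>u2\<close> to be negative, and a comparison of \<open>u1, u2\<close> with their mirror images about \<open>m\<close>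
  gives \<open>q (m - s) \<le> q (m + s)\<close>.
\<close>

section \<open>Scalar differential equations and inequalities\<close>

text \<open>Angles make the Dirichlet condition an ordinary value, so boundary conditions can be
  moved along a segment. The minimal gap over s need not be differentiable in t, so it is never
  differentiated: if the bound failed by 2 \<open>\<epsilon>\<close>, the gap plus
  \<open>\<epsilon>\<close> t would have a minimum over a compact rectangle of (t, s), and
  first-order conditions are tested at that single point. To keep the minimum off the edges s = S
  and s = -S, the slope S must dominate the variation of V. This calls for a Lipschitz potential,
  while a bounded convex one may have infinite slope and a jump at an endpoint. The jump is
  invisible, since the equation is imposed on the open interval; the infinite slope is removed by
  dilating the variable and passing to the limit. On the edges the two end angles may differ and the
  symmetric argument for the node fails; there the steepness 8 pi^2 / R^3 forces the node to the low
  side. In the mirror comparison, logarithms of ratios turn differences of squares into hyperbolic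
  sines, so that the inequality follows from monotonicity statements.\<close>

lemma deriv_nonneg_mono:
  fixes f f' :: "real \<Rightarrow> real"
  assumes "p \<le> q" "continuous_on {p..q} f"
    and "\<And>x. p < x \<Longrightarrow> x < q \<Longrightarrow> (f has_real_derivative f' x) (at x)"
    and "\<And>x. p < x \<Longrightarrow> x < q \<Longrightarrow> 0 \<le> f' x"
  shows "f p \<le> f q"
  by (rule DERIV_nonneg_imp_increasing_open[OF assms(1) _ assms(2)]) (use assms in blast)

lemma deriv_pos_strict_mono:
  fixes f f' :: "real \<Rightarrow> real"
  assumes "p < q" "continuous_on {p..q} f"
    and "\<And>x. p < x \<Longrightarrow> x < q \<Longrightarrow> (f has_real_derivative f' x) (at x)"
    and "\<And>x. p < x \<Longrightarrow> x < q \<Longrightarrow> 0 < f' x"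
  shows "f p < f q"
  by (rule DERIV_pos_imp_increasing_open[OF assms(1) _ assms(2)]) (use assms in blast)

lemma deriv_nonpos_antimono:
  fixes f f' :: "real \<Rightarrow> real"
  assumes "p \<le> q" "continuous_on {p..q} f"
    and "\<And>x. p < x \<Longrightarrow> x < q \<Longrightarrow> (f has_real_derivative f' x) (at x)"
    and "\<And>x. p < x \<Longrightarrow> x < q \<Longrightarrow> f' x \<le> 0"
  shows "f q \<le> f p"
  by (rule DERIV_nonpos_imp_decreasing_open[OF assms(1) _ assms(2)]) (use assms in blast)

lemma continuous_on_if_deriv:
  fixes f f' :: "real \<Rightarrow> real"
  assumes "\<And>x. x \<in> S \<Longrightarrow> (f has_real_derivative f' x) (at x)"
  shows "continuous_on S f"
  using assms by (meson DERIV_isCont continuous_at_imp_continuous_on)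

text \<open>Continuing by the tangent lines at both ends turns one-sided derivatives into two-sided
  ones, so that differential equations on closed intervals can be stated with \<open>at x\<close>
  throughout.\<close>

lemma extend_deriv_beyond_interval:
  fixes f f' :: "real \<Rightarrow> real"
  assumes ab: "a < b"
    and f: "\<And>x. x \<in> {a..b} \<Longrightarrow> (f has_real_derivative f' x) (at x within {a..b})"
  obtains g where "\<And>x. x \<in> {a..b} \<Longrightarrow> g x = f x"
    and "\<And>x. x \<in> {a..b} \<Longrightarrow> (g has_real_derivative f' x) (at x)"
proof -
  define g where "g x = (if x < a then f a + f' a * (x - a)
      else if x > b then f b + f' b * (x - b) else f x)" for x
  have eq: "g x = f x" if "x \<in> {a..b}" for x
    using that by (auto simp: g_def)
  have gwithin: "(g has_real_derivative f' x) (at x within {a..b})" if "x \<in> {a..b}" for x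
    by (rule has_field_derivative_transform_within[OF f[OF that] zero_less_one that]) (simp add: eq)
  have "(g has_real_derivative f' x) (at x)" if x: "x \<in> {a..b}" for x
  proof -
    consider "x = a" | "x = b" | "a < x" "x < b" using x by force
    then show ?thesis
    proof cases
      case 1
      have r: "(g has_real_derivative f' a) (at_right a)"
        using gwithin[of a] ab 1 at_within_Icc_at_right[OF ab] by simp
      have l: "((\<lambda>y. (g y - g a) / (y - a)) \<longlongrightarrow> f' a) (at_left a)"
        by (rule tendsto_eventually) (use ab in \<open>auto simp: eventually_at_filter g_def\<close>)
      show ?thesis
        using l r unfolding 1 has_field_derivative_iff by (simp add: filterlim_at_split)
    next
      case 2
      have r: "(g has_real_derivative f' b) (at_left b)"
        using gwithin[of b] ab 2 at_within_Icc_at_left[OF ab] by simp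
      have l: "((\<lambda>y. (g y - g b) / (y - b)) \<longlongrightarrow> f' b) (at_right b)"
        by (rule tendsto_eventually) (use ab in \<open>auto simp: eventually_at_filter g_def\<close>)
      show ?thesis
        using l r unfolding 2 has_field_derivative_iff by (simp add: filterlim_at_split)
    next
      case 3
      then show ?thesis using gwithin[OF x] at_within_Icc_at[OF 3] by simp
    qed
  qed
  with eq that show ?thesis by blast
qed

text \<open>The Picard operator contracts with factor 1/2 on the whole interval at once if the sup
  norm carries the weight exp (- K (t - a)) with \<open>K = 2 * M\<close>, so short-time solutions
  need not be glued. Clamping the variable provides bounded continuous functions on the line, the
  complete space for the Banach fixed point theorem.\<close>

lemma picard_lindeloef:
  fixes F :: "real \<Rightarrow> real \<Rightarrow> real"
  assumes ab: "a < b" and M: "0 < M"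
    and cont: "\<And>y. continuous_on {a..b} y \<Longrightarrow> continuous_on {a..b} (\<lambda>t. F t (y t))"
    and lip: "\<And>t y z. t \<in> {a..b} \<Longrightarrow> \<bar>F t y - F t z\<bar> \<le> M * \<bar>y - z\<bar>"
  obtains y where "y a = y0"
    and "\<And>x. x \<in> {a..b} \<Longrightarrow> (y has_real_derivative F x (y x)) (at x)"
proof -
  define K where "K = 2 * M"
  have K: "K > 0" using M by (simp add: K_def)
  define y where "y z t = exp (K * (t - a)) * apply_bcontfun z t" for z t
  have ycont: "continuous_on S (y z)" for z S
    unfolding y_def by (intro continuous_intros) auto
  define I where "I z x = integral {a..x} (\<lambda>t. F t (y z t))" for z x
  have Ider: "(I z has_real_derivative F x (y z x)) (at x within {a..b})" if "x \<in> {a..b}" for z x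
    unfolding I_def by (rule integral_has_real_derivative[OF cont[OF ycont] that])
  have Fint: "(\<lambda>t. F t (y z t)) integrable_on {a..x}" if "x \<in> {a..b}" for z x
    by (rule integrable_on_subinterval[OF integrable_continuous_real[OF cont[OF ycont]]])
      (use that in auto)
  define P where "P z x = exp (- K * (x - a)) * (y0 + I z x)" for z x
  have Pcont: "continuous_on {a..b} (P z)" for z
    unfolding P_def by (intro continuous_intros DERIV_continuous_on[OF Ider]) auto
  have "\<exists>T. \<forall>x. apply_bcontfun T x = P z (clamp a b x)" for z
    using continuous_on_cbox_bcontfunE[of a b "P z"] Pcont[of z] by auto
  then obtain T where T: "\<And>z x. apply_bcontfun (T z) x = P z (clamp a b x)"
    by metis
  have "dist (T z) (T w) \<le> 1/2 * dist z w" for z w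
  proof (rule dist_bound)
    fix x
    define c where "c = clamp a b x"
    have c: "c \<in> {a..b}" using clamp_in_interval[of a b x] ab by (simp add: c_def)
    have "\<bar>F t (y z t) - F t (y w t)\<bar> \<le> M * dist z w * exp (K * (t - a))" if t: "t \<in> {a..c}" for t
    proof -
      have "\<bar>F t (y z t) - F t (y w t)\<bar> \<le> M * \<bar>y z t - y w t\<bar>"
        using lip t c by auto
      also have "\<bar>y z t - y w t\<bar> = exp (K * (t - a)) * dist (z t) (w t)"
        by (simp add: y_def dist_real_def abs_mult flip: right_diff_distrib)
      also have "\<dots> \<le> exp (K * (t - a)) * dist z w"
        by (intro mult_left_mono dist_bounded) auto
      finally show ?thesis using M by (simp add: mult_ac)
    qed note bound = this
    have hi: "((\<lambda>t. M * dist z w * exp (K * (t - a))) has_integral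
        (M * dist z w * (exp (K * (c - a)) / K) - M * dist z w * (exp (K * (a - a)) / K))) {a..c}"
      using c K by (intro fundamental_theorem_of_calculus)
        (auto intro!: derivative_eq_intros simp flip: has_real_derivative_iff_has_vector_derivative)
    have "\<bar>I z c - I w c\<bar> = \<bar>integral {a..c} (\<lambda>t. F t (y z t) - F t (y w t))\<bar>"
      unfolding I_def by (subst integral_diff) (use Fint c in auto)
    also have "\<dots> \<le> integral {a..c} (\<lambda>t. M * dist z w * exp (K * (t - a)))"
      using integral_norm_bound_integral[of "\<lambda>t. F t (y z t) - F t (y w t)" "{a..c}"
          "\<lambda>t. M * dist z w * exp (K * (t - a))"] bound hi Fint[OF c]
      by (auto simp: integrable_diff has_integral_integrable)
    also have "\<dots> = M * dist z w * (exp (K * (c - a)) - 1) / K"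
      using integral_unique[OF hi] by (simp add: field_simps diff_divide_distrib)
    also have "\<dots> = 1/2 * dist z w * (exp (K * (c - a)) - 1)"
      using M by (simp add: K_def)
    also have "\<dots> \<le> 1/2 * dist z w * exp (K * (c - a))"
      by (intro mult_left_mono) auto
    finally have le: "\<bar>I z c - I w c\<bar> \<le> 1/2 * dist z w * exp (K * (c - a))" .
    have "dist (T z x) (T w x) = exp (- K * (c - a)) * \<bar>I z c - I w c\<bar>"
      by (simp add: T dist_real_def P_def c_def abs_mult flip: right_diff_distrib)
    also have "\<dots> \<le> exp (- K * (c - a)) * (1/2 * dist z w * exp (K * (c - a)))"
      by (intro mult_left_mono le) auto
    also have "\<dots> = 1/2 * dist z w * (exp (- K * (c - a)) * exp (K * (c - a)))"
      by (simp only: mult_ac)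
    also have "exp (- K * (c - a)) * exp (K * (c - a)) = 1"
      by (simp flip: exp_add)
    also have "1/2 * dist z w * 1 = 1/2 * dist z w" by simp
    finally show "dist (T z x) (T w x) \<le> 1/2 * dist z w" .
  qed
  then obtain z where z: "T z = z"
    using banach_fix_type[of "1/2" T] by auto
  have fix_eq: "y z x = y0 + I z x" if "x \<in> {a..b}" for x
  proof -
    have "apply_bcontfun z x = P z x"
      using T[of z x] z that by simp
    then have "y z x = (exp (K * (x - a)) * exp (- K * (x - a))) * (y0 + I z x)"
      by (simp add: y_def P_def)
    also have "exp (K * (x - a)) * exp (- K * (x - a)) = 1" by (simp flip: exp_add)
    finally show ?thesis by simp
  qed
  have "(y z has_real_derivative F x (y z x)) (at x within {a..b})" if x: "x \<in> {a..b}" for x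
  proof -
    have "((\<lambda>x. y0 + I z x) has_real_derivative F x (y z x)) (at x within {a..b})"
      using Ider[OF x] by (auto intro!: derivative_eq_intros)
    then show ?thesis
      by (rule has_field_derivative_transform_within[OF _ zero_less_one x]) (simp add: fix_eq)
  qed
  then obtain g where g: "\<And>x. x \<in> {a..b} \<Longrightarrow> g x = y z x"
    and g': "\<And>x. x \<in> {a..b} \<Longrightarrow> (g has_real_derivative F x (y z x)) (at x)"
    using extend_deriv_beyond_interval[OF ab, of "y z" "\<lambda>x. F x (y z x)"] by metis
  show ?thesis
  proof
    show "g a = y0" using g[of a] fix_eq[of a] ab by (simp add: I_def)
    show "(g has_real_derivative F x (g x)) (at x)" if "x \<in> {a..b}" for x
      using g'[OF that] g[OF that] by simp
  qed
qed

text \<open>After the last point \<open>z\<close> at which \<open>D\<close> is nonnegative the bound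
  reads \<open>K * D t \<le> D' t\<close>, so \<open>D t * exp (- K * t)\<close> cannot decrease
  from its nonnegative value at \<open>z\<close>.\<close>

lemma differential_inequality_nonneg:
  fixes D D' :: "real \<Rightarrow> real"
  assumes "0 \<le> D a" and x: "x \<in> {a..b}"
    and D: "\<And>x. x \<in> {a..b} \<Longrightarrow> (D has_real_derivative D' x) (at x)"
    and D': "\<And>x. x \<in> {a..b} \<Longrightarrow> - K * \<bar>D x\<bar> \<le> D' x"
  shows "0 \<le> D x"
proof (rule ccontr)
  assume neg: "\<not> 0 \<le> D x"
  have cont: "continuous_on {a..x} D"
    by (rule continuous_on_if_deriv[OF D]) (use x in auto)
  define z where "z = Sup {t \<in> {a..x}. 0 \<le> D t}"
  have comp: "compact {t \<in> {a..x}. 0 \<le> D t}"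
    using continuous_closed_preimage[OF cont closed_atLeastAtMost closed_atLeast, of 0]
    by (auto simp: compact_eq_bounded_closed vimage_def Int_def intro: bounded_subset[OF bounded_closed_interval[of a x]])
  have ne: "{t \<in> {a..x}. 0 \<le> D t} \<noteq> {}" using assms(1) x by auto
  have z: "z \<in> {a..x}" "0 \<le> D z"
    using closed_contains_Sup[OF ne] comp unfolding z_def[symmetric]
    by (auto simp: compact_eq_bounded_closed bounded_imp_bdd_above)
  have after: "D t < 0" if "z < t" "t \<le> x" for t
  proof (rule ccontr)
    assume "\<not> D t < 0"
    then have "t \<le> z" unfolding z_def using that z
      by (intro cSup_upper) (auto intro: bounded_imp_bdd_above compact_imp_bounded[OF comp])
    with that show False by simp
  qed
  have zx: "z < x" using z neg by (cases "z = x") auto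
  have "D z * exp (- K * z) \<le> D x * exp (- K * x)"
  proof (rule deriv_nonneg_mono[where f = "\<lambda>t. D t * exp (- K * t)"])
    show "continuous_on {z..x} (\<lambda>t. D t * exp (- K * t))"
      by (intro continuous_intros continuous_on_subset[OF cont]) (use z in auto)
    fix t assume t: "z < t" "t < x"
    then have tI: "t \<in> {a..b}" using z x by auto
    show "((\<lambda>t. D t * exp (- K * t)) has_real_derivative (D' t - K * D t) * exp (- K * t)) (at t)"
      by (auto intro!: derivative_eq_intros D[OF tI] simp: algebra_simps)
    show "0 \<le> (D' t - K * D t) * exp (- K * t)"
      using D'[OF tI] after[of t] t by simp
  qed (use zx in auto)
  then have "0 \<le> D x * exp (- K * x)" using z(2)
    by (meson exp_ge_zero order_trans zero_le_mult_iff)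
  then show False using neg by (simp add: zero_le_mult_iff)
qed

text \<open>As \<open>D\<close> is nonnegative, \<open>D x * exp (K * x)\<close> is nondecreasing,
  so \<open>D b = 0\<close> would force \<open>D\<close> to vanish on the whole interval; the source
  \<open>g\<close> rules this out at \<open>t\<close>.\<close>

lemma differential_inequality_pos:
  fixes D D' g :: "real \<Rightarrow> real"
  assumes "0 \<le> D a" and ab: "a < b"
    and D: "\<And>x. x \<in> {a..b} \<Longrightarrow> (D has_real_derivative D' x) (at x)"
    and D': "\<And>x. x \<in> {a..b} \<Longrightarrow> - K * \<bar>D x\<bar> + g x \<le> D' x"
    and g0: "\<And>x. x \<in> {a..b} \<Longrightarrow> 0 \<le> g x"
    and t: "t \<in> {a<..<b}" and gt: "0 < g t"
  shows "0 < D b"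
proof (rule ccontr)
  assume neg: "\<not> 0 < D b"
  have nn: "0 \<le> D x" if "x \<in> {a..b}" for x
    by (rule differential_inequality_nonneg[OF assms(1) that D, of K]) (use D' g0 in force)+
  have mono: "D x * exp (K * x) \<le> D y * exp (K * y)" if xy: "a \<le> x" "x \<le> y" "y \<le> b" for x y
  proof (rule deriv_nonneg_mono[where f = "\<lambda>t. D t * exp (K * t)"])
    show "continuous_on {x..y} (\<lambda>t. D t * exp (K * t))"
      by (intro continuous_intros continuous_on_if_deriv[OF D]) (use xy in auto)
    fix t assume t: "x < t" "t < y"
    then have tI: "t \<in> {a..b}" using xy by auto
    show "((\<lambda>t. D t * exp (K * t)) has_real_derivative (D' t + K * D t) * exp (K * t)) (at t)"
      by (auto intro!: derivative_eq_intros D[OF tI] simp: algebra_simps)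
    show "0 \<le> (D' t + K * D t) * exp (K * t)"
      using D'[OF tI] nn[OF tI] g0[OF tI] by simp
  qed (use xy in auto)
  have z: "D x = 0" if "x \<in> {a..b}" for x
  proof -
    have "D b = 0" using nn[of b] ab neg by auto
    then have "D x * exp (K * x) \<le> 0" using mono[of x b] that by auto
    then show ?thesis using nn[OF that] by (simp add: mult_le_0_iff)
  qed
  have "((\<lambda>_. 0) has_real_derivative D' t) (at t)"
    by (rule has_field_derivative_transform_within_open[OF D open_greaterThanLessThan t])
      (use t z in auto)
  then have "D' t = 0" using DERIV_unique DERIV_const by blast
  then show False using D'[of t] gt z[of t] t by auto
qed

text \<open>The explicit function \<open>E\<close> is a supersolution, E' \<ge> K E + \<eta>.
  Applying \<open>differential_inequality_nonneg\<close> to E - D and E + D gives the two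
  sides.\<close>

lemma gronwall_abs:
  fixes D D' :: "real \<Rightarrow> real"
  assumes K: "0 \<le> K" and \<eta>: "0 \<le> \<eta>" and x: "x \<in> {a..b}"
    and D: "\<And>x. x \<in> {a..b} \<Longrightarrow> (D has_real_derivative D' x) (at x)"
    and D': "\<And>x. x \<in> {a..b} \<Longrightarrow> \<bar>D' x\<bar> \<le> K * \<bar>D x\<bar> + \<eta>"
  shows "\<bar>D x\<bar> \<le> (\<bar>D a\<bar> + \<eta> * (x - a)) * exp (K * (x - a))"
proof -
  define E where "E x = (\<bar>D a\<bar> + \<eta> * (x - a)) * exp (K * (x - a))" for x
  have Eder: "(E has_real_derivative K * E x + \<eta> * exp (K * (x - a))) (at x)" for x
    unfolding E_def by (auto intro!: derivative_eq_intros simp: algebra_simps)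
  have E0: "0 \<le> E x" if "x \<in> {a..b}" for x
    using that \<eta> by (auto simp: E_def)
  have ineq: "- K * \<bar>E x - G\<bar> \<le> K * E x + \<eta> * exp (K * (x - a)) - G'"
    if "x \<in> {a..b}" "\<bar>G'\<bar> \<le> K * \<bar>G\<bar> + \<eta>" for x G G'
  proof -
    have "\<bar>G\<bar> - E x \<le> \<bar>E x - G\<bar>" using E0[OF that(1)] by linarith
    then have "K * (\<bar>G\<bar> - E x) \<le> K * \<bar>E x - G\<bar>" using K by (intro mult_left_mono) auto
    moreover have "\<eta> * 1 \<le> \<eta> * exp (K * (x - a))"
      using \<eta> K that(1) by (intro mult_left_mono) auto
    ultimately show ?thesis using that(2) by (simp add: algebra_simps)
  qed
  have le: "G x \<le> E x"
    if G: "\<And>x. x \<in> {a..b} \<Longrightarrow> (G has_real_derivative G' x) (at x)"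
      and G': "\<And>x. x \<in> {a..b} \<Longrightarrow> \<bar>G' x\<bar> \<le> K * \<bar>G x\<bar> + \<eta>" and a: "G a \<le> \<bar>D a\<bar>"
    for G G'
  proof -
    have "0 \<le> E x - G x"
    proof (rule differential_inequality_nonneg[OF _ x, where K = K and D = "\<lambda>x. E x - G x" and
          D' = "\<lambda>x. K * E x + \<eta> * exp (K * (x - a)) - G' x"])
      fix t assume t: "t \<in> {a..b}"
      show "((\<lambda>x. E x - G x) has_real_derivative K * E t + \<eta> * exp (K * (t - a)) - G' t) (at t)"
        by (intro derivative_intros Eder G t)
      show "- K * \<bar>E t - G t\<bar> \<le> K * E t + \<eta> * exp (K * (t - a)) - G' t"
        by (rule ineq[OF t G'[OF t]])
    qed (use a in \<open>auto simp: E_def\<close>)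
    then show ?thesis by simp
  qed
  have "D x \<le> E x" by (rule le[OF D D']) auto
  moreover have "- D x \<le> E x"
    by (rule le[where G = "\<lambda>x. - D x" and G' = "\<lambda>x. - D' x"]) (use D D' in \<open>auto intro: DERIV_minus\<close>)
  ultimately show ?thesis unfolding E_def by linarith
qed

section \<open>Pruefer angles and eigenvalues\<close>

lemma sin_squared_lipschitz:
  fixes y z :: real
  shows "\<bar>(sin y)\<^sup>2 - (sin z)\<^sup>2\<bar> \<le> \<bar>y - z\<bar>"
proof -
  have "(sin y)\<^sup>2 - (sin z)\<^sup>2 = sin (y + z) * sin (y - z)"
    unfolding sin_add sin_diff
    using sin_cos_squared_add[of y] sin_cos_squared_add[of z] by algebra
  then have "\<bar>(sin y)\<^sup>2 - (sin z)\<^sup>2\<bar> = \<bar>sin (y + z)\<bar> * \<bar>sin (y - z)\<bar>"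
    by (simp add: abs_mult)
  also have "\<dots> \<le> 1 * \<bar>y - z\<bar>"
    by (intro mult_mono abs_sin_le_one abs_sin_x_le_abs_x) auto
  finally show ?thesis by simp
qed

text \<open>For u = r sin y and u' = r cos y the equation u'' = - c u becomes y' =
  \<open>pruefer_rhs c y\<close>; below, c is \<open>lam - U x\<close>.\<close>

definition pruefer_rhs :: "real \<Rightarrow> real \<Rightarrow> real" where
  "pruefer_rhs c y = (cos y)\<^sup>2 + c * (sin y)\<^sup>2"

lemma pruefer_rhs_alt: "pruefer_rhs c y = 1 + (c - 1) * (sin y)\<^sup>2"
  by (simp add: pruefer_rhs_def cos_squared_eq algebra_simps)

lemma pruefer_rhs_lipschitz:
  assumes "\<bar>c\<bar> \<le> C"
  shows "\<bar>pruefer_rhs c y - pruefer_rhs c z\<bar> \<le> (C + 1) * \<bar>y - z\<bar>"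
proof -
  have "\<bar>pruefer_rhs c y - pruefer_rhs c z\<bar> = \<bar>c - 1\<bar> * \<bar>(sin y)\<^sup>2 - (sin z)\<^sup>2\<bar>"
    by (simp add: pruefer_rhs_alt abs_mult flip: right_diff_distrib)
  also have "\<dots> \<le> (C + 1) * \<bar>y - z\<bar>"
    by (intro mult_mono sin_squared_lipschitz) (use assms in auto)
  finally show ?thesis .
qed

lemma pruefer_comparison:
  assumes "y a \<le> z a" and x: "x \<in> {a..b}"
    and y: "\<And>x. x \<in> {a..b} \<Longrightarrow> (y has_real_derivative y' x) (at x)"
    and z: "\<And>x. x \<in> {a..b} \<Longrightarrow> (z has_real_derivative z' x) (at x)"
    and y': "\<And>x. x \<in> {a..b} \<Longrightarrow> y' x \<le> pruefer_rhs (c x) (y x)"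
    and z': "\<And>x. x \<in> {a..b} \<Longrightarrow> pruefer_rhs (c x) (z x) \<le> z' x"
    and C: "\<And>x. x \<in> {a..b} \<Longrightarrow> \<bar>c x\<bar> \<le> C"
  shows "y x \<le> z x"
proof -
  have "0 \<le> z x - y x"
  proof (rule differential_inequality_nonneg[OF _ x, where K = "C + 1" and D' = "\<lambda>x. z' x - y' x"])
    fix t assume t: "t \<in> {a..b}"
    show "((\<lambda>x. z x - y x) has_real_derivative z' t - y' t) (at t)"
      by (intro derivative_intros y z t)
    show "- (C + 1) * \<bar>z t - y t\<bar> \<le> z' t - y' t"
      using pruefer_rhs_lipschitz[OF C[OF t], of "z t" "y t"] y'[OF t] z'[OF t] by linarith
  qed (use assms in auto)
  then show ?thesis by simp
qed

locale symmetric_interval =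
  fixes R :: real
  assumes R_pos: "0 < R"
begin

definition pruefer_solution :: "(real \<Rightarrow> real) \<Rightarrow> real \<Rightarrow> (real \<Rightarrow> real) \<Rightarrow> bool" where
  "pruefer_solution c A y \<longleftrightarrow> y (- R) = A \<and>
     (\<forall>x\<in>{-R..R}. (y has_real_derivative pruefer_rhs (c x) (y x)) (at x))"

definition angle :: "(real \<Rightarrow> real) \<Rightarrow> real \<Rightarrow> real \<Rightarrow> real" where
  "angle c A = (SOME y. pruefer_solution c A y)"

lemma continuous_bounded_obtain:
  fixes c :: "real \<Rightarrow> real"
  assumes "continuous_on {-R..R} c"
  obtains C where "0 < C" "\<And>x. x \<in> {-R..R} \<Longrightarrow> \<bar>c x\<bar> \<le> C"
proof -
  have "bounded (c ` {-R..R})"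
    by (intro compact_imp_bounded compact_continuous_image assms compact_Icc)
  then obtain C where "0 < C" "\<forall>x\<in>c ` {-R..R}. norm x \<le> C"
    unfolding bounded_pos by blast
  with that show ?thesis by auto
qed

lemma pruefer_solution_angle:
  assumes c: "continuous_on {-R..R} c"
  shows "pruefer_solution c A (angle c A)"
proof -
  obtain C where C: "0 < C" "\<And>x. x \<in> {-R..R} \<Longrightarrow> \<bar>c x\<bar> \<le> C"
    using continuous_bounded_obtain[OF c] by blast
  obtain y where "y (- R) = A"
      "\<And>x. x \<in> {-R..R} \<Longrightarrow> (y has_real_derivative pruefer_rhs (c x) (y x)) (at x)"
  proof (rule picard_lindeloef[of "-R" R "C + 1" "\<lambda>x. pruefer_rhs (c x)" A])
    show "continuous_on {-R..R} (\<lambda>t. pruefer_rhs (c t) (y t))" if "continuous_on {-R..R} y" for y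
      unfolding pruefer_rhs_def by (intro continuous_intros that c)
  qed (use R_pos C pruefer_rhs_lipschitz in auto)
  then show ?thesis
    unfolding angle_def pruefer_solution_def
    by (intro someI_ex[where P = "\<lambda>y. y (-R) = A \<and> (\<forall>x\<in>{-R..R}. (y has_real_derivative pruefer_rhs (c x) (y x)) (at x))"])
      blast
qed

lemma angle_init [simp]: "continuous_on {-R..R} c \<Longrightarrow> angle c A (- R) = A"
  using pruefer_solution_angle by (simp add: pruefer_solution_def)

lemma angle_deriv:
  "continuous_on {-R..R} c \<Longrightarrow> x \<in> {-R..R} \<Longrightarrow>
    (angle c A has_real_derivative pruefer_rhs (c x) (angle c A x)) (at x)"
  using pruefer_solution_angle by (simp add: pruefer_solution_def)

lemma continuous_on_angle: "continuous_on {-R..R} c \<Longrightarrow> continuous_on {-R..R} (angle c A)"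
  by (rule continuous_on_if_deriv[OF angle_deriv])

lemma angle_upper_bound:
  assumes c: "continuous_on {-R..R} c" and "A \<le> z (- R)" and x: "x \<in> {-R..R}"
    and z: "\<And>x. x \<in> {-R..R} \<Longrightarrow> (z has_real_derivative z' x) (at x)"
    and z': "\<And>x. x \<in> {-R..R} \<Longrightarrow> pruefer_rhs (c x) (z x) \<le> z' x"
  shows "angle c A x \<le> z x"
proof -
  obtain C where C: "\<And>x. x \<in> {-R..R} \<Longrightarrow> \<bar>c x\<bar> \<le> C"
    using continuous_bounded_obtain[OF c] by blast
  show ?thesis
    by (rule pruefer_comparison[OF _ x angle_deriv[OF c] z order_refl z' C]) (use assms in auto)
qed

text \<open>If the sine vanished on the whole open interval, so would its derivative; yet at a
  multiple of pi the right-hand side is 1 and the cosine is 1 or -1. This makes the solutions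
  nontrivial and the comparison below strict.\<close>

lemma sin_angle_nonzero:
  assumes c: "continuous_on {-R..R} c"
  obtains t where "t \<in> {-R<..<R}" "sin (angle c A t) \<noteq> 0"
proof (rule ccontr)
  note witness = that
  assume "\<not> thesis"
  then have z: "sin (angle c A t) = 0" if "t \<in> {-R<..<R}" for t
    using witness that by blast
  have 0: "0 \<in> {-R<..<R}" using R_pos by simp
  have "((\<lambda>t. sin (angle c A t)) has_real_derivative
      cos (angle c A 0) * pruefer_rhs (c 0) (angle c A 0)) (at 0)"
    using 0 by (auto intro!: derivative_eq_intros angle_deriv c)
  then have "((\<lambda>t. 0) has_real_derivative
      cos (angle c A 0) * pruefer_rhs (c 0) (angle c A 0)) (at 0)"
    by (rule has_field_derivative_transform_within_open[OF _ open_greaterThanLessThan 0]) (rule z)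
  then have "cos (angle c A 0) * pruefer_rhs (c 0) (angle c A 0) = 0"
    using DERIV_unique DERIV_const by blast
  then show False using z[OF 0] sin_cos_squared_add[of "angle c A 0"]
    by (auto simp: pruefer_rhs_def)
qed

text \<open>Sturm comparison: the difference of the angles has the source (d - c) times the squared
  sine of the lower angle, which is nonnegative and somewhere positive by
  \<open>sin_angle_nonzero\<close>.\<close>

lemma angle_strict_mono:
  assumes c: "continuous_on {-R..R} c" and d: "continuous_on {-R..R} d"
    and AB: "A \<le> B" and cd: "\<And>x. x \<in> {-R..R} \<Longrightarrow> c x < d x"
  shows "angle c A R < angle d B R"
proof -
  obtain C where C: "\<And>x. x \<in> {-R..R} \<Longrightarrow> \<bar>d x\<bar> \<le> C"
    using continuous_bounded_obtain[OF d] by blast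
  obtain t where t: "t \<in> {-R<..<R}" "sin (angle c A t) \<noteq> 0"
    using sin_angle_nonzero[OF c] by blast
  have "0 < angle d B R - angle c A R"
  proof (rule differential_inequality_pos[where a = "-R" and K = "C + 1"
        and D = "\<lambda>x. angle d B x - angle c A x"
        and g = "\<lambda>x. (d x - c x) * (sin (angle c A x))\<^sup>2" and t = t])
    fix x assume x: "x \<in> {-R..R}"
    show "((\<lambda>x. angle d B x - angle c A x) has_real_derivative
        pruefer_rhs (d x) (angle d B x) - pruefer_rhs (c x) (angle c A x)) (at x)"
      by (intro derivative_intros angle_deriv c d x)
    show "- (C + 1) * \<bar>angle d B x - angle c A x\<bar> + (d x - c x) * (sin (angle c A x))\<^sup>2
        \<le> pruefer_rhs (d x) (angle d B x) - pruefer_rhs (c x) (angle c A x)"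
    proof -
      have "pruefer_rhs (d x) (angle c A x) - pruefer_rhs (c x) (angle c A x)
          = (d x - c x) * (sin (angle c A x))\<^sup>2"
        by (simp add: pruefer_rhs_def algebra_simps)
      then show ?thesis
        using pruefer_rhs_lipschitz[OF C[OF x], of "angle d B x" "angle c A x"] by linarith
    qed
    show "0 \<le> (d x - c x) * (sin (angle c A x))\<^sup>2" using cd[OF x] by simp
  next
    show "0 < (d t - c t) * (sin (angle c A t))\<^sup>2" using cd[of t] t by auto
  qed (use R_pos AB c d t in auto)
  then show ?thesis by simp
qed

text \<open>At multiples of pi the angle has derivative 1 whatever \<open>c\<close> is, so each
  level k pi is passed at most once, and upward. This turns the angle into a count of zeros.\<close>

lemma angle_crosses_upward:
  assumes c: "continuous_on {-R..R} c" and p: "- R \<le> p" "p < x" "x \<le> R"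
    and k: "real k * pi \<le> angle c A p"
  shows "real k * pi < angle c A x"
proof -
  obtain C where C: "\<And>x. x \<in> {-R..R} \<Longrightarrow> \<bar>c x\<bar> \<le> C"
    using continuous_bounded_obtain[OF c] by blast
  have "0 < angle c A x - real k * pi"
  proof (rule differential_inequality_pos[where a = p and K = "C + 1" and g = "\<lambda>_. 1" and t = "(p + x) / 2"
        and D = "\<lambda>x. angle c A x - real k * pi"])
    fix t assume t: "t \<in> {p..x}"
    show "((\<lambda>x. angle c A x - real k * pi) has_real_derivative pruefer_rhs (c t) (angle c A t)) (at t)"
      using t p by (auto intro!: derivative_eq_intros angle_deriv c)
    have "pruefer_rhs (c t) (real k * pi) = 1" by (simp add: pruefer_rhs_alt)
    moreover have "\<bar>c t\<bar> \<le> C" using C t p by auto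
    ultimately show "- (C + 1) * \<bar>angle c A t - real k * pi\<bar> + 1 \<le> pruefer_rhs (c t) (angle c A t)"
      using pruefer_rhs_lipschitz[of "c t" C "angle c A t" "real k * pi"] by linarith
  qed (use p k in auto)
  then show ?thesis by simp
qed

text \<open>Gronwall estimate behind the continuity of the eigenvalues: one bound covers changes of
  the potential, of the spectral parameter and of the initial angle.\<close>

lemma angle_close:
  assumes c: "continuous_on {-R..R} c" and d: "continuous_on {-R..R} d"
    and C: "\<And>x. x \<in> {-R..R} \<Longrightarrow> \<bar>c x\<bar> \<le> C" and "0 \<le> \<eta>"
    and \<eta>: "\<And>x. x \<in> {-R..R} \<Longrightarrow> \<bar>d x - c x\<bar> \<le> \<eta>"
  shows "\<bar>angle d B R - angle c A R\<bar> \<le> (\<bar>B - A\<bar> + \<eta> * (2 * R)) * exp ((C + 1) * (2 * R))"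
proof -
  have C0: "0 \<le> C" using C[of 0] R_pos by auto
  have "\<bar>angle d B R - angle c A R\<bar> \<le> (\<bar>angle d B (-R) - angle c A (-R)\<bar> + \<eta> * (R - - R)) * exp ((C + 1) * (R - - R))"
  proof (rule gronwall_abs[where b = R
        and D' = "\<lambda>x. pruefer_rhs (d x) (angle d B x) - pruefer_rhs (c x) (angle c A x)"
        and D = "\<lambda>x. angle d B x - angle c A x"])
    fix x assume x: "x \<in> {-R..R}"
    show "((\<lambda>x. angle d B x - angle c A x) has_real_derivative
        pruefer_rhs (d x) (angle d B x) - pruefer_rhs (c x) (angle c A x)) (at x)"
      by (intro derivative_intros angle_deriv c d x)
    have "pruefer_rhs (d x) (angle d B x) - pruefer_rhs (c x) (angle d B x)
        = (d x - c x) * (sin (angle d B x))\<^sup>2"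
      by (simp add: pruefer_rhs_def algebra_simps)
    moreover have "\<bar>(d x - c x) * (sin (angle d B x))\<^sup>2\<bar> \<le> \<eta> * 1"
      unfolding abs_mult using \<eta>[OF x] by (intro mult_mono) (auto simp: abs_square_le_1)
    ultimately show "\<bar>pruefer_rhs (d x) (angle d B x) - pruefer_rhs (c x) (angle c A x)\<bar>
        \<le> (C + 1) * \<bar>angle d B x - angle c A x\<bar> + \<eta>"
      using pruefer_rhs_lipschitz[OF C[OF x], of "angle d B x" "angle c A x"] by linarith
  qed (use R_pos C0 assms in auto)
  then show ?thesis using c d by simp
qed

end

text \<open>The Wronskian \<open>W\<close> of \<open>u\<close> and the half wave sin (k (x - p)) is
  nonincreasing, because the wave is nonnegative on an interval of length pi / k. But its end values
  are - k u(p) < 0 and k u(q) \<ge> 0. In between, the sign of \<open>u\<close> is free.\<close>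

lemma sine_comparison:
  fixes u u' u'' :: "real \<Rightarrow> real"
  assumes pq: "p < q" and k: "k = pi / (q - p)"
    and u: "\<And>x. x \<in> {p..q} \<Longrightarrow> (u has_real_derivative u' x) (at x)"
    and u': "\<And>x. x \<in> {p..q} \<Longrightarrow> (u' has_real_derivative u'' x) (at x)"
    and u'': "\<And>x. x \<in> {p..q} \<Longrightarrow> u'' x \<le> - k\<^sup>2 * u x"
    and nonneg: "0 \<le> u q" and pos: "0 < u p"
  shows False
proof -
  define W where "W x = u' x * sin (k * (x - p)) - u x * (k * cos (k * (x - p)))" for x
  have kpos: "0 < k" using pq k by simp
  have W': "(W has_real_derivative (u'' x + k\<^sup>2 * u x) * sin (k * (x - p))) (at x)" if "x \<in> {p..q}" for x
    unfolding W_def using that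
    by (auto intro!: derivative_eq_intros u u' simp: algebra_simps power2_eq_square)
  have "W q \<le> W p"
  proof (rule deriv_nonpos_antimono[where f = W and f' = "\<lambda>x. (u'' x + k\<^sup>2 * u x) * sin (k * (x - p))"])
    show "continuous_on {p..q} W" by (rule continuous_on_if_deriv[OF W'])
    fix x assume x: "p < x" "x < q"
    show "(W has_real_derivative (u'' x + k\<^sup>2 * u x) * sin (k * (x - p))) (at x)"
      using W' x by auto
    have "k * (x - p) < pi" using x pq by (simp add: k field_simps)
    then have "0 \<le> sin (k * (x - p))" using x kpos by (intro sin_ge_zero) auto
    then show "(u'' x + k\<^sup>2 * u x) * sin (k * (x - p)) \<le> 0"
      using u''[of x] x by (intro mult_nonpos_nonneg) auto
  qed (use pq in auto)
  moreover have "k * (q - p) = pi" using pq k by simp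
  then have "W q = u q * k" by (simp add: W_def)
  moreover have "W p = - (u p * k)" by (simp add: W_def)
  ultimately show False
    using mult_pos_pos[OF pos kpos] mult_nonneg_nonneg[OF nonneg less_imp_le[OF kpos]] by linarith
qed

section \<open>Solutions in Pruefer coordinates\<close>

context symmetric_interval
begin

definition solves :: "(real \<Rightarrow> real) \<Rightarrow> real \<Rightarrow> (real \<Rightarrow> real) \<Rightarrow> (real \<Rightarrow> real) \<Rightarrow> bool" where
  "solves U lam u u' \<longleftrightarrow> (\<forall>x\<in>{-R..R}.
     (u has_real_derivative u' x) (at x) \<and> (u' has_real_derivative (U x - lam) * u x) (at x))"

abbreviation phase :: "(real \<Rightarrow> real) \<Rightarrow> real \<Rightarrow> real \<Rightarrow> real \<Rightarrow> real" where
  "phase U lam A \<equiv> angle (\<lambda>x. lam - U x) A"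

text \<open>Logarithm of the Pruefer radius. Its equation does not contain the radius, so it is
  solved by an integral, and exponentiating keeps the radius positive. The value 0 at
  \<open>- R\<close> makes the solution \<open>shot\<close> start from the unit vector (sin A, cos
  A).\<close>

definition log_amplitude :: "(real \<Rightarrow> real) \<Rightarrow> real \<Rightarrow> real \<Rightarrow> real \<Rightarrow> real" where
  "log_amplitude U lam A = (SOME l. l (- R) = 0 \<and> (\<forall>x\<in>{-R..R}.
     (l has_real_derivative (1 - (lam - U x)) * (sin (phase U lam A x) * cos (phase U lam A x))) (at x)))"

definition shot :: "(real \<Rightarrow> real) \<Rightarrow> real \<Rightarrow> real \<Rightarrow> real \<Rightarrow> real" where
  "shot U lam A x = exp (log_amplitude U lam A x) * sin (phase U lam A x)"

definition dshot :: "(real \<Rightarrow> real) \<Rightarrow> real \<Rightarrow> real \<Rightarrow> real \<Rightarrow> real" where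
  "dshot U lam A x = exp (log_amplitude U lam A x) * cos (phase U lam A x)"

lemma
  assumes U: "continuous_on {-R..R} U"
  shows log_amplitude_init: "log_amplitude U lam A (- R) = 0"
    and log_amplitude_deriv: "x \<in> {-R..R} \<Longrightarrow> (log_amplitude U lam A has_real_derivative
      (1 - (lam - U x)) * (sin (phase U lam A x) * cos (phase U lam A x))) (at x)"
proof -
  let ?g = "\<lambda>x. (1 - (lam - U x)) * (sin (phase U lam A x) * cos (phase U lam A x))"
  have c: "continuous_on {-R..R} (\<lambda>x. lam - U x)" by (intro continuous_intros U)
  have "continuous_on {-R..R} ?g" by (intro continuous_intros U continuous_on_angle c)
  then have "((\<lambda>x. integral {-R..x} ?g) has_real_derivative ?g x) (at x within {-R..R})"
    if "x \<in> {-R..R}" for x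
    using integral_has_real_derivative that by blast
  then obtain l where "\<And>x. x \<in> {-R..R} \<Longrightarrow> l x = integral {-R..x} ?g"
      and l: "\<And>x. x \<in> {-R..R} \<Longrightarrow> (l has_real_derivative ?g x) (at x)"
    using extend_deriv_beyond_interval[of "-R" R "\<lambda>x. integral {-R..x} ?g" ?g] R_pos by auto
  then have "l (- R) = 0" using R_pos by simp
  with l have "\<exists>l. l (- R) = 0 \<and> (\<forall>x\<in>{-R..R}. (l has_real_derivative ?g x) (at x))" by blast
  then have *: "log_amplitude U lam A (- R) = 0 \<and>
      (\<forall>x\<in>{-R..R}. (log_amplitude U lam A has_real_derivative ?g x) (at x))"
    unfolding log_amplitude_def by (rule someI_ex)
  then show "log_amplitude U lam A (- R) = 0" by blast
  show "(log_amplitude U lam A has_real_derivative ?g x) (at x)" if "x \<in> {-R..R}"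
    using * that by blast
qed

lemma solves_shot:
  assumes U: "continuous_on {-R..R} U"
  shows "solves U lam (shot U lam A) (dshot U lam A)"
  unfolding solves_def
proof (intro ballI conjI)
  fix x assume x: "x \<in> {-R..R}"
  have c: "continuous_on {-R..R} (\<lambda>x. lam - U x)" by (intro continuous_intros U)
  note d = angle_deriv[OF c x, of A] log_amplitude_deriv[OF U x, of lam A]
  let ?s = "sin (phase U lam A x)" and ?c = "cos (phase U lam A x)"
  have cc: "?c\<^sup>2 = 1 - ?s\<^sup>2" by (rule cos_squared_eq)
  have "(shot U lam A has_real_derivative
      exp (log_amplitude U lam A x) * ((1 - (lam - U x)) * (?s * ?c)) * ?s +
      (?c * pruefer_rhs (lam - U x) (phase U lam A x)) * exp (log_amplitude U lam A x)) (at x)"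
    unfolding shot_def[abs_def] by (rule DERIV_cong, (rule derivative_eq_intros d refl)+)
  also have "exp (log_amplitude U lam A x) * ((1 - (lam - U x)) * (?s * ?c)) * ?s +
      (?c * pruefer_rhs (lam - U x) (phase U lam A x)) * exp (log_amplitude U lam A x) = dshot U lam A x"
    unfolding dshot_def pruefer_rhs_def using cc by algebra
  finally show "(shot U lam A has_real_derivative dshot U lam A x) (at x)" .
  have "(dshot U lam A has_real_derivative
      exp (log_amplitude U lam A x) * ((1 - (lam - U x)) * (?s * ?c)) * ?c +
      (- ?s * pruefer_rhs (lam - U x) (phase U lam A x)) * exp (log_amplitude U lam A x)) (at x)"
    unfolding dshot_def[abs_def] by (rule DERIV_cong, (rule derivative_eq_intros d refl)+)
  also have "exp (log_amplitude U lam A x) * ((1 - (lam - U x)) * (?s * ?c)) * ?c +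
      (- ?s * pruefer_rhs (lam - U x) (phase U lam A x)) * exp (log_amplitude U lam A x)
      = (U x - lam) * shot U lam A x"
    unfolding shot_def pruefer_rhs_def using cc by algebra
  finally show "(dshot U lam A has_real_derivative (U x - lam) * shot U lam A x) (at x)" .
qed

lemma shot_init:
  assumes U: "continuous_on {-R..R} U"
  shows "shot U lam A (- R) = sin A" "dshot U lam A (- R) = cos A"
proof -
  have c: "continuous_on {-R..R} (\<lambda>x. lam - U x)" by (intro continuous_intros U)
  show "shot U lam A (- R) = sin A" "dshot U lam A (- R) = cos A"
    by (simp_all add: shot_def dshot_def log_amplitude_init[OF U] c)
qed

lemma solves_cont:
  assumes "solves U lam u u'"
  shows "continuous_on {-R..R} u" "continuous_on {-R..R} u'"
  by (rule continuous_on_if_deriv, use assms solves_def in blast)+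

text \<open>Gronwall for the squared distance in the phase plane, with products absorbed by 2 |e f|
  \<le> e^2 + f^2. Only \<open>u\<close> carries a bound \<open>N\<close>, so in a convergent family
  it can be taken from the limit.\<close>

lemma solves_close:
  assumes u: "solves U lam u u'" and v: "solves W mu v v'"
    and C: "\<And>x. x \<in> {-R..R} \<Longrightarrow> \<bar>W x - mu\<bar> \<le> C"
    and \<eta>: "\<And>x. x \<in> {-R..R} \<Longrightarrow> \<bar>(W x - mu) - (U x - lam)\<bar> \<le> \<eta>"
    and N: "\<And>x. x \<in> {-R..R} \<Longrightarrow> \<bar>u x\<bar> \<le> N"
    and x: "x \<in> {-R..R}"
  shows "(v x - u x)\<^sup>2 + (v' x - u' x)\<^sup>2 \<le>
    ((v (-R) - u (-R))\<^sup>2 + (v' (-R) - u' (-R))\<^sup>2 + \<eta>\<^sup>2 * N\<^sup>2 * (2 * R)) * exp ((2 + C) * (2 * R))"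
proof -
  have C0: "0 \<le> C" using C[of 0] R_pos by auto
  have e0: "0 \<le> \<eta>" using \<eta>[of 0] R_pos by auto
  define y where "y x = (v x - u x)\<^sup>2 + (v' x - u' x)\<^sup>2" for x
  define y' where "y' x = 2 * (v x - u x) * (v' x - u' x) +
      2 * (v' x - u' x) * ((W x - mu) * v x - (U x - lam) * u x)" for x
  have ynn: "0 \<le> y x" for x by (simp add: y_def)
  have "\<bar>y x\<bar> \<le> (\<bar>y (-R)\<bar> + \<eta>\<^sup>2 * N\<^sup>2 * (x - - R)) * exp ((2 + C) * (x - - R))"
  proof (rule gronwall_abs[OF _ _ x, where D' = y'])
    fix x assume x: "x \<in> {-R..R}"
    show "(y has_real_derivative y' x) (at x)"
      unfolding y_def[abs_def] y'_def using u v x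
      by (auto simp: solves_def algebra_simps intro!: derivative_eq_intros)
    define e where "e = v x - u x"
    define f where "f = v' x - u' x"
    define w where "w = (W x - mu) - (U x - lam)"
    have eq: "y' x = 2 * (e * f) + 2 * ((W x - mu) * (e * f)) + 2 * (f * (w * u x))"
      by (simp add: y'_def e_def f_def w_def algebra_simps)
    have ef: "2 * \<bar>e * f\<bar> \<le> y x"
      using sum_squares_bound[of "\<bar>e\<bar>" "\<bar>f\<bar>"] by (simp add: y_def e_def f_def abs_mult)
    have Wef: "2 * \<bar>(W x - mu) * (e * f)\<bar> \<le> C * y x"
      using mult_mono[OF C[OF x] ef C0] by (simp add: abs_mult)
    have "\<bar>w * u x\<bar> \<le> \<eta> * N"
      unfolding abs_mult w_def by (intro mult_mono \<eta> N x e0) auto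
    then have "(w * u x)\<^sup>2 \<le> \<eta>\<^sup>2 * N\<^sup>2"
      by (metis abs_le_square_iff abs_ge_zero abs_of_nonneg order_trans power_mult_distrib)
    moreover have "2 * \<bar>f * (w * u x)\<bar> \<le> f\<^sup>2 + (w * u x)\<^sup>2"
      using sum_squares_bound[of "\<bar>f\<bar>" "\<bar>w * u x\<bar>"] by (simp add: abs_mult power_mult_distrib mult_ac)
    ultimately have "2 * \<bar>f * (w * u x)\<bar> \<le> y x + \<eta>\<^sup>2 * N\<^sup>2"
      using zero_le_power2[of e] unfolding y_def e_def[symmetric] f_def[symmetric] by linarith
    moreover have "(2 + C) * \<bar>y x\<bar> = 2 * y x + C * y x"
      using ynn[of x] by (simp add: algebra_simps)
    ultimately show "\<bar>y' x\<bar> \<le> (2 + C) * \<bar>y x\<bar> + \<eta>\<^sup>2 * N\<^sup>2"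
      using ef Wef unfolding eq by linarith
  qed (use C0 in auto)
  also have "\<dots> \<le> (y (-R) + \<eta>\<^sup>2 * N\<^sup>2 * (2 * R)) * exp ((2 + C) * (2 * R))"
    using x C0 ynn[of "-R"] R_pos
    by (intro mult_mono add_mono mult_left_mono) (auto intro!: add_nonneg_nonneg mult_nonneg_nonneg)
  finally show ?thesis by (simp add: y_def)
qed

section \<open>Eigenvalues as levels of the phase\<close>

text \<open>A boundary angle matters only modulo pi, so [0, pi) lists every condition once; 0 is
  Dirichlet.\<close>

definition admissible :: "real \<Rightarrow> bool" where
  "admissible A \<longleftrightarrow> 0 \<le> A \<and> A < pi"

lemma cont_shift:
  fixes U :: "real \<Rightarrow> real"
  shows "continuous_on {-R..R} U \<Longrightarrow> continuous_on {-R..R} (\<lambda>x. lam - U x)"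
  by (intro continuous_intros)

lemma phase_strict_mono:
  assumes "continuous_on {-R..R} U" "lam < mu"
  shows "phase U lam A R < phase U mu A R"
  by (rule angle_strict_mono) (use assms cont_shift in auto)

lemma continuous_phase:
  assumes U: "continuous_on {-R..R} U"
  shows "continuous_on S (\<lambda>lam. phase U lam A R)"
proof (intro continuous_at_imp_continuous_on ballI)
  fix lam
  obtain C where C: "0 < C" "\<And>x. x \<in> {-R..R} \<Longrightarrow> \<bar>lam - U x\<bar> \<le> C"
    using continuous_bounded_obtain[OF cont_shift[OF U]] by blast
  have "((\<lambda>mu. phase U mu A R - phase U lam A R) \<longlongrightarrow> 0) (at lam)"
  proof (rule Lim_null_comparison)
    show "\<forall>\<^sub>F mu in at lam. norm (phase U mu A R - phase U lam A R)
        \<le> (\<bar>A - A\<bar> + \<bar>mu - lam\<bar> * (2 * R)) * exp ((C + 1) * (2 * R))"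
    proof (rule always_eventually, rule allI)
      fix mu
      show "norm (phase U mu A R - phase U lam A R)
        \<le> (\<bar>A - A\<bar> + \<bar>mu - lam\<bar> * (2 * R)) * exp ((C + 1) * (2 * R))"
        unfolding real_norm_def
        by (rule angle_close[OF cont_shift[OF U] cont_shift[OF U] C(2)]) auto
    qed
    have "((\<lambda>mu. \<bar>mu - lam\<bar>) \<longlongrightarrow> \<bar>lam - lam\<bar>) (at lam)" by (intro tendsto_intros)
    then have "((\<lambda>mu. (\<bar>A - A\<bar> + \<bar>mu - lam\<bar> * (2 * R)) * exp ((C + 1) * (2 * R)))
      \<longlongrightarrow> (\<bar>A - A\<bar> + \<bar>lam - lam\<bar> * (2 * R)) * exp ((C + 1) * (2 * R))) (at lam)"
      by (intro tendsto_intros)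
    then show "((\<lambda>mu. (\<bar>A - A\<bar> + \<bar>mu - lam\<bar> * (2 * R)) * exp ((C + 1) * (2 * R))) \<longlongrightarrow> 0) (at lam)"
      by simp
  qed
  then show "isCont (\<lambda>lam. phase U lam A R) lam"
    unfolding isCont_def by (simp add: LIM_zero_iff)
qed

text \<open>For very negative \<open>lam\<close> a straight line falling from \<open>A'\<close> to
  \<open>e\<close> lies above the phase. Starting at the midpoint \<open>A'\<close> of
  \<open>A\<close> and pi keeps the line inside (0, pi) even for \<open>A = 0\<close>, so the sine
  along it is at least \<open>s > 0\<close>. Then \<open>lam\<close> is chosen to push the
  right-hand side down to - pi / (2 R), which does not exceed the slope of the line.\<close>

lemma phase_small:
  assumes U: "continuous_on {-R..R} U" and A: "admissible A" and B: "admissible B"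
  obtains lam where "phase U lam A R \<le> pi - B"
proof -
  obtain C where C: "\<And>x. x \<in> {-R..R} \<Longrightarrow> \<bar>U x\<bar> \<le> C"
    using continuous_bounded_obtain[OF U] by blast
  define A' where "A' = (A + pi) / 2"
  define e where "e = min (pi - B) A'"
  have e: "0 < e" "e \<le> A'" "e \<le> pi - B" "A \<le> A'" "A' < pi"
    using A B pi_gt_zero by (auto simp: e_def A'_def admissible_def min_def)
  have "\<exists>z\<in>{e..A'}. \<forall>y\<in>{e..A'}. sin z \<le> sin y"
    by (intro continuous_attains_inf continuous_intros compact_Icc) (use e in auto)
  then obtain z0 where z0: "z0 \<in> {e..A'}" "\<And>y. y \<in> {e..A'} \<Longrightarrow> sin z0 \<le> sin y" by blast
  define s where "s = sin z0"
  have s: "0 < s" unfolding s_def using z0 e by (intro sin_gt_zero) auto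
  define lam where "lam = - C - (1 + pi / (2 * R)) / s\<^sup>2"
  define z where "z x = A' + (e - A') * ((x + R) / (2 * R))" for x
  have "phase U lam A R \<le> z R"
  proof (rule angle_upper_bound[OF cont_shift[OF U], where z' = "\<lambda>_. (e - A') / (2 * R)"])
    fix x assume x: "x \<in> {-R..R}"
    show "(z has_real_derivative (e - A') / (2 * R)) (at x)"
      unfolding z_def[abs_def] using R_pos
      by (auto intro!: derivative_eq_intros) (simp add: field_simps)
    define t where "t = (x + R) / (2 * R)"
    have t: "0 \<le> t" "t \<le> 1" using x R_pos by (auto simp: t_def field_simps)
    have "(e - A') * t \<le> 0" using e t by (intro mult_nonpos_nonneg) auto
    moreover have "(A' - e) * t \<le> (A' - e) * 1" using e t by (intro mult_left_mono) auto
    ultimately have "z x \<in> {e..A'}" unfolding z_def t_def[symmetric] by (simp add: algebra_simps)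
    then have "s\<^sup>2 \<le> (sin (z x))\<^sup>2" using z0(2) s unfolding s_def by (intro power_mono) auto
    moreover have "lam - U x \<le> - ((1 + pi / (2 * R)) / s\<^sup>2)" using C[OF x] by (simp add: lam_def)
    then have "(lam - U x) * (sin (z x))\<^sup>2 \<le> - ((1 + pi / (2 * R)) / s\<^sup>2) * (sin (z x))\<^sup>2"
      by (intro mult_right_mono) auto
    moreover have "(1 + pi / (2 * R)) / s\<^sup>2 * s\<^sup>2 \<le> (1 + pi / (2 * R)) / s\<^sup>2 * (sin (z x))\<^sup>2"
      using R_pos calculation(1) by (intro mult_left_mono) auto
    moreover have "(cos (z x))\<^sup>2 \<le> 1" by (simp add: abs_square_le_1)
    moreover have "- (pi / (2 * R)) \<le> (e - A') / (2 * R)"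
      using e R_pos by (simp add: divide_simps)
    ultimately show "pruefer_rhs (lam - U x) (z x) \<le> (e - A') / (2 * R)"
      using s by (simp add: pruefer_rhs_def)
  qed (use e R_pos in \<open>auto simp: z_def\<close>)
  also have "z R = e" using R_pos by (simp add: z_def)
  finally have "phase U lam A R \<le> pi - B" using e by linarith
  then show ?thesis by (rule that)
qed

text \<open>Level 2 pi is enough for the first two eigenvalues. If it were not reached, the solution
  would keep one sign on [- R, 0] or on [0, R], which \<open>sine_comparison\<close> excludes on a
  window of length R / 2; the 2 pi / R in \<open>lam\<close> is pi divided by this length.\<close>

lemma phase_large:
  assumes U: "continuous_on {-R..R} U" and A: "admissible A"
  obtains lam where "2 * pi \<le> phase U lam A R"
proof -
  obtain C where C: "\<And>x. x \<in> {-R..R} \<Longrightarrow> \<bar>U x\<bar> \<le> C"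
    using continuous_bounded_obtain[OF U] by blast
  define lam where "lam = C + (2 * pi / R)\<^sup>2"
  define th where "th = phase U lam A"
  have c: "continuous_on {-R..R} (\<lambda>x. lam - U x)" by (rule cont_shift[OF U])
  have le: "(2 * pi / R)\<^sup>2 \<le> lam - U x" if "x \<in> {-R..R}" for x
    using C[OF that] by (simp add: lam_def)
  have up: "real k * pi < th x" if "- R \<le> p" "p < x" "x \<le> R" "real k * pi \<le> th p" for k p x
    using angle_crosses_upward[OF c that(1-3)] that(4) by (simp add: th_def)
  have d: "(shot U lam A has_real_derivative dshot U lam A x) (at x)"
      "(dshot U lam A has_real_derivative (U x - lam) * shot U lam A x) (at x)" if "x \<in> {-R..R}" for x
    using solves_shot[OF U] that by (auto simp: solves_def)
  have u: "shot U lam A x = exp (log_amplitude U lam A x) * sin (th x)" for x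
    by (simp add: shot_def th_def)
  have pos: "0 < th x" if "- R < x" "x \<le> R" for x
    using up[of "-R" x 0] that A c by (simp add: th_def admissible_def)
  have "2 * pi \<le> th R"
  proof (rule ccontr)
    assume "\<not> 2 * pi \<le> th R"
    then have lt: "th x \<le> 2 * pi" if "x \<in> {-R..R}" for x
      using up[of x R 2] that by (cases "x = R"; cases "2 * pi \<le> th x"; auto)
    have below: "th x < real k * pi" if "th y \<le> real k * pi" "- R \<le> x" "x < y" "y \<le> R" for x y k
      using up[of x y k] that by force
    show False
    proof (cases "th 0 \<le> pi")
      case True
      then have b: "th x \<le> pi" if "- R \<le> x" "x \<le> 0" for x
        using below[of 0 1 x] that R_pos by (cases "x = 0") auto
      show False
      proof (rule sine_comparison[of "- R / 2" 0 "2 * pi / R"])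
        show "0 \<le> shot U lam A 0"
          using b[of 0] pos[of 0] R_pos unfolding u by (simp add: sin_ge_zero)
        show "0 < shot U lam A (- R / 2)"
          using below[of 0 1 "- R/2"] True pos[of "- R / 2"] R_pos unfolding u by (simp add: sin_gt_zero)
        fix x assume x: "x \<in> {- R / 2..0}"
        then have x': "x \<in> {-R..R}" using R_pos by auto
        show "(shot U lam A has_real_derivative dshot U lam A x) (at x)"
          "(dshot U lam A has_real_derivative (U x - lam) * shot U lam A x) (at x)"
          using d[OF x'] by auto
        have "0 \<le> shot U lam A x"
          using b[of x] pos[of x] x R_pos unfolding u by (simp add: sin_ge_zero)
        then have "(2 * pi / R)\<^sup>2 * shot U lam A x \<le> (lam - U x) * shot U lam A x"
          using le[OF x'] by (intro mult_right_mono)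
        then show "(U x - lam) * shot U lam A x \<le> - (2 * pi / R)\<^sup>2 * shot U lam A x"
          by (simp add: algebra_simps)
      qed (use R_pos in auto)
    next
      case False
      then have b: "pi < th x" if "0 \<le> x" "x \<le> R" for x
        using up[of 0 x 1] that R_pos by (cases "x = 0") auto
      have sneg: "sin (th x) \<le> 0" if "0 \<le> x" "x \<le> R" for x
        using b[OF that] lt[of x] that R_pos sin_ge_zero[of "th x - pi"] by simp
      show False
      proof (rule sine_comparison[of "R / 2" R "2 * pi / R" "\<lambda>x. - shot U lam A x" "\<lambda>x. - dshot U lam A x"])
        show "0 \<le> - shot U lam A R"
          using sneg[of R] R_pos unfolding u by (simp add: mult_nonneg_nonpos)
        have "th (R/2) < 2 * pi"
          using below[of R 2 "R/2"] lt[of R] R_pos by simp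
        then have "sin (th (R/2)) < 0"
          using b[of "R/2"] R_pos sin_gt_zero[of "th (R/2) - pi"] by simp
        then show "0 < - shot U lam A (R / 2)"
          unfolding u by (simp add: mult_pos_neg)
        fix x assume x: "x \<in> {R / 2..R}"
        then have x': "x \<in> {-R..R}" using R_pos by auto
        show "((\<lambda>x. - shot U lam A x) has_real_derivative - dshot U lam A x) (at x)"
          "((\<lambda>x. - dshot U lam A x) has_real_derivative - ((U x - lam) * shot U lam A x)) (at x)"
          by (intro DERIV_minus d x')+
        have "shot U lam A x \<le> 0"
          using sneg[of x] x R_pos unfolding u by (simp add: mult_nonneg_nonpos)
        then have "(lam - U x) * shot U lam A x \<le> (2 * pi / R)\<^sup>2 * shot U lam A x"
          using le[OF x'] by (intro mult_right_mono_neg)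
        then show "- ((U x - lam) * shot U lam A x) \<le> - (2 * pi / R)\<^sup>2 * - shot U lam A x"
          by (simp add: algebra_simps)
      qed (use R_pos in auto)
    qed
  qed
  with that show ?thesis by (simp add: th_def)
qed

text \<open>The solution starting with angle \<open>A\<close> meets the right condition iff the sine
  of its final angle plus \<open>B\<close> vanishes, which gives the levels n pi - B. Strict
  monotonicity in \<open>lam\<close> yields uniqueness; for n = 1, 2 existence comes from
  \<open>phase_small\<close> and \<open>phase_large\<close>.\<close>

definition eig :: "nat \<Rightarrow> (real \<Rightarrow> real) \<Rightarrow> real \<Rightarrow> real \<Rightarrow> real" where
  "eig n U A B = (THE lam. phase U lam A R = real n * pi - B)"

lemma phase_inj:
  assumes "continuous_on {-R..R} U" "phase U lam A R = phase U mu A R"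
  shows "lam = mu"
  using phase_strict_mono[OF assms(1), of lam mu A] phase_strict_mono[OF assms(1), of mu lam A] assms(2)
  by (cases lam mu rule: linorder_cases) auto

lemma phase_eig:
  assumes U: "continuous_on {-R..R} U" and A: "admissible A" and B: "admissible B"
    and n: "n \<in> {1, 2}"
  shows "phase U (eig n U A B) A R = real n * pi - B"
proof -
  obtain l where l: "phase U l A R \<le> pi - B" using phase_small[OF assms(1-3)] .
  obtain m where m: "2 * pi \<le> phase U m A R" using phase_large[OF assms(1-2)] .
  have b: "phase U l A R \<le> real n * pi - B" "real n * pi - B \<le> phase U m A R"
    using n l m B pi_gt_zero by (auto simp: admissible_def)
  have "l \<le> m"
    using phase_strict_mono[OF U, of m l A] b by (cases "l \<le> m") auto
  then obtain lam where "phase U lam A R = real n * pi - B"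
    using IVT'[OF b _ continuous_phase[OF U]] by blast
  then show ?thesis
    unfolding eig_def
  proof (rule theI)
    show "mu = lam" if "phase U mu A R = real n * pi - B" for mu
      by (rule phase_inj[OF U, where A = A]) (use that \<open>phase U lam A R = real n * pi - B\<close> in simp)
  qed
qed

lemma eig_le_iff:
  assumes U: "continuous_on {-R..R} U" and A: "admissible A" and B: "admissible B"
    and n: "n \<in> {1, 2}"
  shows "eig n U A B \<le> lam \<longleftrightarrow> real n * pi - B \<le> phase U lam A R"
    and "lam \<le> eig n U A B \<longleftrightarrow> phase U lam A R \<le> real n * pi - B"
proof -
  note e = phase_eig[OF assms]
  note m = phase_strict_mono[OF U, of lam "eig n U A B" A] phase_strict_mono[OF U, of "eig n U A B" lam A]
  show "eig n U A B \<le> lam \<longleftrightarrow> real n * pi - B \<le> phase U lam A R"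
    "lam \<le> eig n U A B \<longleftrightarrow> phase U lam A R \<le> real n * pi - B"
    using m e by (cases lam "eig n U A B" rule: linorder_cases; simp)+
qed

lemma eig_less:
  assumes "continuous_on {-R..R} U" "admissible A" "admissible B"
  shows "eig 1 U A B < eig 2 U A B"
  using eig_le_iff(1)[OF assms, of 2 "eig 1 U A B"] phase_eig[OF assms, of 1] pi_gt_zero
  by (simp flip: not_le)

text \<open>Here \<open>u\<close> is a candidate from \<open>is_eigenvalue\<close>, whose two-sided
  derivatives are known in the open interval only; continuity carries the constant to the
  endpoints.\<close>

lemma wronskian_constant:
  assumes U: "continuous_on {-R..R} U" and v: "solves U lam v v'"
    and u: "continuous_on {-R..R} u" "continuous_on {-R..R} u'"
    and du: "\<And>x. x \<in> {-R<..<R} \<Longrightarrow> (u has_real_derivative u' x) (at x)"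
    and du': "\<And>x. x \<in> {-R<..<R} \<Longrightarrow> (u' has_real_derivative (U x - lam) * u x) (at x)"
    and x: "x \<in> {-R..R}"
  shows "u' x * v x - u x * v' x = u' (-R) * v (-R) - u (-R) * v' (-R)"
proof (rule DERIV_isconst2[where f = "\<lambda>x. u' x * v x - u x * v' x"])
  show "continuous_on {-R..R} (\<lambda>x. u' x * v x - u x * v' x)"
    by (intro continuous_intros u solves_cont[OF v])
  fix t assume "- R < t" "t < R"
  then have t: "t \<in> {-R<..<R}" and t': "t \<in> {-R..R}" by auto
  show "((\<lambda>x. u' x * v x - u x * v' x) has_real_derivative 0) (at t)"
    using v t' by (auto intro!: derivative_eq_intros du[OF t] du'[OF t] simp: solves_def algebra_simps)
qed (use x R_pos in auto)

text \<open>The equation is imposed on the open interval, so \<open>V\<close> has to agree with the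
  continuous \<open>U\<close> only there. An eigenfunction has zero Wronskian with the solution shot
  from angle \<open>A\<close>; hence the two are parallel at \<open>R\<close>, and the right
  condition fixes the phase modulo pi.\<close>

lemma is_eigenvalue_iff:
  assumes U: "continuous_on {-R..R} U" and UV: "\<And>x. x \<in> {-R<..<R} \<Longrightarrow> V x = U x"
    and A: "admissible A" and B: "admissible B"
    and left: "\<And>u du. bc_left \<alpha> u du \<longleftrightarrow> u * cos A = du * sin A"
    and right: "\<And>u du. bc_right \<beta> u du \<longleftrightarrow> u * cos B = - du * sin B"
  shows "is_eigenvalue V (2 * R) \<alpha> \<beta> lam \<longleftrightarrow> (\<exists>n\<ge>1. phase U lam A R = real n * pi - B)"
proof
  assume "is_eigenvalue V (2 * R) \<alpha> \<beta> lam"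
  moreover have "- (2 * R) / 2 = - R" "2 * R / 2 = R" by simp_all
  ultimately obtain u u' where ne: "\<exists>x\<in>{-R..R}. u x \<noteq> 0"
    and cu': "continuous_on {-R..R} u'"
    and du: "\<And>x. x \<in> {-R..R} \<Longrightarrow> (u has_real_derivative u' x) (at x within {-R..R})"
    and du': "\<And>x. x \<in> {-R<..<R} \<Longrightarrow> (u' has_real_derivative (V x - lam) * u x) (at x)"
    and bl: "bc_left \<alpha> (u (-R)) (u' (-R))" and br: "bc_right \<beta> (u R) (u' R)"
    unfolding is_eigenvalue_def by metis
  have cu: "continuous_on {-R..R} u" by (rule DERIV_continuous_on[OF du])
  have dui: "(u has_real_derivative u' x) (at x)" if "x \<in> {-R<..<R}" for x
    using du[of x] at_within_Icc_at[of "-R" x R] that by auto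
  have dui': "(u' has_real_derivative (U x - lam) * u x) (at x)" if "x \<in> {-R<..<R}" for x
    using du'[OF that] UV[OF that] by simp
  have W: "u' x * shot U lam D x - u x * dshot U lam D x
      = u' (-R) * sin D - u (-R) * cos D" if "x \<in> {-R..R}" for x D
    using wronskian_constant[OF U solves_shot[OF U] cu cu' dui dui' that, of D] shot_init[OF U] by simp
  have RI: "R \<in> {-R..R}" using R_pos by auto
  \<comment> \<open>The shots with angles 0 and pi / 2 form a fundamental system: zero data at
    \<open>R\<close> give zero Wronskian with both, hence the zero function.\<close>
  have nz: "u R \<noteq> 0 \<or> u' R \<noteq> 0"
  proof (rule ccontr)
    assume "\<not> (u R \<noteq> 0 \<or> u' R \<noteq> 0)"
    then have z: "u' (-R) * sin D - u (-R) * cos D = 0" for D using W[OF RI, of D] by simp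
    have "u x = 0" if x: "x \<in> {-R..R}" for x
    proof -
      have "dshot U lam 0 x * shot U lam (pi/2) x - shot U lam 0 x * dshot U lam (pi/2) x = 1"
        using wronskian_constant[OF U solves_shot[OF U, of lam "pi/2"]
            solves_cont[OF solves_shot[OF U, of lam 0]] _ _ x] solves_shot[OF U, of lam 0]
        by (simp add: solves_def shot_init[OF U])
      moreover have "u' x * shot U lam 0 x = u x * dshot U lam 0 x"
        "u' x * shot U lam (pi/2) x = u x * dshot U lam (pi/2) x"
        using W[OF x, of 0] W[OF x, of "pi/2"] z[of 0] z[of "pi/2"] by auto
      ultimately show ?thesis by algebra
    qed
    with ne show False by blast
  qed
  define th where "th = phase U lam A R"
  have "u' R * shot U lam A R - u R * dshot U lam A R = 0"
    using W[OF RI, of A] bl left by auto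
  then have "exp (log_amplitude U lam A R) * (u' R * sin th - u R * cos th) = 0"
    by (simp add: shot_def dshot_def th_def algebra_simps)
  then have "u' R * sin th = u R * cos th" by simp
  moreover have "u R * cos B = - u' R * sin B" using br right by auto
  ultimately have "u R * sin (th + B) = 0" "u' R * sin (th + B) = 0"
    unfolding sin_add by algebra+
  then have "sin (th + B) = 0" using nz by auto
  then obtain i :: int where i: "th + B = of_int i * pi" by (auto simp: sin_zero_iff_int2)
  \<comment> \<open>Positivity of the phase excludes the levels n \<le> 0, so counting starts at n =
    1.\<close>
  have "0 < th"
    using angle_crosses_upward[OF cont_shift[OF U, of lam], of "-R" R 0 A] A R_pos cont_shift[OF U]
    by (simp add: th_def admissible_def)
  then have "0 < of_int i * pi" using B i by (simp add: admissible_def)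
  then have "0 < i" by (simp add: zero_less_mult_iff)
  then have "phase U lam A R = real (nat i) * pi - B" "1 \<le> nat i" using i by (auto simp: th_def)
  then show "\<exists>n\<ge>1. phase U lam A R = real n * pi - B" by blast
next
  assume "\<exists>n\<ge>1. phase U lam A R = real n * pi - B"
  then obtain n :: nat where n: "phase U lam A R = real n * pi - B" by blast
  note s = solves_shot[OF U, of lam A]
  obtain t where "t \<in> {-R<..<R}" "sin (phase U lam A t) \<noteq> 0"
    using sin_angle_nonzero[OF cont_shift[OF U]] by blast
  then have "\<exists>x\<in>{-R..R}. shot U lam A x \<noteq> 0"
    by (intro bexI[of _ t]) (auto simp: shot_def)
  moreover have "shot U lam A R * cos B = - dshot U lam A R * sin B"
  proof -
    have "sin (phase U lam A R + B) = 0" using n by simp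
    then have "exp (log_amplitude U lam A R) * (sin (phase U lam A R) * cos B + cos (phase U lam A R) * sin B) = 0"
      by (simp add: sin_add)
    then show ?thesis by (simp add: shot_def dshot_def algebra_simps)
  qed
  ultimately show "is_eigenvalue V (2 * R) \<alpha> \<beta> lam"
    unfolding is_eigenvalue_def left right
    using s solves_cont[OF s] UV
    by (intro exI[of _ "shot U lam A"] exI[of _ "dshot U lam A"])
      (auto simp: solves_def shot_init[OF U] intro: has_field_derivative_at_within)
qed

lemma
  assumes "continuous_on {-R..R} U" "\<And>x. x \<in> {-R<..<R} \<Longrightarrow> V x = U x"
    and "admissible A" "admissible B"
    and "\<And>u du. bc_left \<alpha> u du \<longleftrightarrow> u * cos A = du * sin A"
    and "\<And>u du. bc_right \<beta> u du \<longleftrightarrow> u * cos B = - du * sin B"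
  shows eig1_eq: "eig1 V (2 * R) \<alpha> \<beta> = eig 1 U A B"
    and eig2_eq: "eig2 V (2 * R) \<alpha> \<beta> = eig 2 U A B"
proof -
  define S where "S = {lam. \<exists>n\<ge>1. phase U lam A R = real n * pi - B}"
  have i: "{lam. is_eigenvalue V (2 * R) \<alpha> \<beta> lam} = S"
    unfolding S_def using is_eigenvalue_iff[OF assms] by simp
  note e = eig_le_iff(1)[OF assms(1,3,4)]
  note p = phase_eig[OF assms(1,3,4)]
  show 1: "eig1 V (2 * R) \<alpha> \<beta> = eig 1 U A B"
    unfolding eig1_def i
  proof (rule cInf_eq_minimum)
    show "eig 1 U A B \<in> S"
      using p[of 1] by (auto simp: S_def intro!: exI[of _ 1])
    fix lam assume "lam \<in> S"
    then obtain n :: nat where n: "1 \<le> n" "phase U lam A R = real n * pi - B"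
      unfolding S_def by blast
    then have "1 * pi \<le> real n * pi" by (intro mult_right_mono) auto
    then show "eig 1 U A B \<le> lam" using e[of 1 lam] n(2) by auto
  qed
  show "eig2 V (2 * R) \<alpha> \<beta> = eig 2 U A B"
    unfolding eig2_def 1 i
  proof (rule cInf_eq_minimum)
    show "eig 2 U A B \<in> S - {eig 1 U A B}"
      using p[of 2] eig_less[OF assms(1,3,4)] by (auto simp: S_def intro!: exI[of _ 2])
    fix lam assume "lam \<in> S - {eig 1 U A B}"
    then obtain n :: nat where n: "1 \<le> n" "phase U lam A R = real n * pi - B" "lam \<noteq> eig 1 U A B"
      unfolding S_def by blast
    then have "n \<noteq> 1" using phase_inj[OF assms(1), of lam A "eig 1 U A B"] p[of 1] by auto
    then have "2 * pi \<le> real n * pi" using n(1) by (intro mult_right_mono) auto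
    then show "eig 2 U A B \<le> lam" using e[of 2 lam] n(2) by auto
  qed
qed

section \<open>Dependence of the eigenvalues on the potential and the boundary angles\<close>

lemma phase_tendsto:
  fixes F :: "'a filter"
  assumes U: "continuous_on {-R..R} U" and Uh: "\<And>h. continuous_on {-R..R} (Uh h)"
    and lim: "uniform_limit {-R..R} Uh U F" "(Ah \<longlongrightarrow> A) F"
  shows "((\<lambda>h. phase (Uh h) lam (Ah h) R) \<longlongrightarrow> phase U lam A R) F"
proof (rule tendstoI)
  fix e :: real assume e: "0 < e"
  obtain C where C: "0 < C" "\<And>x. x \<in> {-R..R} \<Longrightarrow> \<bar>lam - U x\<bar> \<le> C"
    using continuous_bounded_obtain[OF cont_shift[OF U]] by blast
  define d where "d = e / ((1 + 2 * R) * exp ((C + 1) * (2 * R)))"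
  have d: "0 < d" using e R_pos by (simp add: d_def)
  have "\<forall>\<^sub>F h in F. \<forall>x\<in>{-R..R}. dist (Uh h x) (U x) < d" by (rule uniform_limitD[OF lim(1) d])
  moreover have "\<forall>\<^sub>F h in F. dist (Ah h) A < d" by (rule tendstoD[OF lim(2) d])
  ultimately show "\<forall>\<^sub>F h in F. dist (phase (Uh h) lam (Ah h) R) (phase U lam A R) < e"
  proof eventually_elim
    case (elim h)
    have "\<bar>phase (Uh h) lam (Ah h) R - phase U lam A R\<bar> \<le> (\<bar>Ah h - A\<bar> + d * (2 * R)) * exp ((C + 1) * (2 * R))"
      by (rule angle_close[OF cont_shift[OF U] cont_shift[OF Uh] C(2)])
        (use elim d in \<open>auto simp: dist_real_def abs_minus_commute less_imp_le\<close>)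
    also have "\<dots> < (d + d * (2 * R)) * exp ((C + 1) * (2 * R))"
      using elim by (intro mult_strict_right_mono add_strict_right_mono) (auto simp: dist_real_def)
    also have "\<dots> = d * ((1 + 2 * R) * exp ((C + 1) * (2 * R)))" by (simp add: algebra_simps)
    also have "\<dots> = e" using R_pos unfolding d_def by (intro nonzero_eq_divide_eq[THEN iffD1]) auto
    finally show ?case by (simp add: dist_real_def)
  qed
qed

text \<open>At \<open>l - e\<close> and \<open>l + e\<close> the limit phase lies strictly on
  opposite sides of its level. This persists nearby and traps the perturbed eigenvalue by
  \<open>eig_le_iff\<close>.\<close>

lemma eig_tendsto:
  fixes F :: "'a filter"
  assumes U: "continuous_on {-R..R} U" and Uh: "\<And>h. continuous_on {-R..R} (Uh h)"
    and lim: "uniform_limit {-R..R} Uh U F" "(Ah \<longlongrightarrow> A) F" "(Bh \<longlongrightarrow> B) F"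
    and A: "admissible A" and B: "admissible B"
    and ev: "\<forall>\<^sub>F h in F. admissible (Ah h) \<and> admissible (Bh h)"
    and n: "n \<in> {1, 2}"
  shows "((\<lambda>h. eig n (Uh h) (Ah h) (Bh h)) \<longlongrightarrow> eig n U A B) F"
proof (rule tendstoI)
  fix e :: real assume e: "0 < e"
  define l where "l = eig n U A B"
  have lo: "phase U (l - e) A R < real n * pi - B" and hi: "real n * pi - B < phase U (l + e) A R"
    using phase_strict_mono[OF U, of "l - e" l A] phase_strict_mono[OF U, of l "l + e" A]
      phase_eig[OF U A B n] e by (auto simp: l_def)
  have 1: "((\<lambda>h. phase (Uh h) (l - e) (Ah h) R - (real n * pi - Bh h)) \<longlongrightarrow>
      phase U (l - e) A R - (real n * pi - B)) F"
    by (intro tendsto_intros phase_tendsto assms)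
  have 2: "((\<lambda>h. phase (Uh h) (l + e) (Ah h) R - (real n * pi - Bh h)) \<longlongrightarrow>
      phase U (l + e) A R - (real n * pi - B)) F"
    by (intro tendsto_intros phase_tendsto assms)
  have "\<forall>\<^sub>F h in F. phase (Uh h) (l - e) (Ah h) R - (real n * pi - Bh h) < 0"
    by (rule order_tendstoD(2)[OF 1]) (use lo in auto)
  moreover have "\<forall>\<^sub>F h in F. 0 < phase (Uh h) (l + e) (Ah h) R - (real n * pi - Bh h)"
    by (rule order_tendstoD(1)[OF 2]) (use hi in auto)
  ultimately show "\<forall>\<^sub>F h in F. dist (eig n (Uh h) (Ah h) (Bh h)) (eig n U A B) < e"
    using ev
  proof eventually_elim
    case (elim h)
    note iff = eig_le_iff[OF Uh[of h] _ _ n, of "Ah h" "Bh h"]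
    have "l - e < eig n (Uh h) (Ah h) (Bh h)"
      using iff(1)[of "l - e"] elim by (simp flip: not_le)
    moreover have "eig n (Uh h) (Ah h) (Bh h) < l + e"
      using iff(2)[of "l + e"] elim by (simp flip: not_le)
    ultimately show ?case by (simp add: dist_real_def l_def abs_less_iff)
  qed
qed

text \<open>Uniform convergence allows the limit under the integrals in \<open>eig_deriv\<close>;
  the limit of \<open>dshot\<close> enters there through the amplitude at \<open>R\<close>.\<close>

lemma shot_uniform_limit:
  fixes F :: "'a filter"
  assumes U: "continuous_on {-R..R} U" and Uh: "\<And>h. continuous_on {-R..R} (Uh h)"
    and lim: "uniform_limit {-R..R} Uh U F" "(Ah \<longlongrightarrow> A) F" "(lh \<longlongrightarrow> l) F"
  shows "uniform_limit {-R..R} (\<lambda>h. shot (Uh h) (lh h) (Ah h)) (shot U l A) F"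
    and "uniform_limit {-R..R} (\<lambda>h. dshot (Uh h) (lh h) (Ah h)) (dshot U l A) F"
proof -
  obtain C where C: "0 < C" "\<And>x. x \<in> {-R..R} \<Longrightarrow> \<bar>l - U x\<bar> \<le> C"
    using continuous_bounded_obtain[OF cont_shift[OF U]] by blast
  obtain N where N: "0 < N" "\<And>x. x \<in> {-R..R} \<Longrightarrow> \<bar>shot U l A x\<bar> \<le> N"
    using continuous_bounded_obtain[OF solves_cont(1)[OF solves_shot[OF U]]] by blast
  define E where "E = exp ((2 + (C + 1)) * (2 * R))"
  have E: "0 < E" by (simp add: E_def)
  have main: "\<forall>\<^sub>F h in F. \<forall>x\<in>{-R..R}.
      (shot (Uh h) (lh h) (Ah h) x - shot U l A x)\<^sup>2 + (dshot (Uh h) (lh h) (Ah h) x - dshot U l A x)\<^sup>2 < e\<^sup>2"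
    if e: "0 < e" for e
  proof -
    have "((\<lambda>\<eta>. \<eta>\<^sup>2 * N\<^sup>2 * (2 * R) * E) \<longlongrightarrow> 0\<^sup>2 * N\<^sup>2 * (2 * R) * E) (at_right 0)"
      by (intro tendsto_intros)
    then have "\<forall>\<^sub>F \<eta> in at_right 0. \<eta>\<^sup>2 * N\<^sup>2 * (2 * R) * E < e\<^sup>2 / 2"
      by (rule order_tendstoD) (use e in simp)
    moreover have "\<forall>\<^sub>F \<eta> in at_right (0::real). 0 < \<eta> \<and> \<eta> < 1"
      by (intro eventually_conj eventually_at_right_less) (auto simp: eventually_at_right_field intro!: exI[of _ 1])
    ultimately have "\<forall>\<^sub>F \<eta> in at_right 0. \<eta>\<^sup>2 * N\<^sup>2 * (2 * R) * E < e\<^sup>2 / 2 \<and> 0 < \<eta> \<and> \<eta> < 1"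
      by (rule eventually_conj)
    then obtain \<eta> where \<eta>: "\<eta>\<^sup>2 * N\<^sup>2 * (2 * R) * E < e\<^sup>2 / 2" "0 < \<eta>" "\<eta> < 1"
      using eventually_happens[of _ "at_right (0::real)"] by auto
    have "((\<lambda>h. ((sin (Ah h) - sin A)\<^sup>2 + (cos (Ah h) - cos A)\<^sup>2) * E) \<longlongrightarrow>
        ((sin A - sin A)\<^sup>2 + (cos A - cos A)\<^sup>2) * E) F"
      by (intro tendsto_intros isCont_tendsto_compose[OF isCont_sin lim(2)]
          isCont_tendsto_compose[OF isCont_cos lim(2)])
    then have "\<forall>\<^sub>F h in F. ((sin (Ah h) - sin A)\<^sup>2 + (cos (Ah h) - cos A)\<^sup>2) * E < e\<^sup>2 / 2"
      by (rule order_tendstoD) (use e in simp)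
    moreover have "\<forall>\<^sub>F h in F. \<forall>x\<in>{-R..R}. dist (Uh h x) (U x) < \<eta> / 2"
      by (rule uniform_limitD[OF lim(1)]) (use \<eta> in simp)
    moreover have "\<forall>\<^sub>F h in F. dist (lh h) l < \<eta> / 2"
      by (rule tendstoD[OF lim(3)]) (use \<eta> in simp)
    ultimately show ?thesis
    proof eventually_elim
      case (elim h)
      show ?case
      proof
        fix x assume x: "x \<in> {-R..R}"
        have close: "\<bar>(Uh h x - lh h) - (U x - l)\<bar> \<le> \<eta>" if "x \<in> {-R..R}" for x
          using elim(2)[rule_format, OF that] elim(3) unfolding dist_real_def by linarith
        have "(shot (Uh h) (lh h) (Ah h) x - shot U l A x)\<^sup>2 + (dshot (Uh h) (lh h) (Ah h) x - dshot U l A x)\<^sup>2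
          \<le> ((shot (Uh h) (lh h) (Ah h) (-R) - shot U l A (-R))\<^sup>2 +
             (dshot (Uh h) (lh h) (Ah h) (-R) - dshot U l A (-R))\<^sup>2 + \<eta>\<^sup>2 * N\<^sup>2 * (2 * R)) * E"
          unfolding E_def
        proof (rule solves_close[OF solves_shot[OF U] solves_shot[OF Uh] _ close N(2) x])
          show "\<bar>Uh h x - lh h\<bar> \<le> C + 1" if "x \<in> {-R..R}" for x
            using close[OF that] C(2)[OF that] \<eta> by linarith
        qed
        also have "\<dots> = ((sin (Ah h) - sin A)\<^sup>2 + (cos (Ah h) - cos A)\<^sup>2) * E + \<eta>\<^sup>2 * N\<^sup>2 * (2 * R) * E"
          by (simp add: shot_init[OF U] shot_init[OF Uh] algebra_simps)
        also have "\<dots> < e\<^sup>2" using elim(1) \<eta>(1) by linarith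
        finally show "(shot (Uh h) (lh h) (Ah h) x - shot U l A x)\<^sup>2 +
            (dshot (Uh h) (lh h) (Ah h) x - dshot U l A x)\<^sup>2 < e\<^sup>2" .
      qed
    qed
  qed
  have sq: "\<bar>a\<bar> < e" "\<bar>b\<bar> < e" if "a\<^sup>2 + b\<^sup>2 < e\<^sup>2" "0 < e" for a b e :: real
  proof -
    have "\<bar>a\<bar>\<^sup>2 < e\<^sup>2" "\<bar>b\<bar>\<^sup>2 < e\<^sup>2"
      using that(1) zero_le_power2[of a] zero_le_power2[of b] unfolding power2_abs by linarith+
    then show "\<bar>a\<bar> < e" "\<bar>b\<bar> < e" using that(2) by (auto intro: power2_less_imp_less)
  qed
  show "uniform_limit {-R..R} (\<lambda>h. shot (Uh h) (lh h) (Ah h)) (shot U l A) F"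
    by (rule uniform_limitI) (rule eventually_mono[OF main], use sq(1) in \<open>auto simp: dist_real_def\<close>)
  show "uniform_limit {-R..R} (\<lambda>h. dshot (Uh h) (lh h) (Ah h)) (dshot U l A) F"
    by (rule uniform_limitI) (rule eventually_mono[OF main], use sq(2) in \<open>auto simp: dist_real_def\<close>)
qed

abbreviation I :: "(real \<Rightarrow> real) \<Rightarrow> real" where
  "I f \<equiv> integral {-R..R} f"

lemma integral_uniform_limit:
  fixes F :: "'a filter" and f :: "'a \<Rightarrow> real \<Rightarrow> real"
  assumes "uniform_limit {-R..R} f g F" "\<And>h. continuous_on {-R..R} (f h)" "F \<noteq> bot"
  shows "((\<lambda>h. I (f h)) \<longlongrightarrow> I g) F"
proof -
  obtain J K where J: "\<And>h. (f h has_integral J h) {-R..R}" "(g has_integral K) {-R..R}"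
      "(J \<longlongrightarrow> K) F"
    using uniform_limit_integral[OF assms] by blast
  then show ?thesis by (simp add: integral_unique[OF J(1)] integral_unique[OF J(2)])
qed

lemma integral_derivative:
  assumes "\<And>x. x \<in> {-R..R} \<Longrightarrow> (f has_real_derivative f' x) (at x)"
  shows "I f' = f R - f (-R)"
  by (rule integral_unique[OF fundamental_theorem_of_calculus])
    (use assms R_pos in \<open>auto simp: has_real_derivative_iff_has_vector_derivative[symmetric]
        intro: has_field_derivative_at_within\<close>)

text \<open>No derivative of an eigenfunction is taken. Integrating the derivative of the Wronskian
  of the old and the perturbed eigenfunction gives an exact formula for the difference of the
  eigenvalues; after division by \<open>h\<close> it consists of integrals and sines with known
  limits. The set \<open>H\<close> allows one-sided differentiation, as at an angle 0, which can
  move in one direction only.\<close>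

lemma eig_deriv:
  fixes H :: "real set"
  assumes U: "continuous_on {-R..R} U" and \<Phi>: "continuous_on {-R..R} \<Phi>"
    and A: "admissible A" and B: "admissible B"
    and H: "\<And>h. h \<in> H \<Longrightarrow> admissible (A - h * a) \<and> admissible (B - h * b)"
    and bot: "at 0 within H \<noteq> bot" and n: "n \<in> {1, 2}"
    and l: "l = eig n U A B"
  shows "((\<lambda>h. (eig n (\<lambda>x. U x + h * \<Phi> x) (A - h * a) (B - h * b) - l) / h) \<longlongrightarrow>
    (I (\<lambda>x. \<Phi> x * (shot U l A x)\<^sup>2) + b * (exp (log_amplitude U l A R))\<^sup>2 + a)
      / I (\<lambda>x. (shot U l A x)\<^sup>2)) (at 0 within H)"
proof -
  let ?F = "at 0 within H"
  define Uh where "Uh h x = U x + h * \<Phi> x" for h x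
  define Ah where "Ah h = A - h * a" for h
  define Bh where "Bh h = B - h * b" for h
  define lh where "lh h = eig n (Uh h) (Ah h) (Bh h)" for h
  define u where "u = shot U l A"
  define uh where "uh h = shot (Uh h) (lh h) (Ah h)" for h
  define r where "r = exp (log_amplitude U l A R)"
  define rh where "rh h = exp (log_amplitude (Uh h) (lh h) (Ah h) R)" for h
  have cUh: "continuous_on {-R..R} (Uh h)" for h
    unfolding Uh_def by (intro continuous_intros U \<Phi>)
  obtain N where N: "0 < N" "\<And>x. x \<in> {-R..R} \<Longrightarrow> \<bar>\<Phi> x\<bar> \<le> N"
    using continuous_bounded_obtain[OF \<Phi>] by blast
  have limU: "uniform_limit {-R..R} Uh U ?F"
  proof (rule uniform_limitI)
    fix e :: real assume e: "0 < e"
    have "\<forall>\<^sub>F h in ?F. dist h 0 < e / N"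
      using e N(1) by (auto simp: eventually_at intro!: exI[of _ "e / N"])
    then show "\<forall>\<^sub>F h in ?F. \<forall>x\<in>{-R..R}. dist (Uh h x) (U x) < e"
    proof eventually_elim
      case (elim h)
      show ?case
      proof
        fix x assume x: "x \<in> {-R..R}"
        have "\<bar>h\<bar> * \<bar>\<Phi> x\<bar> \<le> \<bar>h\<bar> * N" by (intro mult_left_mono N x) auto
        also have "\<dots> < e" using elim N(1) by (simp add: field_simps)
        finally show "dist (Uh h x) (U x) < e" by (simp add: Uh_def dist_real_def abs_mult)
      qed
    qed
  qed
  have h0: "((\<lambda>h. h) \<longlongrightarrow> 0) ?F" by (rule tendsto_ident_at)
  have "((\<lambda>h. A - h * a) \<longlongrightarrow> A - 0 * a) ?F" "((\<lambda>h. B - h * b) \<longlongrightarrow> B - 0 * b) ?F"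
    by (intro tendsto_diff tendsto_mult tendsto_const h0)+
  then have limA: "(Ah \<longlongrightarrow> A) ?F" and limB: "(Bh \<longlongrightarrow> B) ?F"
    by (simp_all add: Ah_def[abs_def] Bh_def[abs_def])
  have ev: "\<forall>\<^sub>F h in ?F. h \<in> H \<and> h \<noteq> 0" by (simp add: eventually_at_filter)
  have adm: "\<forall>\<^sub>F h in ?F. admissible (Ah h) \<and> admissible (Bh h)"
    using ev by eventually_elim (use H in \<open>auto simp: Ah_def Bh_def\<close>)
  have liml: "(lh \<longlongrightarrow> l) ?F"
    unfolding lh_def l by (rule eig_tendsto[OF U cUh limU limA limB A B adm n])
  note limu = shot_uniform_limit[OF U cUh limU limA liml]
  have su: "solves U l u (dshot U l A)" and suh: "solves (Uh h) (lh h) (uh h) (dshot (Uh h) (lh h) (Ah h))" for h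
    unfolding u_def uh_def by (rule solves_shot[OF U], rule solves_shot[OF cUh])
  have cu: "continuous_on {-R..R} u" and cuh: "continuous_on {-R..R} (uh h)" for h
    using solves_cont[OF su] solves_cont[OF suh] by auto
  have bdd: "bounded (f ` {-R..R})" if "continuous_on {-R..R} f" for f :: "real \<Rightarrow> real"
    by (intro compact_imp_bounded compact_continuous_image that compact_Icc)
  have prod: "uniform_limit {-R..R} (\<lambda>h x. uh h x * u x) (\<lambda>x. u x * u x) ?F"
    by (rule uniform_lim_mult[OF limu(1)[folded uh_def u_def] uniform_limit_const bdd[OF cu] bdd[OF cu]])
  have cu2: "continuous_on {-R..R} (\<lambda>x. u x * u x)" by (intro continuous_intros cu)
  have prod2: "uniform_limit {-R..R} (\<lambda>h x. \<Phi> x * (uh h x * u x)) (\<lambda>x. \<Phi> x * (u x * u x)) ?F"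
    by (rule uniform_lim_mult[OF uniform_limit_const prod bdd[OF \<Phi>] bdd[OF cu2]])
  have lim1: "((\<lambda>h. I (\<lambda>x. uh h x * u x)) \<longlongrightarrow> I (\<lambda>x. u x * u x)) ?F"
    by (rule integral_uniform_limit[OF prod _ bot]) (intro continuous_intros cuh cu)
  have lim2: "((\<lambda>h. I (\<lambda>x. \<Phi> x * (uh h x * u x))) \<longlongrightarrow> I (\<lambda>x. \<Phi> x * (u x * u x))) ?F"
    by (rule integral_uniform_limit[OF prod2 _ bot]) (intro continuous_intros cuh cu \<Phi>)
  have amp: "exp (log_amplitude W m D R) = sqrt ((shot W m D R)\<^sup>2 + (dshot W m D R)\<^sup>2)" for W m D
    by (simp add: shot_def dshot_def power_mult_distrib flip: distrib_left)
  have nz: "I (\<lambda>x. u x * u x) \<noteq> 0"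
  proof -
    obtain t where t: "t \<in> {-R<..<R}" "sin (phase U l A t) \<noteq> 0"
      using sin_angle_nonzero[OF cont_shift[OF U]] by blast
    then have "u t * u t \<noteq> 0" by (simp add: u_def shot_def)
    moreover have "t \<in> {-R..R}" using t by auto
    ultimately show "I (\<lambda>x. u x * u x) \<noteq> 0"
      using integral_eq_0_iff[of "-R" R "\<lambda>x. u x * u x", OF cu2] R_pos by auto
  qed
  have RI: "R \<in> {-R..R}" using R_pos by auto
  have lim3: "(rh \<longlongrightarrow> r) ?F"
    unfolding rh_def r_def amp
    by (intro tendsto_intros tendsto_uniform_limitI[OF limu(1) RI] tendsto_uniform_limitI[OF limu(2) RI])
  have sinc: "((\<lambda>h. sin (h * k) / h) \<longlongrightarrow> k) ?F" for k :: real
  proof -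
    have "((\<lambda>h. sin (h * k)) has_real_derivative k) (at 0 within H)"
      by (auto intro!: derivative_eq_intros)
    then show ?thesis unfolding has_field_derivative_iff by simp
  qed
  have "((\<lambda>h. (I (\<lambda>x. \<Phi> x * (uh h x * u x)) + rh h * r * (sin (h * b) / h) + sin (h * a) / h)
      / I (\<lambda>x. uh h x * u x)) \<longlongrightarrow>
      (I (\<lambda>x. \<Phi> x * (u x * u x)) + r * r * b + a) / I (\<lambda>x. u x * u x)) ?F"
    by (intro tendsto_intros lim1 lim2 lim3 sinc nz)
  moreover have "\<forall>\<^sub>F h in ?F. (I (\<lambda>x. \<Phi> x * (uh h x * u x)) + rh h * r * (sin (h * b) / h) + sin (h * a) / h)
      / I (\<lambda>x. uh h x * u x) = (lh h - l) / h"
  proof -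
    have "\<forall>\<^sub>F h in ?F. I (\<lambda>x. uh h x * u x) \<noteq> 0"
      by (rule tendsto_imp_eventually_ne[OF lim1 nz])
    with ev adm show ?thesis
    proof eventually_elim
      case (elim h)
      define th where "th = phase U l A R"
      define thh where "thh = phase (Uh h) (lh h) (Ah h) R"
      have th: "th = real n * pi - B" "thh = real n * pi - Bh h"
        unfolding th_def thh_def l lh_def using phase_eig[OF U A B n] phase_eig[OF cUh _ _ n] elim(2) by auto
      have "I (\<lambda>x. h * (\<Phi> x * (uh h x * u x)) - (lh h - l) * (uh h x * u x)) =
        (dshot (Uh h) (lh h) (Ah h) R * u R - uh h R * dshot U l A R) -
        (dshot (Uh h) (lh h) (Ah h) (-R) * u (-R) - uh h (-R) * dshot U l A (-R))"
      proof (rule integral_derivative[where f = "\<lambda>x. dshot (Uh h) (lh h) (Ah h) x * u x - uh h x * dshot U l A x"])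
        fix x assume x: "x \<in> {-R..R}"
        show "((\<lambda>x. dshot (Uh h) (lh h) (Ah h) x * u x - uh h x * dshot U l A x) has_real_derivative
            h * (\<Phi> x * (uh h x * u x)) - (lh h - l) * (uh h x * u x)) (at x)"
          using su suh[of h] x
          by (auto simp: solves_def Uh_def intro!: derivative_eq_intros) (simp add: algebra_simps)
      qed
      also have "I (\<lambda>x. h * (\<Phi> x * (uh h x * u x)) - (lh h - l) * (uh h x * u x))
          = h * I (\<lambda>x. \<Phi> x * (uh h x * u x)) - (lh h - l) * I (\<lambda>x. uh h x * u x)"
        by (subst integral_diff)
          (auto intro!: integrable_continuous_real continuous_intros \<Phi> cu cuh)
      \<comment> \<open>The initial vectors at \<open>- R\<close> are unit vectors, so their
        Wronskian is the sine of the angle difference; at \<open>R\<close> the two amplitudes appear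
        as factors.\<close>
      also have "dshot (Uh h) (lh h) (Ah h) (-R) * u (-R) - uh h (-R) * dshot U l A (-R) = sin (h * a)"
        using sin_diff[of A "Ah h"] by (simp add: u_def uh_def shot_init[OF U] shot_init[OF cUh] Ah_def mult.commute)
      also have "dshot (Uh h) (lh h) (Ah h) R * u R - uh h R * dshot U l A R = rh h * r * sin (th - thh)"
        unfolding sin_diff
        by (simp add: u_def uh_def shot_def dshot_def rh_def r_def th_def thh_def algebra_simps)
      also have "th - thh = - (h * b)" unfolding th by (simp add: Bh_def)
      finally have "(lh h - l) * I (\<lambda>x. uh h x * u x)
          = h * I (\<lambda>x. \<Phi> x * (uh h x * u x)) + rh h * r * sin (h * b) + sin (h * a)"
        by simp
      then show ?case using elim by (simp add: field_simps)
    qed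
  qed
  ultimately have "((\<lambda>h. (lh h - l) / h) \<longlongrightarrow>
      (I (\<lambda>x. \<Phi> x * (u x * u x)) + r * r * b + a) / I (\<lambda>x. u x * u x)) ?F"
    by (rule Lim_transform_eventually)
  then show ?thesis
    by (simp add: lh_def Uh_def[abs_def] Ah_def Bh_def u_def r_def power2_eq_square mult.commute)
qed

lemma I_pos:
  assumes f: "continuous_on {-R..R} f" and nn: "\<And>x. x \<in> {-R<..<R} \<Longrightarrow> 0 \<le> f x"
    and t: "t \<in> {-R<..<R}" "0 < f t"
  shows "0 < I f"
proof -
  have cl: "closure {-R<..<R} = {-R..R}" using R_pos by (intro closure_greaterThanLessThan) auto
  have nn': "0 \<le> f x" if "x \<in> {-R..R}" for x
    using continuous_ge_on_closure[of "{-R<..<R}" f x 0] f nn that unfolding cl by auto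
  have "0 \<le> I f" by (rule integral_nonneg[OF integrable_continuous_real[OF f] nn'])
  moreover have "I f \<noteq> 0"
    using integral_eq_0_iff[OF f _ nn'] t R_pos by force
  ultimately show ?thesis by simp
qed

lemma I_nonneg:
  assumes f: "continuous_on {-R..R} f" and nn: "\<And>x. x \<in> {-R<..<R} \<Longrightarrow> 0 \<le> f x"
  shows "0 \<le> I f"
proof -
  have cl: "closure {-R<..<R} = {-R..R}" using R_pos by (intro closure_greaterThanLessThan) auto
  have nn': "0 \<le> f x" if "x \<in> {-R..R}" for x
    using continuous_ge_on_closure[of "{-R<..<R}" f x 0] f nn that unfolding cl by auto
  show "0 \<le> I f" by (rule integral_nonneg[OF integrable_continuous_real[OF f] nn'])
qed

end

section \<open>The two lowest eigenfunctions\<close>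

text \<open>The two lowest eigenfunctions, normalised in L^2; \<open>m\<close> is the node of the
  second one, whose sign is chosen negative on the left. \<open>L1\<close>, \<open>R1\<close>,
  \<open>L2\<close>, \<open>R2\<close> are the Pruefer amplitudes at the ends, whose squares form
  the boundary terms in the derivative of the gap.\<close>

locale low_pair = symmetric_interval +
  fixes U :: "real \<Rightarrow> real" and A B l1 l2 :: real and u1 u1' u2 u2' :: "real \<Rightarrow> real"
    and m L1 R1 L2 R2 :: real
  assumes U: "continuous_on {-R..R} U"
    and A: "admissible A" and B: "admissible B"
    and s1: "solves U l1 u1 u1'" and s2: "solves U l2 u2 u2'" and l12: "l1 < l2"
    and u1_pos: "x \<in> {-R<..<R} \<Longrightarrow> 0 < u1 x"
    and m: "- R < m" "m < R"
    and u2_m: "u2 m = 0"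
    and u2_neg: "- R < x \<Longrightarrow> x < m \<Longrightarrow> u2 x < 0"
    and u2_pos: "m < x \<Longrightarrow> x < R \<Longrightarrow> 0 < u2 x"
    and ampl: "0 < L1" "0 < R1" "0 < L2" "0 < R2"
    and left1: "u1 (- R) = L1 * sin A" "u1' (- R) = L1 * cos A"
    and right1: "u1 R = R1 * sin B" "u1' R = - R1 * cos B"
    and left2: "u2 (- R) = - L2 * sin A" "u2' (- R) = - L2 * cos A"
    and right2: "u2 R = R2 * sin B" "u2' R = - R2 * cos B"
    and norm1: "I (\<lambda>x. (u1 x)\<^sup>2) = 1" and norm2: "I (\<lambda>x. (u2 x)\<^sup>2) = 1"
begin

lemma du:
  assumes "x \<in> {-R..R}"
  shows "(u1 has_real_derivative u1' x) (at x)" "(u1' has_real_derivative (U x - l1) * u1 x) (at x)"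
    "(u2 has_real_derivative u2' x) (at x)" "(u2' has_real_derivative (U x - l2) * u2 x) (at x)"
  using s1 s2 assms by (auto simp: solves_def)

lemmas cont_u = solves_cont[OF s1] solves_cont[OF s2]

definition w :: "real \<Rightarrow> real" where "w x = u1 x * u2' x - u1' x * u2 x"
definition v :: "real \<Rightarrow> real" where "v x = u2 x / u1 x"
text \<open>First-order perturbation density: the gap changes at the rate
  \<open>I (\<lambda>x. \<Phi> x * q x)\<close> when the potential moves in direction
  \<Phi>.\<close>

definition q :: "real \<Rightarrow> real" where "q x = (u2 x)\<^sup>2 - (u1 x)\<^sup>2"

lemma cont_q: "continuous_on {-R..R} q"
  unfolding q_def[abs_def] by (intro continuous_intros cont_u)

lemma cont_w: "continuous_on {-R..R} w"
  unfolding w_def[abs_def] by (intro continuous_intros cont_u)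

lemma w_deriv:
  assumes "x \<in> {-R..R}"
  shows "(w has_real_derivative (l1 - l2) * (u1 x * u2 x)) (at x)"
  unfolding w_def[abs_def]
  by (rule DERIV_cong, (rule derivative_eq_intros du[OF assms] refl)+) (simp add: algebra_simps)

lemma w_ends: "w (- R) = 0" "w R = 0"
  by (simp_all add: w_def left1 left2 right1 right2)

text \<open>The common boundary conditions make the Wronskian vanish at both ends, and its
  derivative has the sign of - u2: it rises up to the node and falls afterwards. Since v' = w /
  u1^2, the ratio \<open>v\<close> increases.\<close>

lemma w_pos:
  assumes x: "x \<in> {-R<..<R}"
  shows "0 < w x"
proof (cases "x \<le> m")
  case True
  have "w (- R) < w x"
  proof (rule deriv_pos_strict_mono[where f = w and f' = "\<lambda>x. (l1 - l2) * (u1 x * u2 x)"])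
    show "continuous_on {-R..x} w" by (rule continuous_on_subset[OF cont_w]) (use x in auto)
    fix t assume t: "- R < t" "t < x"
    show "(w has_real_derivative (l1 - l2) * (u1 t * u2 t)) (at t)" by (rule w_deriv) (use t x in auto)
    have "u1 t * u2 t < 0" using u1_pos[of t] u2_neg[of t] t x True by (intro mult_pos_neg) auto
    then show "0 < (l1 - l2) * (u1 t * u2 t)" using l12 by (intro mult_neg_neg) auto
  qed (use x in auto)
  then show ?thesis by (simp add: w_ends)
next
  case False
  have "- w x < - w R"
  proof (rule deriv_pos_strict_mono[where f = "\<lambda>x. - w x" and f' = "\<lambda>x. - ((l1 - l2) * (u1 x * u2 x))"])
    show "continuous_on {x..R} (\<lambda>x. - w x)"
      by (intro continuous_intros continuous_on_subset[OF cont_w]) (use x in auto)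
    fix t assume t: "x < t" "t < R"
    show "((\<lambda>x. - w x) has_real_derivative - ((l1 - l2) * (u1 t * u2 t))) (at t)"
      by (rule DERIV_minus[OF w_deriv]) (use t x in auto)
    have "0 < u1 t * u2 t" using u1_pos[of t] u2_pos[of t] t x False by (intro mult_pos_pos) auto
    then show "0 < - ((l1 - l2) * (u1 t * u2 t))" using l12 by (simp add: mult_neg_pos)
  qed (use x in auto)
  then show ?thesis by (simp add: w_ends)
qed

lemma cont_v: "continuous_on {-R<..<R} v"
  unfolding v_def[abs_def]
  by (intro continuous_intros continuous_on_subset[OF cont_u(1)] continuous_on_subset[OF cont_u(3)])
    (auto dest: u1_pos)

lemma v_strict_mono:
  assumes "- R < x" "x < y" "y < R"
  shows "v x < v y"
proof (rule deriv_pos_strict_mono[where f = v and f' = "\<lambda>x. w x / (u1 x)\<^sup>2"])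
  show "continuous_on {x..y} v" by (rule continuous_on_subset[OF cont_v]) (use assms in auto)
  fix t assume "x < t" "t < y"
  then have t: "t \<in> {-R<..<R}" and t': "t \<in> {-R..R}" using assms by auto
  show "(v has_real_derivative w t / (u1 t)\<^sup>2) (at t)"
    unfolding v_def[abs_def] using u1_pos[OF t]
    by (auto intro!: derivative_eq_intros du t' simp: w_def power2_eq_square algebra_simps)
  show "0 < w t / (u1 t)\<^sup>2" using w_pos[OF t] u1_pos[OF t] by simp
qed (use assms in auto)

lemma v_m: "v m = 0" by (simp add: v_def u2_m)

lemma q_eq: "x \<in> {-R<..<R} \<Longrightarrow> q x = (u1 x)\<^sup>2 * ((v x)\<^sup>2 - 1)"
  using u1_pos[of x] by (simp add: q_def v_def field_simps)

lemma I_q: "I q = 0"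
  unfolding q_def[abs_def]
  by (subst integral_diff) (auto intro!: integrable_continuous_real continuous_intros cont_u simp: norm1 norm2)

text \<open>Rate of change of the gap when a small multiple of x is added to the potential.\<close>

definition tilt :: real where "tilt = I (\<lambda>x. x * q x)"

text \<open>As \<open>q\<close> has mean zero, a weight of first degree may be recentred at any
  point without changing its integral.\<close>

lemma I_shift_q: "I (\<lambda>x. (a * x + c) * q x) = a * tilt"
proof -
  have "I (\<lambda>x. (a * x + c) * q x) = I (\<lambda>x. a * (x * q x) + c * q x)"
    by (rule arg_cong[of _ _ I]) (auto simp: algebra_simps)
  also have "\<dots> = a * tilt + c * I q"
    unfolding tilt_def
    by (subst integral_add) (auto intro!: integrable_continuous_real continuous_intros cont_q)
  finally show ?thesis by (simp add: I_q)
qed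

lemma crossing_right:
  assumes "x \<in> {-R<..<R}" "1 \<le> v x"
  obtains y where "m < y" "y < R" "v y = 1"
proof -
  have mx: "m < x" using v_strict_mono[of x m] v_m assms m by (cases x m rule: linorder_cases) auto
  have "continuous_on {m..x} v" by (rule continuous_on_subset[OF cont_v]) (use assms m in auto)
  then obtain y where y: "m \<le> y" "y \<le> x" "v y = 1"
    using IVT'[of v m 1 x] v_m assms mx by auto
  moreover have "m \<noteq> y" using y v_m by auto
  ultimately show ?thesis using that[of y] assms by auto
qed

lemma crossing_left:
  assumes "x \<in> {-R<..<R}" "v x \<le> -1"
  obtains y where "- R < y" "y < m" "v y = -1"
proof -
  have mx: "x < m" using v_strict_mono[of m x] v_m assms m by (cases x m rule: linorder_cases) auto
  have "continuous_on {x..m} v" by (rule continuous_on_subset[OF cont_v]) (use assms m in auto)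
  then obtain y where y: "x \<le> y" "y \<le> m" "v y = -1"
    using IVT'[of v x "-1" m] v_m assms mx by auto
  moreover have "m \<noteq> y" using y v_m by auto
  ultimately show ?thesis using that[of y] assms by auto
qed

lemma square_le_one: "\<bar>t\<bar> \<le> 1 \<Longrightarrow> t\<^sup>2 - 1 \<le> (0::real)"
  by (simp add: abs_square_le_1)

lemma q_nonpos: "x \<in> {-R<..<R} \<Longrightarrow> \<bar>v x\<bar> \<le> 1 \<Longrightarrow> q x \<le> 0"
  by (simp only: q_eq) (intro mult_nonneg_nonpos zero_le_power2 square_le_one)

lemma q_nonneg: "x \<in> {-R<..<R} \<Longrightarrow> 1 \<le> \<bar>v x\<bar> \<Longrightarrow> 0 \<le> q x"
  by (auto simp: q_eq intro!: mult_nonneg_nonneg) (metis abs_square_le_1 linorder_le_cases not_less abs_le_square_iff abs_one one_power2)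

lemma q_m: "q m < 0"
  using u1_pos[of m] m by (simp add: q_def u2_m)

text \<open>Without a left crossing \<open>q\<close> changes sign only at the point \<open>y\<close>
  with \<open>v y = 1\<close>, from minus to plus; such a point exists because \<open>q\<close> has
  mean zero and is negative at the node. Recentred at \<open>y\<close>, the integrand is
  nonnegative.\<close>

lemma tilt_pos_if_no_left_crossing:
  assumes no: "\<And>x. x \<in> {-R<..<R} \<Longrightarrow> -1 < v x"
  shows "0 < tilt"
proof -
  have "\<exists>x\<in>{-R<..<R}. 1 \<le> v x"
  proof (rule ccontr)
    assume "\<not> ?thesis"
    then have "0 < I (\<lambda>x. - q x)"
      using q_nonpos no q_m m by (intro I_pos[of _ m] continuous_intros cont_q) (force simp: abs_le_iff)+
    then show False by (simp add: I_q)
  qed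
  then obtain y where y: "m < y" "y < R" "v y = 1" using crossing_right by blast
  have "0 < I (\<lambda>x. (1 * x + (- y)) * q x)"
  proof (rule I_pos[of _ m])
    show "continuous_on {-R..R} (\<lambda>x. (1 * x + (- y)) * q x)" by (intro continuous_intros cont_q)
    show "0 < (1 * m + (- y)) * q m" using q_m y by (intro mult_neg_neg) auto
    fix x assume x: "x \<in> {-R<..<R}"
    show "0 \<le> (1 * x + (- y)) * q x"
    proof (cases "x \<le> y")
      case True
      then have "v x \<le> 1" using v_strict_mono[of x y] x y by (cases "x = y") auto
      then have "q x \<le> 0" using q_nonpos[OF x] no[OF x] by auto
      then show ?thesis using True by (intro mult_nonpos_nonpos) auto
    next
      case False
      then have "1 \<le> v x" using v_strict_mono[of y x] x y m by auto
      then have "0 \<le> q x" using q_nonneg[OF x] by auto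
      then show ?thesis using False by (intro mult_nonneg_nonneg) auto
    qed
  qed (use m in auto)
  then show ?thesis by (simp only: I_shift_q)
qed

text \<open>Reflection in 0 exchanges the two angles and the left and right amplitudes; the extra
  sign of \<open>u2\<close> restores the convention. Statements about one end thus follow from those
  about the other.\<close>

lemma reflected: "low_pair R (\<lambda>x. U (- x)) B A l1 l2 (\<lambda>x. u1 (- x)) (\<lambda>x. - u1' (- x))
    (\<lambda>x. - u2 (- x)) (\<lambda>x. u2' (- x)) (- m) R1 L1 R2 L2"
proof
  show "continuous_on {-R..R} (\<lambda>x. U (- x))"
    by (rule continuous_on_compose2[OF U]) (auto intro!: continuous_intros)
  have refl: "((\<lambda>x. f (- x)) has_real_derivative - D) (at x)"
    if "(f has_real_derivative D) (at (- x))" for f D x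
    using that by (simp add: DERIV_mirror)
  have minus: "- x \<in> {-R..R}" if "x \<in> {-R..R}" for x using that by auto
  show "solves (\<lambda>x. U (- x)) l1 (\<lambda>x. u1 (- x)) (\<lambda>x. - u1' (- x))"
    unfolding solves_def using refl[OF du(1)[OF minus]] DERIV_minus[OF refl[OF du(2)[OF minus]]] by auto
  show "solves (\<lambda>x. U (- x)) l2 (\<lambda>x. - u2 (- x)) (\<lambda>x. u2' (- x))"
    unfolding solves_def using DERIV_minus[OF refl[OF du(3)[OF minus]]] refl[OF du(4)[OF minus]] by auto
  have "I (\<lambda>x. (u (- x))\<^sup>2) = I (\<lambda>x. (u x)\<^sup>2)" for u :: "real \<Rightarrow> real"
    using Henstock_Kurzweil_Integration.integral_reflect_real[of R "-R" "\<lambda>x. (u x)\<^sup>2"] by simp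
  then show "I (\<lambda>x. (u1 (- x))\<^sup>2) = 1" "I (\<lambda>x. (- u2 (- x))\<^sup>2) = 1"
    using norm1 norm2 by auto
qed (use A B l12 u1_pos m u2_m u2_neg u2_pos ampl left1 left2 right1 right2 in auto)

lemma tilt_reflected:
  "low_pair.tilt R (\<lambda>x. u1 (- x)) (\<lambda>x. - u2 (- x)) = - tilt"
proof -
  interpret r: low_pair R "\<lambda>x. U (- x)" B A l1 l2 "\<lambda>x. u1 (- x)" "\<lambda>x. - u1' (- x)"
    "\<lambda>x. - u2 (- x)" "\<lambda>x. u2' (- x)" "- m" R1 L1 R2 L2
    by (rule reflected)
  have "I (\<lambda>x. x * r.q x) = I (\<lambda>x. - ((- x) * q (- x)))"
    by (simp add: r.q_def q_def)
  also have "\<dots> = - I (\<lambda>x. x * q x)"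
    using Henstock_Kurzweil_Integration.integral_reflect_real[of R "-R" "\<lambda>x. x * q x"] by simp
  finally show ?thesis by (simp add: r.tilt_def tilt_def)
qed

lemma tilt_neg_if_no_right_crossing:
  assumes no: "\<And>x. x \<in> {-R<..<R} \<Longrightarrow> v x < 1"
  shows "tilt < 0"
proof -
  interpret r: low_pair R "\<lambda>x. U (- x)" B A l1 l2 "\<lambda>x. u1 (- x)" "\<lambda>x. - u1' (- x)"
    "\<lambda>x. - u2 (- x)" "\<lambda>x. u2' (- x)" "- m" R1 L1 R2 L2
    by (rule reflected)
  have "0 < r.tilt"
    by (rule r.tilt_pos_if_no_left_crossing) (use no[of "- x" for x] in \<open>auto simp: r.v_def v_def\<close>)
  then show ?thesis by (simp add: tilt_reflected)
qed

lemma crossings_if_balanced: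
  assumes "tilt = 0"
  obtains x1 x2 where "- R < x1" "x1 < m" "v x1 = -1" "m < x2" "x2 < R" "v x2 = 1"
proof -
  have "\<exists>y\<in>{-R<..<R}. v y \<le> -1"
    by (rule ccontr) (use tilt_pos_if_no_left_crossing assms in \<open>force simp: not_le\<close>)
  then obtain y where "y \<in> {-R<..<R}" "v y \<le> -1" by blast
  then obtain x1 where "- R < x1" "x1 < m" "v x1 = -1" using crossing_left by blast
  moreover have "\<exists>y\<in>{-R<..<R}. 1 \<le> v y"
    by (rule ccontr) (use tilt_neg_if_no_right_crossing assms in \<open>force simp: not_le\<close>)
  then obtain z where "z \<in> {-R<..<R}" "1 \<le> v z" by blast
  then obtain x2 where "m < x2" "x2 < R" "v x2 = 1" using crossing_right by blast
  ultimately show ?thesis using that by blast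
qed

lemma convex_response_nonneg:
  assumes bal: "tilt = 0" and \<Phi>: "continuous_on {-R..R} \<Phi>" "convex_on {-R..R} \<Phi>"
  shows "0 \<le> I (\<lambda>x. \<Phi> x * q x)"
proof -
  obtain x1 x2 where x12: "- R < x1" "x1 < m" "v x1 = -1" "m < x2" "x2 < R" "v x2 = 1"
    using crossings_if_balanced[OF bal] by blast
  define k where "k = (\<Phi> x2 - \<Phi> x1) / (x2 - x1)"
  define l where "l x = k * x + (\<Phi> x1 - k * x1)" for x
  have l1: "l x1 = \<Phi> x1" by (simp add: l_def)
  have "k * (x2 - x1) = \<Phi> x2 - \<Phi> x1" using x12 by (simp add: k_def)
  then have l2: "l x2 = \<Phi> x2" by (simp add: l_def algebra_simps)
  have "0 \<le> I (\<lambda>x. (\<Phi> x - l x) * q x)"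
  proof (rule I_nonneg)
    show "continuous_on {-R..R} (\<lambda>x. (\<Phi> x - l x) * q x)"
      unfolding l_def by (intro continuous_intros \<Phi> cont_q)
    fix x assume x: "x \<in> {-R<..<R}"
    have I: "x \<in> {-R..R}" "x1 \<in> {-R..R}" "x2 \<in> {-R..R}" using x x12 m by auto
    note slope = convex_on_slope_le[OF \<Phi>(2)]
    consider "x < x1" | "x = x1 \<or> x = x2" | "x1 < x" "x < x2" | "x2 < x" by linarith
    then show "0 \<le> (\<Phi> x - l x) * q x"
    proof cases
      case 1
      have "v x \<le> -1" using v_strict_mono[of x x1] 1 x x12 m by auto
      then have "0 \<le> q x" using q_nonneg[OF x] by auto
      moreover have "(\<Phi> x - \<Phi> x1) / (x - x1) \<le> (\<Phi> x1 - \<Phi> x2) / (x1 - x2)"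
        using slope[OF I(1,3), of x1] 1 x12 by (meson order_trans order.strict_trans)
      then have "(\<Phi> x - \<Phi> x1) / (x - x1) \<le> k"
        by (metis k_def minus_diff_eq minus_divide_divide)
      then have "0 \<le> \<Phi> x - l x" using 1 by (simp add: l_def divide_le_eq algebra_simps)
      ultimately show ?thesis by simp
    next
      case 2
      then show ?thesis using l1 l2 by auto
    next
      case 3
      have "\<bar>v x\<bar> \<le> 1" using v_strict_mono[of x1 x] v_strict_mono[of x x2] 3 x x12 by auto
      then have "q x \<le> 0" using q_nonpos[OF x] by auto
      moreover have "(\<Phi> x1 - \<Phi> x) / (x1 - x) \<le> (\<Phi> x1 - \<Phi> x2) / (x1 - x2)"
        using slope(1)[OF I(2,3) 3] .
      then have "(\<Phi> x - \<Phi> x1) / (x - x1) \<le> k"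
        by (metis k_def minus_diff_eq minus_divide_divide)
      then have "\<Phi> x - l x \<le> 0" using 3 by (simp add: l_def divide_le_eq algebra_simps)
      ultimately show ?thesis by (simp add: mult_nonpos_nonpos)
    next
      case 4
      have "1 \<le> v x" using v_strict_mono[of x2 x] 4 x x12 m by auto
      then have "0 \<le> q x" using q_nonneg[OF x] by auto
      moreover have "(\<Phi> x1 - \<Phi> x2) / (x1 - x2) \<le> (\<Phi> x2 - \<Phi> x) / (x2 - x)"
        using slope[OF I(2,1), of x2] 4 x12 by (meson order_trans order.strict_trans)
      then have "k \<le> (\<Phi> x - \<Phi> x2) / (x - x2)"
        by (metis k_def minus_diff_eq minus_divide_divide)
      then have "k * (x - x2) \<le> \<Phi> x - \<Phi> x2" using 4 by (simp add: le_divide_eq)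
      then have "0 \<le> \<Phi> x - l x" using l2 by (simp add: l_def algebra_simps)
      ultimately show ?thesis by simp
    qed
  qed
  also have "I (\<lambda>x. (\<Phi> x - l x) * q x) = I (\<lambda>x. \<Phi> x * q x - (k * x + (\<Phi> x1 - k * x1)) * q x)"
    by (simp add: l_def algebra_simps)
  also have "\<dots> = I (\<lambda>x. \<Phi> x * q x) - I (\<lambda>x. (k * x + (\<Phi> x1 - k * x1)) * q x)"
    by (intro integral_diff integrable_continuous_real continuous_intros \<Phi> cont_q)
  finally show ?thesis by (simp add: I_shift_q bal)
qed

text \<open>Beyond the right sign change \<open>u2\<close> dominates \<open>u1\<close>, and this is
  inherited at \<open>R\<close>: by the values if \<open>sin B > 0\<close>, by the slopes at a
  Dirichlet end. It fixes the sign of the boundary term at \<open>R\<close> in the derivative of the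
  gap.\<close>

lemma right_amplitude_le:
  assumes bal: "tilt = 0"
  shows "R1 \<le> R2"
proof (rule ccontr)
  assume neg: "\<not> R1 \<le> R2"
  obtain x2 where x2: "m < x2" "x2 < R" "v x2 = 1"
    using crossings_if_balanced[OF bal] by blast
  have le: "u1 x \<le> u2 x" if "x2 < x" "x < R" for x
  proof -
    have "1 < v x" using v_strict_mono[of x2 x] that x2 m by auto
    then show ?thesis using u1_pos[of x] that x2 m by (simp add: v_def)
  qed
  define D where "D x = u2 x - u1 x" for x
  have RI: "R \<in> {-R..R}" using R_pos by auto
  have dD: "(D has_real_derivative (R1 - R2) * cos B) (at R)"
    unfolding D_def[abs_def] using du(1,3)[OF RI] right1 right2
    by (auto intro!: derivative_eq_intros simp: algebra_simps)
  have DR: "D R = (R2 - R1) * sin B" by (simp add: D_def right1 right2 algebra_simps)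
  show False
  proof (cases "B = 0")
    case True
    then have "(D has_real_derivative (R1 - R2)) (at R)" "0 < R1 - R2" using dD neg by auto
    then obtain d where d: "0 < d" "\<And>h. 0 < h \<Longrightarrow> h < d \<Longrightarrow> D (R - h) < D R"
      using DERIV_pos_inc_left by blast
    define h where "h = min d (R - x2) / 2"
    have h: "0 < h" "h < d" "x2 < R - h" using d(1) x2 by (auto simp: h_def min_def field_simps)
    show False using d(2)[OF h(1,2)] le[of "R - h"] h DR True by (simp add: D_def)
  next
    case False
    then have "0 < sin B" using B by (intro sin_gt_zero) (auto simp: admissible_def)
    then have "D R < 0" using DR neg by (simp add: mult_neg_pos)
    moreover have "isCont D R" using dD by (rule DERIV_isCont)
    ultimately have "\<forall>\<^sub>F x in at_left R. D x < 0"
      by (intro order_tendstoD(2)[of D "D R"]) (auto simp: isCont_def filterlim_at_split)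
    moreover have "\<forall>\<^sub>F x in at_left R. x2 < x \<and> x < R"
      by (auto simp: eventually_at_left_field intro!: exI[of _ x2] x2)
    ultimately have "\<forall>\<^sub>F x in at_left R. False"
      by eventually_elim (use le in \<open>force simp: D_def\<close>)
    then show False by (simp add: trivial_limit_at_left_real)
  qed
qed

lemma left_amplitude_le:
  assumes bal: "tilt = 0"
  shows "L1 \<le> L2"
proof -
  interpret r: low_pair R "\<lambda>x. U (- x)" B A l1 l2 "\<lambda>x. u1 (- x)" "\<lambda>x. - u1' (- x)"
    "\<lambda>x. - u2 (- x)" "\<lambda>x. u2' (- x)" "- m" R1 L1 R2 L2
    by (rule reflected)
  show ?thesis by (rule r.right_amplitude_le) (simp add: tilt_reflected bal)
qed

end

section \<open>Potentials that are higher to the right of the node\<close>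

text \<open>The quotient sinh x / x increases for x > 0, hence sinh r \<le> (r / A) sinh A \<le> n
  sinh A when r is positive; for other r the two sides have opposite signs.\<close>

lemma sinh_le_mult_sinh:
  fixes n A r :: real
  assumes "0 \<le> n" "0 \<le> A" "r \<le> A" "r \<le> n * A"
  shows "sinh r \<le> n * sinh A"
proof (cases "r \<le> 0")
  case True
  then have "sinh r \<le> 0" by simp
  also have "0 \<le> n * sinh A" using assms by simp
  finally show ?thesis .
next
  case False
  have tanh: "sinh r \<le> r * cosh r"
  proof -
    have "0 * cosh 0 - sinh 0 \<le> r * cosh r - sinh r"
      by (rule deriv_nonneg_mono[where f = "\<lambda>r. r * cosh r - sinh r" and f' = "\<lambda>r. r * sinh r"])
        (use False in \<open>auto intro!: continuous_intros derivative_eq_intros\<close>)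
    then show ?thesis by simp
  qed
  have "r * sinh r - r * sinh r \<le> r * sinh A - A * sinh r"
  proof (rule deriv_nonneg_mono[where f = "\<lambda>A. r * sinh A - A * sinh r" and f' = "\<lambda>A. r * cosh A - sinh r"])
    fix x assume x: "r < x" "x < A"
    have "r * cosh r \<le> r * cosh x" using x False by (intro mult_left_mono) (auto simp: cosh_real_nonneg_le_iff)
    then show "0 \<le> r * cosh x - sinh r" using tanh by simp
  qed (use assms in \<open>auto intro!: continuous_intros derivative_eq_intros\<close>)
  then have "A * sinh r \<le> r * sinh A" by simp
  also have "\<dots> \<le> (n * A) * sinh A" using assms by (intro mult_right_mono) auto
  finally have "A * sinh r \<le> A * (n * sinh A)" by (simp add: mult_ac)
  then show ?thesis using False assms(3) by simp
qed

text \<open>Serves functions such as \<open>LA\<close> below, a logarithm of a quotient that is 0 /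
  0 at the node, where only a limit is at hand.\<close>

lemma nonneg_from_right_limit:
  fixes f f' :: "real \<Rightarrow> real"
  assumes lim: "(f \<longlongrightarrow> 0) (at_right 0)"
    and d: "\<And>x. 0 < x \<Longrightarrow> x < T \<Longrightarrow> (f has_real_derivative f' x) (at x)"
    and nn: "\<And>x. 0 < x \<Longrightarrow> x < T \<Longrightarrow> 0 \<le> f' x"
    and s: "0 < s" "s < T"
  shows "0 \<le> f s"
proof (rule tendsto_upperbound[OF lim])
  have le: "f t \<le> f s" if t: "0 < t" "t < s" for t
  proof (rule deriv_nonneg_mono[where f = f and f' = f'])
    show "continuous_on {t..s} f" by (rule continuous_on_if_deriv[OF d]) (use t s in auto)
  qed (use t s d nn in auto)
  show "\<forall>\<^sub>F x in at_right 0. f x \<le> f s"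
    using le s by (auto simp: eventually_at_right_field intro!: exI[of _ s])
qed auto

text \<open>The node lies left of the centre, so every point to its left has a mirror image about
  \<open>m\<close> inside the interval, and the potential is at least as high at that image.\<close>

locale tilted_pair = low_pair +
  assumes m_neg: "m < 0"
    and U_higher: "0 < s \<Longrightarrow> s < R + m \<Longrightarrow> U (m - s) \<le> U (m + s)"
begin

definition T :: real where "T = R + m"

definition a :: "real \<Rightarrow> real" where "a s = u1 (m + s)"
definition b :: "real \<Rightarrow> real" where "b s = u1 (m - s)"
definition c :: "real \<Rightarrow> real" where "c s = u2 (m + s)"
definition e :: "real \<Rightarrow> real" where "e s = - u2 (m - s)"

text \<open>\<open>H\<close> and \<open>K\<close> are half the Wronskians of \<open>u1\<close> and of \<open>u2\<close> with their mirror images about \<open>m\<close>.\<close>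

definition H :: "real \<Rightarrow> real" where
  "H s = (u1' (m + s) * b s + a s * u1' (m - s)) / 2"
definition K :: "real \<Rightarrow> real" where
  "K s = (u2' (m + s) * e s - c s * u2' (m - s)) / 2"
text \<open>Equal to \<open>- v (m + s) * v (m - s)\<close>: the factor that carries the product of
  the values of \<open>u1\<close> at mirror points to that of \<open>u2\<close>, up to sign.\<close>

definition n :: "real \<Rightarrow> real" where
  "n s = (c s * e s) / (a s * b s)"
text \<open>Up to the positive factor 2 / (c e) this is the derivative of ln (c / e) - ln (a / b),
  which compares the asymmetry of \<open>u2\<close> about the node with that of
  \<open>u1\<close>.\<close>

definition J :: "real \<Rightarrow> real" where
  "J s = K s - n s * H s"
definition n' :: "real \<Rightarrow> real" where
  "n' s = (e s * b s * w (m + s) + c s * a s * w (m - s)) / (a s * b s)\<^sup>2"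
definition d :: "real \<Rightarrow> real" where
  "d s = (U (m + s) - U (m - s)) / 2"

lemma T_pos: "0 < T" and T_R: "m + T < R" "m - T = - R"
  using m m_neg by (auto simp: T_def)

lemma inside:
  assumes "0 \<le> s" "s < T"
  shows "m + s \<in> {-R<..<R}" "m - s \<in> {-R<..<R}" "m + s \<in> {-R..R}" "m - s \<in> {-R..R}"
  using assms m m_neg by (auto simp: T_def)

lemma ab_pos:
  assumes "0 \<le> s" "s < T"
  shows "0 < a s" "0 < b s"
  using u1_pos inside[OF assms] by (auto simp: a_def b_def)

lemma ce_pos:
  assumes "0 < s" "s < T"
  shows "0 < c s" "0 < e s"
  using u2_pos[of "m + s"] u2_neg[of "m - s"] inside[of s] assms by (auto simp: c_def e_def)

lemma d_nonneg: "0 < s \<Longrightarrow> s < T \<Longrightarrow> 0 \<le> d s"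
  using U_higher by (simp add: d_def T_def)

lemma shift_deriv:
  "(f has_real_derivative D) (at (m + s)) \<Longrightarrow> ((\<lambda>s. f (m + s)) has_real_derivative D) (at s)"
  using DERIV_shift[of f D s m] by (simp add: add.commute)

lemma flip_deriv:
  assumes "(f has_real_derivative D) (at (m - s))"
  shows "((\<lambda>s. f (m - s)) has_real_derivative - D) (at s)"
proof -
  have "((\<lambda>s. m - s) has_real_derivative -1) (at s)" by (auto intro!: derivative_eq_intros)
  from DERIV_chain2[OF assms this] show ?thesis by simp
qed

lemma reflected_deriv:
  assumes "0 \<le> s" "s < T"
  shows "(a has_real_derivative u1' (m + s)) (at s)"
    "(b has_real_derivative - u1' (m - s)) (at s)"
    "(c has_real_derivative u2' (m + s)) (at s)"
    "(e has_real_derivative u2' (m - s)) (at s)"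
    "((\<lambda>s. u1' (m + s)) has_real_derivative (U (m + s) - l1) * a s) (at s)"
    "((\<lambda>s. u1' (m - s)) has_real_derivative - ((U (m - s) - l1) * b s)) (at s)"
    "((\<lambda>s. u2' (m + s)) has_real_derivative (U (m + s) - l2) * c s) (at s)"
    "((\<lambda>s. u2' (m - s)) has_real_derivative (U (m - s) - l2) * e s) (at s)"
proof -
  note du' = du[OF inside(3)[OF assms]] du[OF inside(4)[OF assms]]
  show "(a has_real_derivative u1' (m + s)) (at s)"
    "(b has_real_derivative - u1' (m - s)) (at s)"
    "(c has_real_derivative u2' (m + s)) (at s)"
    "((\<lambda>s. u1' (m + s)) has_real_derivative (U (m + s) - l1) * a s) (at s)"
    "((\<lambda>s. u1' (m - s)) has_real_derivative - ((U (m - s) - l1) * b s)) (at s)"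
    "((\<lambda>s. u2' (m + s)) has_real_derivative (U (m + s) - l2) * c s) (at s)"
    unfolding a_def[abs_def] b_def[abs_def] c_def[abs_def]
    by (intro shift_deriv flip_deriv du')+
  show "(e has_real_derivative u2' (m - s)) (at s)"
    using DERIV_minus[OF flip_deriv[OF du'(7)]] by (simp add: e_def[abs_def])
  show "((\<lambda>s. u2' (m - s)) has_real_derivative (U (m - s) - l2) * e s) (at s)"
    using flip_deriv[OF du'(8)] by (simp add: e_def)
qed

lemma w_reflected:
  "w (m + s) = a s * u2' (m + s) - u1' (m + s) * c s"
  "w (m - s) = b s * u2' (m - s) + u1' (m - s) * e s"
  by (simp_all add: w_def a_def b_def c_def e_def)

lemma v_reflected: "v (m + s) = c s / a s" "v (m - s) = - (e s / b s)"
  by (simp_all add: v_def a_def b_def c_def e_def)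

lemma H_deriv:
  assumes "0 \<le> s" "s < T"
  shows "(H has_real_derivative d s * (a s * b s)) (at s)"
proof -
  have "(H has_real_derivative (((U (m + s) - l1) * a s) * b s + (- u1' (m - s)) * u1' (m + s)
      + (u1' (m + s) * u1' (m - s) + (- ((U (m - s) - l1) * b s)) * a s)) / 2) (at s)"
    unfolding H_def[abs_def]
    by (intro DERIV_cdivide DERIV_add DERIV_mult reflected_deriv assms)
  also have "(((U (m + s) - l1) * a s) * b s + (- u1' (m - s)) * u1' (m + s)
      + (u1' (m + s) * u1' (m - s) + (- ((U (m - s) - l1) * b s)) * a s)) / 2 = d s * (a s * b s)"
    by (simp add: d_def algebra_simps)
  finally show ?thesis .
qed

lemma K_deriv:
  assumes "0 \<le> s" "s < T"
  shows "(K has_real_derivative d s * (c s * e s)) (at s)"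
proof -
  have "(K has_real_derivative (((U (m + s) - l2) * c s) * e s + u2' (m - s) * u2' (m + s)
      - (u2' (m + s) * u2' (m - s) + ((U (m - s) - l2) * e s) * c s)) / 2) (at s)"
    unfolding K_def[abs_def]
    by (intro DERIV_cdivide DERIV_diff DERIV_mult reflected_deriv assms)
  also have "(((U (m + s) - l2) * c s) * e s + u2' (m - s) * u2' (m + s)
      - (u2' (m + s) * u2' (m - s) + ((U (m - s) - l2) * e s) * c s)) / 2 = d s * (c s * e s)"
    by (simp add: d_def algebra_simps)
  finally show ?thesis .
qed

lemma n_deriv:
  assumes s: "0 \<le> s" "s < T"
  shows "(n has_real_derivative n' s) (at s)"
proof -
  have nz: "a s * b s \<noteq> 0" using ab_pos[OF s] by simp
  have "(n has_real_derivative
      ((u2' (m + s) * e s + u2' (m - s) * c s) * (a s * b s)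
        - c s * e s * (u1' (m + s) * b s + - u1' (m - s) * a s)) / ((a s * b s) * (a s * b s))) (at s)"
    unfolding n_def[abs_def] by (intro DERIV_divide DERIV_mult reflected_deriv s nz)
  also have "(u2' (m + s) * e s + u2' (m - s) * c s) * (a s * b s)
        - c s * e s * (u1' (m + s) * b s + - u1' (m - s) * a s)
      = e s * b s * w (m + s) + c s * a s * w (m - s)"
    by (simp add: w_reflected algebra_simps)
  finally show ?thesis by (simp add: n'_def power2_eq_square)
qed

lemma n'_pos: "0 < s \<Longrightarrow> s < T \<Longrightarrow> 0 < n' s"
  unfolding n'_def using ab_pos[of s] ce_pos[of s] w_pos inside[of s]
  by (intro divide_pos_pos add_pos_pos mult_pos_pos) auto

lemma n_ab: "0 \<le> s \<Longrightarrow> s < T \<Longrightarrow> n s * (a s * b s) = c s * e s"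
  using ab_pos[of s] by (simp add: n_def)

text \<open>The factor \<open>n\<close> makes the contributions of the potential difference
  \<open>d\<close> cancel, because n a b = c e. What remains is controlled by the sign of the
  monotone function \<open>H\<close>.\<close>

lemma J_deriv:
  assumes s: "0 \<le> s" "s < T"
  shows "(J has_real_derivative - (n' s * H s)) (at s)"
proof -
  have "(J has_real_derivative d s * (c s * e s) - (n' s * H s + d s * (a s * b s) * n s)) (at s)"
    unfolding J_def[abs_def] by (intro DERIV_diff DERIV_mult H_deriv K_deriv n_deriv s)
  also have "d s * (c s * e s) - (n' s * H s + d s * (a s * b s) * n s) = - (n' s * H s)"
    using n_ab[OF s] by algebra
  finally show ?thesis .
qed

lemma at_zero: "n 0 = 0" "K 0 = 0" "J 0 = 0"
  by (simp_all add: n_def K_def J_def c_def e_def u2_m)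

lemma n_pos: "0 < s \<Longrightarrow> s < T \<Longrightarrow> 0 < n s"
  unfolding n_def using ab_pos[of s] ce_pos[of s] by simp

lemma n_mono:
  assumes "0 \<le> s" "s \<le> t" "t < T"
  shows "n s \<le> n t"
proof (rule deriv_nonneg_mono[where f = n and f' = n'])
  show "continuous_on {s..t} n" by (rule continuous_on_if_deriv[OF n_deriv]) (use assms in auto)
  fix x assume x: "s < x" "x < t"
  show "(n has_real_derivative n' x) (at x)" by (rule n_deriv) (use x assms in auto)
  show "0 \<le> n' x" using n'_pos[of x] x assms by simp
qed (use assms in auto)

lemma H_mono:
  assumes "0 \<le> s" "s \<le> t" "t < T"
  shows "H s \<le> H t"
proof (rule deriv_nonneg_mono[where f = H and f' = "\<lambda>s. d s * (a s * b s)"])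
  show "continuous_on {s..t} H" by (rule continuous_on_if_deriv[OF H_deriv]) (use assms in auto)
  fix x assume x: "s < x" "x < t"
  show "(H has_real_derivative d x * (a x * b x)) (at x)" by (rule H_deriv) (use x assms in auto)
  show "0 \<le> d x * (a x * b x)"
    using x assms ab_pos[of x] d_nonneg[of x] by (intro mult_nonneg_nonneg) auto
qed (use assms in auto)

lemma K_nonneg:
  assumes "0 \<le> s" "s < T"
  shows "0 \<le> K s"
proof -
  have "K 0 \<le> K s"
  proof (rule deriv_nonneg_mono[where f = K and f' = "\<lambda>s. d s * (c s * e s)"])
    show "continuous_on {0..s} K" by (rule continuous_on_if_deriv[OF K_deriv]) (use assms in auto)
    fix x assume x: "0 < x" "x < s"
    show "(K has_real_derivative d x * (c x * e x)) (at x)" by (rule K_deriv) (use x assms in auto)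
    show "0 \<le> d x * (c x * e x)"
      using x assms ce_pos[of x] d_nonneg[of x] by (intro mult_nonneg_nonneg) auto
  qed (use assms in auto)
  then show ?thesis by (simp add: at_zero)
qed

text \<open>If \<open>A\<close> is not 0, the denominator is nonzero at \<open>- R\<close> while
  \<open>w\<close> vanishes. At a Dirichlet end both vanish, but w' contains the factor u1 and is 0
  there, while u1' is not.\<close>

lemma w_over_u1_lim: "((\<lambda>x. w x / u1 x) \<longlongrightarrow> 0) (at_right (- R))"
proof -
  have RI: "- R \<in> {-R..R}" using R_pos by auto
  have rt: "(f \<longlongrightarrow> f (- R)) (at_right (- R))" if "(f has_real_derivative D) (at (- R))" for f D
    using DERIV_isCont[OF that] by (auto simp: isCont_def filterlim_at_split)
  show ?thesis
  proof (cases "A = 0")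
    case False
    then have "0 < sin A" using A by (intro sin_gt_zero) (auto simp: admissible_def)
    then have "u1 (- R) \<noteq> 0" using left1 ampl by simp
    then have "((\<lambda>x. w x / u1 x) \<longlongrightarrow> w (- R) / u1 (- R)) (at_right (- R))"
      by (intro tendsto_divide rt[OF w_deriv[OF RI]] rt[OF du(1)[OF RI]])
    then show ?thesis by (simp add: w_ends)
  next
    case True
    have quot: "((\<lambda>x. f x / (x + R)) \<longlongrightarrow> D) (at_right (- R))"
      if "(f has_real_derivative D) (at (- R))" "f (- R) = 0" for f D
      using that unfolding has_field_derivative_iff by (simp add: filterlim_at_split)
    have u0: "u1 (- R) = 0" using True left1 by simp
    have "((\<lambda>x. (w x / (x + R)) / (u1 x / (x + R))) \<longlongrightarrow>
        (l1 - l2) * (u1 (- R) * u2 (- R)) / u1' (- R)) (at_right (- R))"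
      by (intro tendsto_divide quot w_deriv RI w_ends du(1) u0) (use True left1 ampl in simp)
    moreover have "\<forall>\<^sub>F x in at_right (- R). (w x / (x + R)) / (u1 x / (x + R)) = w x / u1 x"
      unfolding eventually_at_filter by (intro always_eventually) auto
    ultimately show ?thesis using u0 by (simp add: Lim_transform_eventually)
  qed
qed

text \<open>\<open>J\<close> is unimodal because its derivative is \<open>- n' H\<close> with \<open>H\<close> increasing, and it is
  nonnegative at both ends of \<open>[0, T)\<close>; at \<open>T\<close> the Wronskian vanishes faster than \<open>u1\<close>.\<close>

lemma J_nonneg:
  assumes s: "0 < s" "s < T"
  shows "0 \<le> J s"
proof (rule ccontr)
  assume neg: "\<not> 0 \<le> J s"
  \<comment> \<open>Since \<open>J\<close> starts at 0, a negative value at \<open>s\<close> forces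
    \<open>H\<close> to be positive at an earlier \<open>t\<close>; as \<open>H\<close> is
    nondecreasing, \<open>J\<close> then stays at or below \<open>J s\<close> from \<open>s\<close>
    on.\<close>
  have "\<exists>t. 0 < t \<and> t < s \<and> J s - J 0 = (s - 0) * - (n' t * H t)"
  proof (rule MVT2)
    show "(J has_real_derivative - (n' x * H x)) (at x)" if "0 \<le> x" "x \<le> s" for x
      by (rule J_deriv) (use that s in auto)
  qed (use s in auto)
  then obtain t where t: "0 < t" "t < s" "J s = s * - (n' t * H t)"
    using at_zero by auto
  have "0 < H t"
  proof (rule ccontr)
    assume "\<not> 0 < H t"
    then have "n' t * H t \<le> 0" using n'_pos[of t] t s by (intro mult_nonneg_nonpos) auto
    then have "0 \<le> J s" using t s by (simp add: mult_nonneg_nonpos)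
    with neg show False by simp
  qed
  then have Hpos: "0 < H x" if "t \<le> x" "x < T" for x using H_mono[of t x] that t by auto
  have Jle: "J x \<le> J s" if "s \<le> x" "x < T" for x
  proof (rule deriv_nonpos_antimono[where f = J and f' = "\<lambda>s. - (n' s * H s)"])
    show "continuous_on {s..x} J" by (rule continuous_on_if_deriv[OF J_deriv]) (use that s in auto)
    fix y assume y: "s < y" "y < x"
    show "(J has_real_derivative - (n' y * H y)) (at y)" by (rule J_deriv) (use y that s in auto)
    show "- (n' y * H y) \<le> 0" using n'_pos[of y] Hpos[of y] y that s t by simp
  qed (use that in auto)
  obtain N where N: "0 < N" "\<And>x. x \<in> {-R..R} \<Longrightarrow> \<bar>u2 x\<bar> \<le> N"
    using continuous_bounded_obtain[OF cont_u(3)] by blast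
  \<comment> \<open>Twice \<open>J\<close> is e w / a, with w at the right point, minus c w / b,
    with w at the left point. The first term is nonnegative, so \<open>J \<le> J s < 0\<close> keeps
    w / u1 away from 0 up to the left end.\<close>
  have lower: "- J s * 2 / N \<le> w x / u1 x" if "- R < x" "x \<le> m - s" for x
  proof -
    define y where "y = m - x"
    have y: "s \<le> y" "y < T" "x = m - y" using that by (auto simp: y_def T_def)
    have ab: "0 < a y" "0 < b y" using ab_pos[of y] y s by auto
    have ce: "0 < c y" "0 < e y" using ce_pos[of y] y s by auto
    have "J y = (e y * (w (m + y) / a y) - c y * (w (m - y) / b y)) / 2"
      unfolding J_def K_def H_def n_def w_reflected using ab by (simp add: field_simps)
    moreover have "0 \<le> e y * (w (m + y) / a y)"
      using ce ab w_pos[of "m + y"] inside[of y] y s by (intro mult_nonneg_nonneg divide_nonneg_pos) auto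
    ultimately have "- J y * 2 \<le> c y * (w (m - y) / b y)" by simp
    also have "\<dots> \<le> N * (w (m - y) / b y)"
      using N(2)[of "m + y", folded c_def] ab w_pos[of "m - y"] inside[of y] y s by (intro mult_right_mono divide_nonneg_pos) auto
    finally have "- J y * 2 / N \<le> w (m - y) / b y"
      by (simp only: pos_divide_le_eq[OF N(1)] mult.commute)
    then have "- J y * 2 / N \<le> w x / u1 x" by (simp add: y(3) b_def)
    moreover have "- J s * 2 / N \<le> - J y * 2 / N"
      using Jle[of y] y N(1) by (intro divide_right_mono) auto
    ultimately show ?thesis by linarith
  qed
  have "\<forall>\<^sub>F x in at_right (- R). w x / u1 x < - J s * 2 / N"
    by (rule order_tendstoD(2)[OF w_over_u1_lim]) (use neg N(1) in \<open>auto simp: divide_neg_pos mult_neg_pos\<close>)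
  moreover have "\<forall>\<^sub>F x in at_right (- R). - R < x \<and> x < m - s"
    using s by (auto simp: eventually_at_right_field T_def intro!: exI[of _ "m - s"])
  ultimately have "\<forall>\<^sub>F x in at_right (- R). False"
    by eventually_elim (use lower in force)
  then show False by simp
qed

text \<open>The two logarithms encode differences of squares at mirror points: c^2 - e^2 = 2 c e
  sinh LA and a^2 - b^2 = 2 a b sinh Lr.\<close>

definition LA :: "real \<Rightarrow> real" where "LA s = ln (c s / e s)"
definition Lr :: "real \<Rightarrow> real" where "Lr s = ln (a s / b s)"

lemma LA_deriv:
  assumes s: "0 < s" "s < T"
  shows "(LA has_real_derivative 2 * K s / (c s * e s)) (at s)"
proof -
  note p = ce_pos[OF s] reflected_deriv[OF less_imp_le[OF s(1)] s(2)]
  have "((\<lambda>s. ln (c s) - ln (e s)) has_real_derivative 1 / c s * u2' (m + s) - 1 / e s * u2' (m - s)) (at s)"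
    by (intro DERIV_diff DERIV_chain2[OF DERIV_ln_divide] p)
  also have "1 / c s * u2' (m + s) - 1 / e s * u2' (m - s) = 2 * K s / (c s * e s)"
    using p(1,2) by (simp add: K_def field_simps)
  finally show ?thesis
  proof (rule has_field_derivative_transform_within_open[of _ _ _ "{0<..<T}"])
    show "ln (c x) - ln (e x) = LA x" if "x \<in> {0<..<T}" for x
      using ce_pos[of x] that by (simp only: LA_def ln_div) simp
  qed (use s in auto)
qed

lemma Lr_deriv:
  assumes s: "0 < s" "s < T"
  shows "(Lr has_real_derivative 2 * H s / (a s * b s)) (at s)"
proof -
  note s' = less_imp_le[OF s(1)] s(2)
  note p = ab_pos[OF s'] reflected_deriv[OF s']
  have "((\<lambda>s. ln (a s) - ln (b s)) has_real_derivative 1 / a s * u1' (m + s) - 1 / b s * - u1' (m - s)) (at s)"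
    by (intro DERIV_diff DERIV_chain2[OF DERIV_ln_divide] p)
  also have "1 / a s * u1' (m + s) - 1 / b s * - u1' (m - s) = 2 * H s / (a s * b s)"
    using p(1,2) by (simp add: H_def field_simps)
  finally show ?thesis
  proof (rule has_field_derivative_transform_within_open[of _ _ _ "{0<..<T}"])
    show "ln (a x) - ln (b x) = Lr x" if "x \<in> {0<..<T}" for x
      using ab_pos[of x] that by (simp only: Lr_def ln_div) simp
  qed (use s in auto)
qed

lemma Lr_lim: "(Lr \<longlongrightarrow> 0) (at_right 0)"
proof -
  have "isCont a 0" "isCont b 0"
    using reflected_deriv(1,2)[of 0] T_pos by (auto intro: DERIV_isCont)
  moreover have z: "0 < a 0" "b 0 = a 0" using ab_pos[of 0] T_pos by (auto simp: a_def b_def)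
  ultimately have "isCont Lr 0"
    unfolding Lr_def[abs_def] by (intro continuous_intros) auto
  then show ?thesis using z by (simp add: isCont_def filterlim_at_split Lr_def)
qed

text \<open>Both \<open>c\<close> and \<open>e\<close> vanish at 0 with the same slope
  \<open>u2' m\<close>, which is positive because the Wronskian at the node equals u1 u2'. Hence
  their quotient tends to 1.\<close>

lemma LA_lim: "(LA \<longlongrightarrow> 0) (at_right 0)"
proof -
  have um: "0 < u2' m"
  proof -
    have "0 < w m" using w_pos m by auto
    then show ?thesis using u1_pos[of m] m by (simp add: w_def u2_m zero_less_mult_iff)
  qed
  have quot: "((\<lambda>s. f s / s) \<longlongrightarrow> D) (at_right 0)"
    if "(f has_real_derivative D) (at 0)" "f 0 = 0" for f D
    using that unfolding has_field_derivative_iff by (simp add: filterlim_at_split)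
  have "((\<lambda>s. c s / s) \<longlongrightarrow> u2' m) (at_right 0)" "((\<lambda>s. e s / s) \<longlongrightarrow> u2' m) (at_right 0)"
    by (rule quot, use reflected_deriv(3,4)[of 0] T_pos in simp, simp add: c_def e_def u2_m)+
  then have "((\<lambda>s. (c s / s) / (e s / s)) \<longlongrightarrow> u2' m / u2' m) (at_right 0)"
    by (rule tendsto_divide) (use um in simp)
  then have "((\<lambda>s. ln ((c s / s) / (e s / s))) \<longlongrightarrow> ln (u2' m / u2' m)) (at_right 0)"
    by (rule tendsto_ln) (use um in simp)
  moreover have "\<forall>\<^sub>F s in at_right 0. ln ((c s / s) / (e s / s)) = LA s"
    unfolding eventually_at_filter by (intro always_eventually) (auto simp: LA_def)
  ultimately show ?thesis using um by (simp add: Lim_transform_eventually)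
qed

lemma LA_nonneg:
  assumes s: "0 < s" "s < T"
  shows "0 \<le> LA s"
proof (rule nonneg_from_right_limit[OF LA_lim LA_deriv])
  show "0 \<le> 2 * K x / (c x * e x)" if "0 < x" "x < T" for x
    using ce_pos[OF that] K_nonneg[of x] that by (intro divide_nonneg_pos mult_pos_pos) auto
qed (use s in auto)

lemma Lr_le_LA:
  assumes s: "0 < s" "s < T"
  shows "Lr s \<le> LA s"
proof -
  have "((\<lambda>s. LA s - Lr s) \<longlongrightarrow> 0 - 0) (at_right 0)" by (intro tendsto_diff LA_lim Lr_lim)
  then have lim: "((\<lambda>s. LA s - Lr s) \<longlongrightarrow> 0) (at_right 0)" by simp
  have "0 \<le> LA s - Lr s"
  proof (rule nonneg_from_right_limit[OF lim _ _ s])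
    fix x assume x: "0 < x" "x < T"
    show "((\<lambda>s. LA s - Lr s) has_real_derivative 2 * J x / (c x * e x)) (at x)"
    proof (rule DERIV_cong[OF DERIV_diff[OF LA_deriv[OF x] Lr_deriv[OF x]]])
      have "H x / (a x * b x) = n x * H x / (c x * e x)"
        using ce_pos[OF x] ab_pos[of x] x by (simp add: n_def)
      then show "2 * K x / (c x * e x) - 2 * H x / (a x * b x) = 2 * J x / (c x * e x)"
        unfolding J_def by (simp add: diff_divide_distrib right_diff_distrib)
    qed
    show "0 \<le> 2 * J x / (c x * e x)"
      using ce_pos[OF x] J_nonneg[OF x] by (intro divide_nonneg_pos mult_pos_pos) auto
  qed
  then show ?thesis by simp
qed

text \<open>In terms of \<open>v\<close> this is - v (m - s) \<le> v (m + s), the exponentiated form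
  of \<open>Lr_le_LA\<close>.\<close>

lemma ratio_le:
  assumes s: "0 < s" "s < T"
  shows "e s / b s \<le> c s / a s"
proof -
  have p: "0 < a s / b s" "0 < c s / e s" using ab_pos[of s] ce_pos[of s] s by auto
  have "a s / b s \<le> c s / e s"
    using Lr_le_LA[OF s] p unfolding LA_def Lr_def by (simp only: ln_le_cancel_iff)
  then show ?thesis using ab_pos[of s] ce_pos[of s] s by (simp add: field_simps)
qed

text \<open>By \<open>ratio_le\<close> the mirror image of a left sign change lies at or beyond the
  right one. The left factor of \<open>n\<close> is 1 there, so \<open>n\<close> coincides with the
  right value of \<open>v\<close>.\<close>

lemma left_crossing_ratio:
  assumes x1: "- R < x1" "x1 < m" "v x1 = -1"
  shows "0 < m - x1" "m - x1 < T" "1 \<le> v (m + (m - x1))" "1 \<le> n (m - x1)"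
proof -
  let ?s = "m - x1"
  show s: "0 < ?s" "?s < T" using x1 by (auto simp: T_def)
  have e: "e ?s / b ?s = 1" using x1(3) v_reflected(2)[of ?s] by simp
  then show *: "1 \<le> v (m + ?s)" using ratio_le[OF s] v_reflected(1)[of ?s] by simp
  have "n ?s = (c ?s / a ?s) * (e ?s / b ?s)" by (simp add: n_def)
  then have "n ?s = v (m + ?s)" unfolding e v_reflected(1) by simp
  then show "1 \<le> n ?s" using * by simp
qed

text \<open>\<open>K - H\<close> is smallest where \<open>n = 1\<close>, and there it coincides with \<open>J\<close>.\<close>

lemma H_le_K:
  assumes x1: "- R < x1" "x1 < m" "v x1 = -1" and s: "0 < s" "s < T"
  shows "H s \<le> K s"
proof -
  note x = left_crossing_ratio[OF x1]
  have "continuous_on {0..m - x1} n"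
    by (rule continuous_on_if_deriv[OF n_deriv]) (use x in auto)
  then obtain t where t: "0 \<le> t" "t \<le> m - x1" "n t = 1"
    using IVT'[of n 0 1 "m - x1"] x at_zero by auto
  have t': "0 < t" "t < T" using t at_zero x by (cases "t = 0"; auto)+
  define Z where "Z s = K s - H s" for s
  have Zt: "0 \<le> Z t" using J_nonneg[OF t'] t by (simp add: Z_def J_def)
  have dZ: "(Z has_real_derivative d s * (a s * b s) * (n s - 1)) (at s)" if "0 \<le> s" "s < T" for s
    unfolding Z_def[abs_def]
    by (rule DERIV_cong[OF DERIV_diff[OF K_deriv[OF that] H_deriv[OF that]]])
      (use n_ab[OF that] in algebra)
  have pos: "0 \<le> d y * (a y * b y)" if "0 < y" "y < T" for y
    using ab_pos[of y] d_nonneg[of y] that by (intro mult_nonneg_nonneg) auto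
  have "Z t \<le> Z s"
  proof (cases "s \<le> t")
    case True
    show ?thesis
    proof (rule deriv_nonpos_antimono[where f = Z and f' = "\<lambda>s. d s * (a s * b s) * (n s - 1)"])
      show "continuous_on {s..t} Z" by (rule continuous_on_if_deriv[OF dZ]) (use s t' in auto)
      fix y assume y: "s < y" "y < t"
      show "(Z has_real_derivative d y * (a y * b y) * (n y - 1)) (at y)"
        by (rule dZ) (use y s t' in auto)
      show "d y * (a y * b y) * (n y - 1) \<le> 0"
        using n_mono[of y t] y s t' t(3) by (intro mult_nonneg_nonpos pos) auto
    qed (use True in auto)
  next
    case False
    show ?thesis
    proof (rule deriv_nonneg_mono[where f = Z and f' = "\<lambda>s. d s * (a s * b s) * (n s - 1)"])
      show "continuous_on {t..s} Z" by (rule continuous_on_if_deriv[OF dZ]) (use s t' in auto)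
      fix y assume y: "t < y" "y < s"
      show "(Z has_real_derivative d y * (a y * b y) * (n y - 1)) (at y)"
        by (rule dZ) (use y s t' in auto)
      show "0 \<le> d y * (a y * b y) * (n y - 1)"
        using n_mono[of t y] y s t' t(3) by (intro mult_nonneg_nonneg pos) auto
    qed (use False in auto)
  qed
  with Zt show ?thesis by (simp add: Z_def)
qed

text \<open>Since n / (c e) = 1 / (a b), the derivative of n LA - Lr is the sum of n' LA and a
  positive multiple of K - H, both nonnegative.\<close>

lemma Lr_le_n_LA:
  assumes x1: "- R < x1" "x1 < m" "v x1 = -1" and s: "0 < s" "s < T"
  shows "Lr s \<le> n s * LA s"
proof -
  have "isCont n 0" by (rule DERIV_isCont[OF n_deriv]) (use T_pos in auto)
  then have "(n \<longlongrightarrow> 0) (at_right 0)" using at_zero by (simp add: isCont_def filterlim_at_split)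
  then have "((\<lambda>s. n s * LA s - Lr s) \<longlongrightarrow> 0 * 0 - 0) (at_right 0)"
    by (intro tendsto_intros LA_lim Lr_lim)
  then have lim: "((\<lambda>s. n s * LA s - Lr s) \<longlongrightarrow> 0) (at_right 0)" by simp
  have "0 \<le> n s * LA s - Lr s"
  proof (rule nonneg_from_right_limit[OF lim _ _ s])
    fix x assume x: "0 < x" "x < T"
    then have x': "0 \<le> x" by simp
    note p = ab_pos[OF x' x(2)] ce_pos[OF x]
    show "((\<lambda>s. n s * LA s - Lr s) has_real_derivative
        n' x * LA x + 2 * (K x - H x) / (a x * b x)) (at x)"
    proof (rule DERIV_cong[OF DERIV_diff[OF DERIV_mult[OF n_deriv[OF x' x(2)] LA_deriv[OF x]] Lr_deriv[OF x]]])
      have "2 * K x / (c x * e x) * n x = 2 * K x / (a x * b x)"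
        unfolding n_def using p by simp
      then show "n' x * LA x + 2 * K x / (c x * e x) * n x - 2 * H x / (a x * b x)
          = n' x * LA x + 2 * (K x - H x) / (a x * b x)"
        by (simp add: diff_divide_distrib right_diff_distrib)
    qed
    show "0 \<le> n' x * LA x + 2 * (K x - H x) / (a x * b x)"
      using n'_pos[OF x] LA_nonneg[OF x] H_le_K[OF x1 x] p
      by (intro add_nonneg_nonneg mult_nonneg_nonneg divide_nonneg_pos mult_pos_pos) auto
  qed
  then show ?thesis by simp
qed

text \<open>Divided by 2 a b, the claim reads sinh Lr \<le> n sinh LA. The two linear bounds
  \<open>Lr \<le> LA\<close> and Lr \<le> n LA are what \<open>sinh_le_mult_sinh\<close> asks
  for.\<close>

lemma q_reflected_le:
  assumes x1: "- R < x1" "x1 < m" "v x1 = -1" and s: "0 < s" "s < T"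
  shows "q (m - s) \<le> q (m + s)"
proof -
  have s': "0 \<le> s" using s by simp
  note p = ab_pos[OF s' s(2)] ce_pos[OF s]
  have sinh_ln: "2 * (x * y) * sinh (ln (x / y)) = x\<^sup>2 - y\<^sup>2" if "0 < x" "0 < y" for x y :: real
    using that by (simp add: sinh_def exp_minus field_simps power2_eq_square)
  have "sinh (Lr s) \<le> n s * sinh (LA s)"
    using n_pos[OF s] LA_nonneg[OF s] Lr_le_LA[OF s] Lr_le_n_LA[OF x1 s]
    by (intro sinh_le_mult_sinh) auto
  then have "2 * (a s * b s) * sinh (Lr s) \<le> 2 * (a s * b s) * (n s * sinh (LA s))"
    using p by (intro mult_left_mono) auto
  also have "\<dots> = 2 * (c s * e s) * sinh (LA s)" using n_ab[OF s' s(2)] by algebra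
  finally have "(a s)\<^sup>2 - (b s)\<^sup>2 \<le> (c s)\<^sup>2 - (e s)\<^sup>2"
    unfolding Lr_def LA_def by (simp only: sinh_ln[OF p(1,2)] sinh_ln[OF p(3,4)])
  then show ?thesis by (simp add: q_def a_def b_def c_def e_def)
qed

text \<open>If there is a left crossing, the integral is recentred at the node and folded about it.
  Mirror pairs contribute a nonnegative amount by \<open>q_reflected_le\<close>, and the part beyond
  \<open>m + T\<close>, which has no mirror image, lies past the right sign change, where
  \<open>q\<close> is positive.\<close>

lemma tilt_pos: "0 < tilt"
proof (cases "\<forall>x\<in>{-R<..<R}. -1 < v x")
  case True
  then show ?thesis by (intro tilt_pos_if_no_left_crossing) auto
next
  case False
  then obtain x where "x \<in> {-R<..<R}" "v x \<le> -1" by (auto simp: not_less)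
  then obtain x1 where x1: "- R < x1" "x1 < m" "v x1 = -1" by (rule crossing_left)
  have cont: "continuous_on {-R..R} (\<lambda>x. (x - m) * q x)" by (intro continuous_intros cont_q)
  have "((\<lambda>x. integral {-R..x} (\<lambda>x. (x - m) * q x)) has_real_derivative (x - m) * q x) (at x within {-R..R})"
    if "x \<in> {-R..R}" for x
    by (rule integral_has_real_derivative[OF cont that])
  from extend_deriv_beyond_interval[OF _ this] R_pos
  obtain F where F: "\<And>x. x \<in> {-R..R} \<Longrightarrow> (F has_real_derivative (x - m) * q x) (at x)"
    by (metis minus_less_iff neg_less_0_iff_less less_trans)
  have cF: "continuous_on {-R..R} F" by (rule continuous_on_if_deriv[OF F])
  have "F (m + 0) - F (m - 0) \<le> F (m + T) - F (m - T)"
  proof (rule deriv_nonneg_mono[where f = "\<lambda>s. F (m + s) - F (m - s)"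
        and f' = "\<lambda>s. s * (q (m + s) - q (m - s))"])
    show "continuous_on {0..T} (\<lambda>s. F (m + s) - F (m - s))"
    proof (rule continuous_on_diff)
      show "continuous_on {0..T} (\<lambda>s. F (m + s))" "continuous_on {0..T} (\<lambda>s. F (m - s))"
        by (rule continuous_on_compose2[OF cF]; use T_R m T_pos in \<open>force intro: continuous_intros\<close>)+
    qed
    fix s assume s: "0 < s" "s < T"
    then have s': "0 \<le> s" by simp
    show "((\<lambda>s. F (m + s) - F (m - s)) has_real_derivative s * (q (m + s) - q (m - s))) (at s)"
      by (rule DERIV_cong[OF DERIV_diff[OF shift_deriv[OF F[OF inside(3)[OF s' s(2)]]]
              flip_deriv[OF F[OF inside(4)[OF s' s(2)]]]]])
        (simp add: algebra_simps)
    show "0 \<le> s * (q (m + s) - q (m - s))"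
      using q_reflected_le[OF x1 s] s by simp
  qed (use T_pos in auto)
  then have 1: "F (- R) \<le> F (m + T)" using T_R by simp
  have 2: "F (m + T) < F R"
  proof (rule deriv_pos_strict_mono[where f = F and f' = "\<lambda>x. (x - m) * q x"])
    show "continuous_on {m + T..R} F"
      by (rule continuous_on_subset[OF cF]) (use T_pos m in auto)
    fix x assume x: "m + T < x" "x < R"
    then have x': "x \<in> {-R<..<R}" using T_pos m by auto
    show "(F has_real_derivative (x - m) * q x) (at x)" by (rule F) (use x' in auto)
    have "v (m + (m - x1)) < v x"
      by (rule v_strict_mono) (use left_crossing_ratio[OF x1] x m in auto)
    then have "1 < v x" using left_crossing_ratio(3)[OF x1] by simp
    then have "0 < (v x)\<^sup>2 - 1" by (simp add: power2_eq_square less_1_mult)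
    then have "0 < q x" using u1_pos[OF x'] by (simp add: q_eq[OF x'])
    then show "0 < (x - m) * q x" using x T_pos by simp
  qed (use T_R in auto)
  have "I (\<lambda>x. (1 * x + - m) * q x) = F R - F (- R)"
    using integral_derivative[OF F] by simp
  then show ?thesis using 1 2 unfolding I_shift_q by simp
qed

end

section \<open>Position of the node for increasing potentials\<close>

context low_pair
begin

text \<open>The hypothesis \<open>0 \<le> 2 * R * cos B + sin B\<close> is \<open>\<beta> \<ge> -1/L\<close>; it makes the lowest eigenvalue nonnegative
  for a Dirichlet condition at the node and the given condition at \<open>R\<close>.\<close>

lemma potential_at_node_le:
  assumes m0: "0 \<le> m" and bc: "0 \<le> 2 * R * cos B + sin B"
    and mono: "\<And>x y. - R \<le> x \<Longrightarrow> x \<le> y \<Longrightarrow> y \<le> R \<Longrightarrow> U x \<le> U y"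
  shows "U m \<le> l2"
proof (rule ccontr)
  assume "\<not> U m \<le> l2"
  \<comment> \<open>Otherwise \<open>u2\<close> would be strictly convex right of the node and its
    slope at \<open>R\<close> would exceed that of the chord from the node, so the boundary
    condition would have to be more negative than \<open>bc\<close> allows.\<close>
  then have pos: "0 < (U x - l2) * u2 x" if "m < x" "x < R" for x
    using mono[of m x] u2_pos[OF that] that m by (intro mult_pos_pos) auto
  have "\<exists>z. m < z \<and> z < R \<and> u2 R - u2 m = (R - m) * u2' z"
    by (rule MVT2) (use m du(3) in auto)
  then obtain z where z: "m < z" "z < R" "u2 R = (R - m) * u2' z" by (auto simp: u2_m)
  have "u2' z < u2' R"
  proof (rule deriv_pos_strict_mono[where f = u2' and f' = "\<lambda>x. (U x - l2) * u2 x"])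
    show "continuous_on {z..R} u2'" by (rule continuous_on_subset[OF cont_u(4)]) (use z m in auto)
  qed (use z pos du(4) m in auto)
  then have "(R - m) * u2' z < (R - m) * u2' R" using m by (intro mult_strict_left_mono) auto
  then have "R2 * sin B < R2 * (- (R - m) * cos B)" using z(3) right2 by (simp add: algebra_simps)
  then have "sin B < - (R - m) * cos B" using ampl by (simp only: mult_less_cancel_left_pos)
  then have lt: "sin B + (R - m) * cos B < 0" by (simp add: algebra_simps)
  have "0 \<le> sin B" using B by (intro sin_ge_zero) (auto simp: admissible_def)
  then have "(R - m) * cos B < 0" using lt by linarith
  then have "cos B < 0" using m by (simp add: mult_less_0_iff)
  then have "2 * R * cos B \<le> (R - m) * cos B" using m m0 by (intro mult_right_mono_neg) auto
  then show False using lt bc by linarith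
qed

text \<open>Suppose the node is not left of the centre and reflect the left piece about it. The
  increasing potential makes the Wronskian of \<open>c\<close> and \<open>e\<close> positive at
  \<open>T\<close>, so cos B e + sin B e' is negative there. Left of the node \<open>U\<close> is at
  most \<open>l2\<close>, so this expression divided by \<open>e\<close> cannot increase from
  \<open>T\<close> to \<open>S\<close>; but at \<open>S\<close> it is 0, because both ends carry the
  same condition.\<close>

lemma node_negative_symmetric:
  assumes AB: "A = B" and bc: "0 \<le> 2 * R * cos B + sin B"
    and mono: "\<And>x y. - R \<le> x \<Longrightarrow> x < y \<Longrightarrow> y \<le> R \<Longrightarrow> U x < U y"
  shows "m < 0"
proof (rule ccontr)
  assume "\<not> m < 0"
  then have m0: "0 \<le> m" by simp
  have mono': "U x \<le> U y" if "- R \<le> x" "x \<le> y" "y \<le> R" for x y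
    using mono[of x y] that by (cases "x = y") auto
  have l2: "U m \<le> l2" by (rule potential_at_node_le[OF m0 bc mono'])
  define c where "c s = u2 (m + s)" for s
  define c' where "c' s = u2' (m + s)" for s
  define e where "e s = - u2 (m - s)" for s
  define e' where "e' s = u2' (m - s)" for s
  have dc: "(c has_real_derivative c' s) (at s)" "(c' has_real_derivative (U (m + s) - l2) * c s) (at s)"
    if "m + s \<in> {-R..R}" for s
    using DERIV_shift[of u2 "u2' (m + s)" s m] DERIV_shift[of u2' "(U (m + s) - l2) * u2 (m + s)" s m]
      du(3,4)[OF that]
    by (simp_all add: c_def[abs_def] c'_def[abs_def] add.commute)
  have lin: "((\<lambda>s. m - s) has_real_derivative -1) (at s)" for s by (auto intro!: derivative_eq_intros)
  have de: "(e has_real_derivative e' s) (at s)" "(e' has_real_derivative (U (m - s) - l2) * e s) (at s)"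
    if "m - s \<in> {-R..R}" for s
    using DERIV_minus[OF DERIV_chain2[OF du(3)[OF that] lin]] DERIV_chain2[OF du(4)[OF that] lin]
    by (simp_all add: e_def[abs_def] e'_def[abs_def])
  define T where "T = R - m"
  define S where "S = R + m"
  have TS: "0 < T" "T \<le> S" "0 < S" using m m0 by (auto simp: T_def S_def)
  have epos: "0 < e s" if "0 < s" "s < S" for s using u2_neg[of "m - s"] that by (simp add: e_def S_def)
  have cpos: "0 < c s" if "0 < s" "s < T" for s using u2_pos[of "m + s"] that by (simp add: c_def T_def)
  have inT: "m + s \<in> {-R..R}" "m - s \<in> {-R..R}" if "0 \<le> s" "s \<le> T" for s
    using that m m0 by (auto simp: T_def)
  have inS: "m - s \<in> {-R..R}" if "0 \<le> s" "s \<le> S" for s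
    using that m m0 by (auto simp: S_def)
  have "c' 0 * e 0 - c 0 * e' 0 < c' T * e T - c T * e' T"
  proof (rule deriv_pos_strict_mono[where f = "\<lambda>s. c' s * e s - c s * e' s" and
        f' = "\<lambda>s. (U (m + s) - U (m - s)) * (c s * e s)"])
    have d: "((\<lambda>s. c' s * e s - c s * e' s) has_real_derivative (U (m + s) - U (m - s)) * (c s * e s)) (at s)"
      if "0 \<le> s" "s \<le> T" for s
      by (rule DERIV_cong[OF DERIV_diff[OF DERIV_mult[OF dc(2) de(1)] DERIV_mult[OF dc(1) de(2)]]])
        (use inT[OF that] in \<open>auto simp: algebra_simps\<close>)
    show "continuous_on {0..T} (\<lambda>s. c' s * e s - c s * e' s)"
      by (rule continuous_on_if_deriv[OF d]) auto
    fix s assume s: "0 < s" "s < T"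
    show "((\<lambda>s. c' s * e s - c s * e' s) has_real_derivative (U (m + s) - U (m - s)) * (c s * e s)) (at s)"
      by (rule d) (use s in auto)
    show "0 < (U (m + s) - U (m - s)) * (c s * e s)"
      using mono[of "m - s" "m + s"] inT[of s] s epos[of s] cpos[of s] TS by (intro mult_pos_pos) auto
  qed (use TS in auto)
  moreover have "c T = R2 * sin B" "c' T = - R2 * cos B"
    by (simp_all add: c_def c'_def T_def right2)
  moreover have "c 0 = 0" "e 0 = 0" by (simp_all add: c_def e_def u2_m)
  ultimately have "R2 * (cos B * e T + sin B * e' T) < 0" by (simp add: algebra_simps)
  then have FT: "cos B * e T + sin B * e' T < 0" using ampl by (simp add: mult_less_0_iff)
  have eS: "e S = L2 * sin B" "e' S = - L2 * cos B"
    by (simp_all add: e_def e'_def S_def left2 AB)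
  have FS: "cos B * e S + sin B * e' S = 0" by (simp add: eS)
  then have "T \<noteq> S" using FT by auto
  then have T: "T < S" using TS by simp
  show False
  proof (cases "B = 0")
    case True
    then show False using FT epos[of T] T TS by simp
  next
    case False
    then have sB: "0 < sin B" using B by (intro sin_gt_zero) (auto simp: admissible_def)
    then have eSpos: "0 < e S" using eS ampl by simp
    have epos': "0 < e s" if "T \<le> s" "s \<le> S" for s
      using epos[of s] eSpos that TS by (cases "s = S") auto
    have d: "((\<lambda>s. (cos B * e s + sin B * e' s) / e s) has_real_derivative
        sin B * ((U (m - s) - l2) * (e s)\<^sup>2 - (e' s)\<^sup>2) / (e s)\<^sup>2) (at s)" if "T \<le> s" "s \<le> S" for s
      using de[OF inS[of s]] epos'[OF that] that TS
      by (auto intro!: derivative_eq_intros simp: power2_eq_square algebra_simps)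
    have "(cos B * e S + sin B * e' S) / e S \<le> (cos B * e T + sin B * e' T) / e T"
    proof (rule deriv_nonpos_antimono[where f = "\<lambda>s. (cos B * e s + sin B * e' s) / e s"
          and f' = "\<lambda>s. sin B * ((U (m - s) - l2) * (e s)\<^sup>2 - (e' s)\<^sup>2) / (e s)\<^sup>2"])
      show "continuous_on {T..S} (\<lambda>s. (cos B * e s + sin B * e' s) / e s)"
        by (rule continuous_on_if_deriv[OF d]) auto
      fix s assume s: "T < s" "s < S"
      show "((\<lambda>s. (cos B * e s + sin B * e' s) / e s) has_real_derivative
        sin B * ((U (m - s) - l2) * (e s)\<^sup>2 - (e' s)\<^sup>2) / (e s)\<^sup>2) (at s)"
        by (rule d) (use s in auto)
      have "U (m - s) \<le> l2" using mono'[of "m - s" m] inS[of s] s TS l2 m by auto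
      then have "(U (m - s) - l2) * (e s)\<^sup>2 \<le> 0" by (intro mult_nonpos_nonneg) auto
      moreover have "0 \<le> (e' s)\<^sup>2" by simp
      ultimately have "(U (m - s) - l2) * (e s)\<^sup>2 - (e' s)\<^sup>2 \<le> 0" by linarith
      then show "sin B * ((U (m - s) - l2) * (e s)\<^sup>2 - (e' s)\<^sup>2) / (e s)\<^sup>2 \<le> 0"
        using sB by (intro divide_nonpos_nonneg mult_nonneg_nonpos) auto
    qed (use T in auto)
    then have "0 \<le> (cos B * e T + sin B * e' T) / e T" using FS by simp
    then show False using FT epos'[of T] T by (simp add: zero_le_divide_iff)
  qed
qed

text \<open>With different end angles the mirror argument lacks its closing boundary condition, and
  steepness replaces it. If \<open>m \<ge> 0\<close>, then at distance R / 2 or more left of the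
  node \<open>U\<close> is below \<open>l2\<close> by at least \<sigma> R / 2, and \<open>u2\<close>
  would have to change sign within a window of length R / 2 as soon as \<sigma> R / 2 \<ge> (2 pi /
  R)^2. This is the origin of 8 pi^2 / R^3.\<close>

lemma node_negative_steep:
  assumes bc: "0 \<le> 2 * R * cos B + sin B" and \<sigma>: "8 * pi\<^sup>2 / R ^ 3 \<le> \<sigma>"
    and mono: "\<And>x y. - R \<le> x \<Longrightarrow> x \<le> y \<Longrightarrow> y \<le> R \<Longrightarrow> \<sigma> * (y - x) \<le> U y - U x"
  shows "m < 0"
proof (rule ccontr)
  assume "\<not> m < 0"
  then have m0: "0 \<le> m" by simp
  have \<sigma>0: "0 < \<sigma>" using \<sigma> R_pos by (intro less_le_trans[OF _ \<sigma>]) auto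
  have mono': "U x \<le> U y" if "- R \<le> x" "x \<le> y" "y \<le> R" for x y
  proof -
    have "0 \<le> \<sigma> * (y - x)" using \<sigma>0 that by (intro mult_nonneg_nonneg) auto
    then show ?thesis using mono[OF that] by linarith
  qed
  have l2: "U m \<le> l2" by (rule potential_at_node_le[OF m0 bc mono'])
  have lin: "((\<lambda>s. m - s) has_real_derivative -1) (at s)" for s by (auto intro!: derivative_eq_intros)
  have inside: "m - s \<in> {-R..R}" if "s \<in> {R/2..R}" for s using that m m0 by auto
  have neg: "u2 x \<le> 0" if "- R \<le> x" "x < m" for x
  proof (cases "x = - R")
    case True
    have "0 \<le> sin A" using A by (intro sin_ge_zero) (auto simp: admissible_def)
    then show ?thesis using True left2 ampl by simp
  next
    case False
    then show ?thesis using u2_neg[of x] that by simp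
  qed
  show False
  proof (rule sine_comparison[of "R/2" R "2 * pi / R" "\<lambda>s. - u2 (m - s)" "\<lambda>s. u2' (m - s)"
        "\<lambda>s. - ((U (m - s) - l2) * u2 (m - s))"])
    show "2 * pi / R = pi / (R - R / 2)" using R_pos by simp
    show "0 \<le> - u2 (m - R)" using neg[of "m - R"] m0 R_pos by simp
    show "0 < - u2 (m - R / 2)" using u2_neg[of "m - R / 2"] m0 R_pos by simp
    fix s assume s: "s \<in> {R/2..R}"
    show "((\<lambda>s. - u2 (m - s)) has_real_derivative u2' (m - s)) (at s)"
      using DERIV_minus[OF DERIV_chain2[OF du(3)[OF inside[OF s]] lin]] by simp
    show "((\<lambda>s. u2' (m - s)) has_real_derivative - ((U (m - s) - l2) * u2 (m - s))) (at s)"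
      using DERIV_chain2[OF du(4)[OF inside[OF s]] lin] by simp
    have "\<sigma> * s \<le> U m - U (m - s)" using mono[of "m - s" m] inside[OF s] s m R_pos by auto
    moreover have "(8 * pi\<^sup>2 / R ^ 3) * (R / 2) \<le> \<sigma> * s"
      using \<sigma> s \<sigma>0 R_pos by (intro mult_mono) auto
    moreover have "(8 * pi\<^sup>2 / R ^ 3) * (R / 2) = (2 * pi / R)\<^sup>2"
      using R_pos by (simp add: power2_eq_square power3_eq_cube field_simps)
    ultimately have "U (m - s) - l2 \<le> - (2 * pi / R)\<^sup>2" using l2 by linarith
    moreover have "u2 (m - s) \<le> 0" using neg[of "m - s"] inside[OF s] s R_pos by auto
    ultimately have "- (2 * pi / R)\<^sup>2 * u2 (m - s) \<le> (U (m - s) - l2) * u2 (m - s)"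
      by (intro mult_right_mono_neg)
    then show "- ((U (m - s) - l2) * u2 (m - s)) \<le> - (2 * pi / R)\<^sup>2 * - u2 (m - s)" by simp
  qed (use R_pos in auto)
qed

lemma tilt_pos_increasing:
  assumes bc: "0 \<le> 2 * R * cos B + sin B" and \<sigma>: "0 < \<sigma>" "A = B \<or> 8 * pi\<^sup>2 / R ^ 3 \<le> \<sigma>"
    and mono: "\<And>x y. - R \<le> x \<Longrightarrow> x \<le> y \<Longrightarrow> y \<le> R \<Longrightarrow> \<sigma> * (y - x) \<le> U y - U x"
  shows "0 < tilt"
proof -
  have strict: "U x < U y" if "- R \<le> x" "x < y" "y \<le> R" for x y
  proof -
    have "0 < \<sigma> * (y - x)" using \<sigma>(1) that by (intro mult_pos_pos) auto
    also have "\<dots> \<le> U y - U x" using mono that by auto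
    finally show ?thesis by simp
  qed
  have mneg: "m < 0"
    using \<sigma>(2) node_negative_symmetric[OF _ bc strict] node_negative_steep[OF bc _ mono] by blast
  interpret t: tilted_pair R U A B l1 l2 u1 u1' u2 u2' m L1 R1 L2 R2
    by unfold_locales (use mneg strict[THEN less_imp_le] in auto)
  show ?thesis by (rule t.tilt_pos)
qed

lemma tilt_neg_decreasing:
  assumes bc: "0 \<le> 2 * R * cos A + sin A" and \<sigma>: "0 < \<sigma>" "A = B \<or> 8 * pi\<^sup>2 / R ^ 3 \<le> \<sigma>"
    and mono: "\<And>x y. - R \<le> x \<Longrightarrow> x \<le> y \<Longrightarrow> y \<le> R \<Longrightarrow> \<sigma> * (y - x) \<le> U x - U y"
  shows "tilt < 0"
proof -
  interpret r: low_pair R "\<lambda>x. U (- x)" B A l1 l2 "\<lambda>x. u1 (- x)" "\<lambda>x. - u1' (- x)"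
    "\<lambda>x. - u2 (- x)" "\<lambda>x. u2' (- x)" "- m" R1 L1 R2 L2
    by (rule reflected)
  have "0 < r.tilt"
  proof (rule r.tilt_pos_increasing[OF bc \<sigma>(1)])
    show "\<sigma> * (y - x) \<le> U (- y) - U (- x)" if "- R \<le> x" "x \<le> y" "y \<le> R" for x y
      using mono[of "- y" "- x"] that by simp
  qed (use \<sigma> in auto)
  then show ?thesis by (simp add: tilt_reflected)
qed

end

section \<open>Minimising the gap over linear perturbations\<close>

context symmetric_interval
begin

definition gap_fun :: "(real \<Rightarrow> real) \<Rightarrow> real \<Rightarrow> real \<Rightarrow> real" where
  "gap_fun U A B = eig 2 U A B - eig 1 U A B"

text \<open>Inside the interval the phase of the first solution stays in (0, pi); that of the second
  passes pi once, at \<open>m\<close>, and stays below 2 pi. The minus sign on the second solution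
  meets the convention of \<open>low_pair\<close>.\<close>

lemma low_pair_shots:
  assumes U: "continuous_on {-R..R} U" and A: "admissible A" and B: "admissible B"
    and l1: "l1 = eig 1 U A B" and l2: "l2 = eig 2 U A B"
    and N1: "N1 = sqrt (I (\<lambda>x. (shot U l1 A x)\<^sup>2))" and N2: "N2 = sqrt (I (\<lambda>x. (shot U l2 A x)\<^sup>2))"
  obtains m where "0 < N1" "0 < N2" "low_pair R U A B l1 l2 (\<lambda>x. shot U l1 A x / N1) (\<lambda>x. dshot U l1 A x / N1)
      (\<lambda>x. - shot U l2 A x / N2) (\<lambda>x. - dshot U l2 A x / N2) m
      (1 / N1) (exp (log_amplitude U l1 A R) / N1) (1 / N2) (exp (log_amplitude U l2 A R) / N2)"
proof -
  have sol: "solves U l (shot U l A) (dshot U l A)" for l by (rule solves_shot[OF U])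
  have cu: "continuous_on {-R..R} (shot U l A)" for l by (rule solves_cont[OF sol])
  have Ipos: "0 < I (\<lambda>x. (shot U l A x)\<^sup>2)" for l
  proof -
    obtain t where "t \<in> {-R<..<R}" "sin (phase U l A t) \<noteq> 0"
      using sin_angle_nonzero[OF cont_shift[OF U]] by blast
    then show ?thesis
      by (intro I_pos[of _ t] continuous_intros cu) (auto simp: shot_def)
  qed
  have N: "0 < N1" "0 < N2" "N1\<^sup>2 = I (\<lambda>x. (shot U l1 A x)\<^sup>2)" "N2\<^sup>2 = I (\<lambda>x. (shot U l2 A x)\<^sup>2)"
    using Ipos[of l1] Ipos[of l2] by (auto simp: N1 N2)
  have c: "continuous_on {-R..R} (\<lambda>x. l - U x)" for l by (rule cont_shift[OF U])
  have up: "real k * pi < phase U l A x" if "- R \<le> p" "p < x" "x \<le> R" "real k * pi \<le> phase U l A p" for k p x l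
    by (rule angle_crosses_upward[OF c that])
  have pos: "0 < phase U l A x" if "- R < x" "x \<le> R" for x l
    using up[of "-R" x 0] that A c by (simp add: admissible_def)
  have end1: "phase U l1 A R = pi - B" and end2: "phase U l2 A R = 2 * pi - B"
    using phase_eig[OF U A B, of 1] phase_eig[OF U A B, of 2] l1 l2 by auto
  have Bb: "0 \<le> B" "B < pi" using B by (auto simp: admissible_def)
  have below1: "phase U l1 A x < pi" if "- R \<le> x" "x < R" for x
    using up[of x R 1 l1] that end1 Bb by (cases "phase U l1 A x < pi") auto
  have below2: "phase U l2 A x < 2 * pi" if "- R \<le> x" "x < R" for x
    using up[of x R 2 l2] that end2 Bb by (cases "phase U l2 A x < 2 * pi") auto
  have "phase U l2 A (- R) \<le> pi" "pi \<le> phase U l2 A R" using A c end2 Bb by (auto simp: admissible_def)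
  then obtain m where m: "- R \<le> m" "m \<le> R" "phase U l2 A m = pi"
    using IVT'[OF _ _ _ continuous_on_angle[OF c[of l2]], of A pi] R_pos by auto
  have m': "- R < m" "m < R"
    using m end2 Bb A c by (auto simp: admissible_def less_le)
  have small: "phase U l2 A x < pi" if "- R \<le> x" "x < m" for x
    using up[of x m 1 l2] that m by (cases "phase U l2 A x < pi") auto
  have large: "pi < phase U l2 A x" if "m < x" "x \<le> R" for x
    using up[of m x 1 l2] that m by auto
  show ?thesis
  proof (rule that[OF N(1,2)], unfold_locales)
    have div: "solves U l (\<lambda>x. k * u x) (\<lambda>x. k * u' x)" if "solves U l u u'" for k l u u'
      using that unfolding solves_def by (auto intro!: derivative_eq_intros)
    show "solves U l1 (\<lambda>x. shot U l1 A x / N1) (\<lambda>x. dshot U l1 A x / N1)"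
      using div[OF sol, of l1 "1 / N1"] by simp
    show "solves U l2 (\<lambda>x. - shot U l2 A x / N2) (\<lambda>x. - dshot U l2 A x / N2)"
      using div[OF sol, of l2 "- 1 / N2"] by simp
    show "l1 < l2" unfolding l1 l2 by (rule eig_less[OF U A B])
    show "0 < shot U l1 A x / N1" if "x \<in> {-R<..<R}" for x
      using pos[of x l1] below1[of x] that N by (auto simp: shot_def intro!: divide_pos_pos mult_pos_pos sin_gt_zero)
    show "- shot U l2 A m / N2 = 0" using m by (simp add: shot_def)
    show "- shot U l2 A x / N2 < 0" if "- R < x" "x < m" for x
      using pos[of x l2] small[of x] that m N by (auto simp: shot_def intro!: divide_pos_pos mult_pos_pos sin_gt_zero)
    show "0 < - shot U l2 A x / N2" if "m < x" "x < R" for x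
    proof -
      have "0 < sin (phase U l2 A x - pi)"
        using large[of x] below2[of x] that m by (intro sin_gt_zero) auto
      then have "sin (phase U l2 A x) < 0" by simp
      then show ?thesis using N by (simp add: shot_def mult_pos_neg divide_neg_pos)
    qed
    show "I (\<lambda>x. (shot U l1 A x / N1)\<^sup>2) = 1" "I (\<lambda>x. (- shot U l2 A x / N2)\<^sup>2) = 1"
      using N Ipos[of l1] Ipos[of l2] by (simp_all add: power_divide)
  qed (use U A B m' N R_pos end1 end2 in \<open>simp_all add: shot_init[OF U] shot_def[of _ _ _ R] dshot_def[of _ _ _ R] sin_diff cos_diff\<close>)
qed

text \<open>The pair is obtained before the direction is chosen: the minimality argument tests one
  point in several directions and has to see the same eigenfunctions each time.\<close>

lemma gap_deriv:
  assumes U: "continuous_on {-R..R} U" and A: "admissible A" and B: "admissible B"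
  obtains u1 u1' u2 u2' m L1 R1 L2 R2
  where "low_pair R U A B (eig 1 U A B) (eig 2 U A B) u1 u1' u2 u2' m L1 R1 L2 R2"
    and "\<And>\<Phi> a b H. continuous_on {-R..R} \<Phi> \<Longrightarrow>
      (\<And>h. h \<in> H \<Longrightarrow> admissible (A - h * a) \<and> admissible (B - h * b)) \<Longrightarrow> at 0 within H \<noteq> bot \<Longrightarrow>
      ((\<lambda>h. (gap_fun (\<lambda>x. U x + h * \<Phi> x) (A - h * a) (B - h * b) - gap_fun U A B) / h) \<longlongrightarrow>
        I (\<lambda>x. \<Phi> x * ((u2 x)\<^sup>2 - (u1 x)\<^sup>2)) + b * (R2\<^sup>2 - R1\<^sup>2) + a * (L2\<^sup>2 - L1\<^sup>2)) (at 0 within H)"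
proof -
  define l1 where "l1 = eig 1 U A B"
  define l2 where "l2 = eig 2 U A B"
  define N1 where "N1 = sqrt (I (\<lambda>x. (shot U l1 A x)\<^sup>2))"
  define N2 where "N2 = sqrt (I (\<lambda>x. (shot U l2 A x)\<^sup>2))"
  obtain m where N: "0 < N1" "0 < N2"
    and pair: "low_pair R U A B l1 l2 (\<lambda>x. shot U l1 A x / N1) (\<lambda>x. dshot U l1 A x / N1)
      (\<lambda>x. - shot U l2 A x / N2) (\<lambda>x. - dshot U l2 A x / N2) m
      (1 / N1) (exp (log_amplitude U l1 A R) / N1) (1 / N2) (exp (log_amplitude U l2 A R) / N2)"
    using low_pair_shots[OF U A B l1_def l2_def N1_def N2_def] by blast
  have NN: "N1\<^sup>2 = I (\<lambda>x. (shot U l1 A x)\<^sup>2)" "N2\<^sup>2 = I (\<lambda>x. (shot U l2 A x)\<^sup>2)"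
    using N by (auto simp: N1_def N2_def)
  show ?thesis
  proof (rule that[OF pair[unfolded l1_def l2_def]], fold l1_def l2_def)
    fix \<Phi> :: "real \<Rightarrow> real" and a b :: real and H :: "real set"
    assume \<Phi>: "continuous_on {-R..R} \<Phi>"
      and H: "\<And>h. h \<in> H \<Longrightarrow> admissible (A - h * a) \<and> admissible (B - h * b)"
      and bot: "at 0 within H \<noteq> bot"
    note d = tendsto_diff[OF eig_deriv[OF U \<Phi> A B H bot, where n = 2, OF _ _ l2_def]
        eig_deriv[OF U \<Phi> A B H bot, where n = 1, OF _ _ l1_def]]
    have cu: "continuous_on {-R..R} (shot U l A)" for l by (rule solves_cont[OF solves_shot[OF U]])
    have "I (\<lambda>x. \<Phi> x * ((- shot U l2 A x / N2)\<^sup>2 - (shot U l1 A x / N1)\<^sup>2))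
        = I (\<lambda>x. \<Phi> x * (shot U l2 A x)\<^sup>2 / N2\<^sup>2 - \<Phi> x * (shot U l1 A x)\<^sup>2 / N1\<^sup>2)"
      by (simp add: power_divide right_diff_distrib)
    also have "\<dots> = I (\<lambda>x. \<Phi> x * (shot U l2 A x)\<^sup>2 / N2\<^sup>2) - I (\<lambda>x. \<Phi> x * (shot U l1 A x)\<^sup>2 / N1\<^sup>2)"
      by (intro integral_diff integrable_continuous_real continuous_intros \<Phi> cu) (use N in auto)
    finally have split: "I (\<lambda>x. \<Phi> x * ((- shot U l2 A x / N2)\<^sup>2 - (shot U l1 A x / N1)\<^sup>2))
        = I (\<lambda>x. \<Phi> x * (shot U l2 A x)\<^sup>2) / N2\<^sup>2 - I (\<lambda>x. \<Phi> x * (shot U l1 A x)\<^sup>2) / N1\<^sup>2"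
      by simp
    have val: "I (\<lambda>x. \<Phi> x * ((- shot U l2 A x / N2)\<^sup>2 - (shot U l1 A x / N1)\<^sup>2))
        + b * ((exp (log_amplitude U l2 A R) / N2)\<^sup>2 - (exp (log_amplitude U l1 A R) / N1)\<^sup>2)
        + a * ((1 / N2)\<^sup>2 - (1 / N1)\<^sup>2)
      = (I (\<lambda>x. \<Phi> x * (shot U l2 A x)\<^sup>2) + b * (exp (log_amplitude U l2 A R))\<^sup>2 + a) / N2\<^sup>2
        - (I (\<lambda>x. \<Phi> x * (shot U l1 A x)\<^sup>2) + b * (exp (log_amplitude U l1 A R))\<^sup>2 + a) / N1\<^sup>2"
      unfolding split by (simp add: power_divide add_divide_distrib right_diff_distrib)
    show "((\<lambda>h. (gap_fun (\<lambda>x. U x + h * \<Phi> x) (A - h * a) (B - h * b) - gap_fun U A B) / h) \<longlongrightarrow>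
        I (\<lambda>x. \<Phi> x * ((- shot U l2 A x / N2)\<^sup>2 - (shot U l1 A x / N1)\<^sup>2))
        + b * ((exp (log_amplitude U l2 A R) / N2)\<^sup>2 - (exp (log_amplitude U l1 A R) / N1)\<^sup>2)
        + a * ((1 / N2)\<^sup>2 - (1 / N1)\<^sup>2)) (at 0 within H)"
      unfolding val NN gap_fun_def
      by (rule tendsto_cong[THEN iffD1, OF _ d])
        (auto simp: l1_def l2_def diff_divide_distrib)
  qed
qed

text \<open>For \<open>D > 0\<close> the condition is cot D \<ge> - 1 / (2 R), and the cotangent
  decreases; so every angle on the path inherits it from \<open>D\<close>.\<close>

lemma cos_sin_condition_mono:
  assumes "0 \<le> A" "A \<le> D" "D < pi" and D: "0 \<le> 2 * R * cos D + sin D"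
  shows "0 \<le> 2 * R * cos A + sin A"
proof (cases "A \<le> pi / 2")
  case True
  then show ?thesis using assms R_pos
    by (intro add_nonneg_nonneg mult_nonneg_nonneg cos_ge_zero sin_ge_zero) auto
next
  case False
  have "cos D \<le> cos A" using assms by (intro cos_monotone_0_pi_le) auto
  moreover have "sin D \<le> sin A"
    using sin_monotone_2pi_le[of "pi - D" "pi - A"] False assms by simp
  ultimately show ?thesis using D R_pos mult_left_mono[of "cos D" "cos A" "2 * R"] by linarith
qed

lemma gap_bound_lipschitz:
  assumes V: "continuous_on {-R..R} V" "convex_on {-R..R} V"
    and lip: "\<And>x y. x \<in> {-R..R} \<Longrightarrow> y \<in> {-R..R} \<Longrightarrow> \<bar>V x - V y\<bar> \<le> k * \<bar>x - y\<bar>"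
    and A: "0 \<le> A" "A \<le> D" and B: "0 \<le> B" "B \<le> D" and D: "D < pi" "0 \<le> 2 * R * cos D + sin D"
  shows "gap_fun (\<lambda>_. 0) D D \<le> gap_fun V A B"
proof (rule ccontr)
  assume neg: "\<not> ?thesis"
  define Uf where "Uf t s x = t * V x + s * x" for t s x
  define Af where "Af t = D - t * (D - A)" for t
  define Bf where "Bf t = D - t * (D - B)" for t
  define G where "G t s = gap_fun (Uf t s) (Af t) (Bf t)" for t s
  define \<sigma> where "\<sigma> = 8 * pi\<^sup>2 / R ^ 3"
  \<comment> \<open>On the edges s = S and s = -S the added slope exceeds the Lipschitz constant of
    \<open>t * V\<close> by \<sigma>. The potential is then monotone with slope at least \<sigma> in
    absolute value, as required when the end angles differ.\<close>
  define S where "S = \<bar>k\<bar> + \<sigma>"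
  have \<sigma>: "0 < \<sigma>" using R_pos by (simp add: \<sigma>_def)
  have S: "0 < S" using \<sigma> by (simp add: S_def)
  have cUf: "continuous_on {-R..R} (Uf t s)" for t s
    unfolding Uf_def[abs_def] by (intro continuous_intros V)
  have range: "0 \<le> D - t * (D - C) \<and> D - t * (D - C) \<le> D" if "0 \<le> t" "t \<le> 1" "0 \<le> C" "C \<le> D" for t C
  proof -
    have "0 \<le> t * (D - C)" "t * (D - C) \<le> 1 * (D - C)"
      using that by (intro mult_nonneg_nonneg mult_right_mono; simp)+
    then show ?thesis using that by auto
  qed
  have adm: "admissible (Af t)" "admissible (Bf t)" if "0 \<le> t" "t \<le> 1" for t
    using range[OF that A] range[OF that B] D by (auto simp: admissible_def Af_def Bf_def)
  have bc: "0 \<le> 2 * R * cos (Af t) + sin (Af t)" "0 \<le> 2 * R * cos (Bf t) + sin (Bf t)"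
    if "0 \<le> t" "t \<le> 1" for t
    unfolding Af_def Bf_def
    using cos_sin_condition_mono[OF _ _ D, of "D - t * (D - A)"] range[OF that A]
      cos_sin_condition_mono[OF _ _ D, of "D - t * (D - B)"] range[OF that B] by blast+
  obtain N where N: "0 < N" "\<And>x. x \<in> {-R..R} \<Longrightarrow> \<bar>V x\<bar> \<le> N"
    using continuous_bounded_obtain[OF V(1)] by blast
  define Q where "Q = {0..1::real} \<times> {-S..S}"
  have "continuous_on Q (\<lambda>p. G (fst p) (snd p))"
    unfolding continuous_on_def
  proof
    fix p assume p: "p \<in> Q"
    let ?F = "at p within Q"
    have lim: "(fst \<longlongrightarrow> fst p) ?F" "(snd \<longlongrightarrow> snd p) ?F"
      by (rule tendsto_fst[OF tendsto_ident_at], rule tendsto_snd[OF tendsto_ident_at])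
    have limU: "uniform_limit {-R..R} (\<lambda>p. Uf (fst p) (snd p)) (Uf (fst p) (snd p)) ?F"
    proof (rule uniform_limitI)
      fix e :: real assume e: "0 < e"
      have "((\<lambda>p'. \<bar>fst p' - fst p\<bar> * N + \<bar>snd p' - snd p\<bar> * R) \<longlongrightarrow>
          \<bar>fst p - fst p\<bar> * N + \<bar>snd p - snd p\<bar> * R) ?F"
        by (intro tendsto_intros lim)
      then have "\<forall>\<^sub>F p' in ?F. \<bar>fst p' - fst p\<bar> * N + \<bar>snd p' - snd p\<bar> * R < e"
        by (rule order_tendstoD) (use e in simp)
      then show "\<forall>\<^sub>F p' in ?F. \<forall>x\<in>{-R..R}. dist (Uf (fst p') (snd p') x) (Uf (fst p) (snd p) x) < e"
      proof eventually_elim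
        case (elim p')
        show ?case
        proof
          fix x assume x: "x \<in> {-R..R}"
          have "Uf (fst p') (snd p') x - Uf (fst p) (snd p) x = (fst p' - fst p) * V x + (snd p' - snd p) * x"
            by (simp add: Uf_def algebra_simps)
          then have "\<bar>Uf (fst p') (snd p') x - Uf (fst p) (snd p) x\<bar>
              \<le> \<bar>fst p' - fst p\<bar> * \<bar>V x\<bar> + \<bar>snd p' - snd p\<bar> * \<bar>x\<bar>"
            by (metis abs_triangle_ineq abs_mult)
          also have "\<dots> \<le> \<bar>fst p' - fst p\<bar> * N + \<bar>snd p' - snd p\<bar> * R"
            using N(2)[OF x] x by (intro add_mono mult_left_mono) auto
          finally show "dist (Uf (fst p') (snd p') x) (Uf (fst p) (snd p) x) < e"
            using elim by (simp add: dist_real_def)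
        qed
      qed
    qed
    have limAB: "((\<lambda>p. Af (fst p)) \<longlongrightarrow> Af (fst p)) ?F" "((\<lambda>p. Bf (fst p)) \<longlongrightarrow> Bf (fst p)) ?F"
      unfolding Af_def Bf_def by (intro tendsto_intros lim)+
    have ev: "\<forall>\<^sub>F p in ?F. admissible (Af (fst p)) \<and> admissible (Bf (fst p))"
      unfolding eventually_at_filter using adm by (intro always_eventually) (auto simp: Q_def)
    have ap: "admissible (Af (fst p))" "admissible (Bf (fst p))"
      using adm p by (auto simp: Q_def)
    note lim_eig = eig_tendsto[OF cUf cUf limU limAB ap ev]
    show "((\<lambda>p. G (fst p) (snd p)) \<longlongrightarrow> G (fst p) (snd p)) ?F"
      unfolding G_def gap_fun_def by (rule tendsto_diff; rule lim_eig; simp)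
  qed
  note contG = this
  \<comment> \<open>Half of the supposed defect, so that the penalised value at (t, s) = (1, 0), and
    with it the minimum, stays below the gap of the zero potential.\<close>
  define \<epsilon> where "\<epsilon> = (gap_fun (\<lambda>_. 0) D D - gap_fun V A B) / 2"
  have \<epsilon>: "0 < \<epsilon>" using neg by (simp add: \<epsilon>_def)
  have "\<exists>p\<in>Q. \<forall>p'\<in>Q. G (fst p) (snd p) + \<epsilon> * fst p \<le> G (fst p') (snd p') + \<epsilon> * fst p'"
  proof (rule continuous_attains_inf)
    show "compact Q" unfolding Q_def by (intro compact_Times compact_Icc)
    show "Q \<noteq> {}" using S by (auto simp: Q_def)
    show "continuous_on Q (\<lambda>p. G (fst p) (snd p) + \<epsilon> * fst p)"
      by (intro continuous_on_add contG continuous_on_mult continuous_on_const continuous_on_fst continuous_on_id)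
  qed
  then obtain t s where ts: "0 \<le> t" "t \<le> 1" "- S \<le> s" "s \<le> S"
    and min: "\<And>t' s'. 0 \<le> t' \<Longrightarrow> t' \<le> 1 \<Longrightarrow> - S \<le> s' \<Longrightarrow> s' \<le> S \<Longrightarrow>
        G t s + \<epsilon> * t \<le> G t' s' + \<epsilon> * t'"
    unfolding Q_def by fastforce
  have "G 1 0 = gap_fun V A B" by (simp add: G_def Uf_def[abs_def] Af_def Bf_def)
  moreover have "0 \<le> \<epsilon> * t" using \<epsilon> ts by simp
  ultimately have Gts: "G t s < gap_fun (\<lambda>_. 0) D D"
    using min[of 1 0] S \<epsilon> by (simp add: \<epsilon>_def field_simps)
  obtain u1 u1' u2 u2' m L1 R1 L2 R2
    where pair: "low_pair R (Uf t s) (Af t) (Bf t) (eig 1 (Uf t s) (Af t) (Bf t)) (eig 2 (Uf t s) (Af t) (Bf t))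
        u1 u1' u2 u2' m L1 R1 L2 R2"
    and deriv: "\<And>\<Phi> a b H. continuous_on {-R..R} \<Phi> \<Longrightarrow>
      (\<And>h. h \<in> H \<Longrightarrow> admissible (Af t - h * a) \<and> admissible (Bf t - h * b)) \<Longrightarrow> at 0 within H \<noteq> bot \<Longrightarrow>
      ((\<lambda>h. (gap_fun (\<lambda>x. Uf t s x + h * \<Phi> x) (Af t - h * a) (Bf t - h * b) - gap_fun (Uf t s) (Af t) (Bf t)) / h) \<longlongrightarrow>
        I (\<lambda>x. \<Phi> x * ((u2 x)\<^sup>2 - (u1 x)\<^sup>2)) + b * (R2\<^sup>2 - R1\<^sup>2) + a * (L2\<^sup>2 - L1\<^sup>2)) (at 0 within H)"
    using gap_deriv[OF cUf adm(1)[OF ts(1,2)] adm(2)[OF ts(1,2)]] by blast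
  interpret p: low_pair R "Uf t s" "Af t" "Bf t" "eig 1 (Uf t s) (Af t) (Bf t)" "eig 2 (Uf t s) (Af t) (Bf t)"
    u1 u1' u2 u2' m L1 R1 L2 R2
    by (rule pair)
  have tilt_eq: "I (\<lambda>x. x * ((u2 x)\<^sup>2 - (u1 x)\<^sup>2)) = p.tilt"
    by (simp add: p.tilt_def p.q_def)
  have slope: "((\<lambda>h. (G t (s + h) - G t s) / h) \<longlongrightarrow> p.tilt) (at 0 within H)"
    if "at 0 within H \<noteq> bot" for H
  proof -
    have "Uf t (s + h) = (\<lambda>x. Uf t s x + h * x)" for h by (auto simp: Uf_def algebra_simps)
    then show ?thesis
      using deriv[of "\<lambda>x. x" H 0 0] adm[OF ts(1,2)] that by (simp add: G_def tilt_eq)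
  qed
  \<comment> \<open>Off the lower edge \<open>s\<close> may be decreased, off the upper edge
    increased; each move gives one inequality for \<open>tilt\<close>, and at an edge the remaining
    one contradicts steepness.\<close>
  have tilt_le: "p.tilt \<le> 0" if "- S < s"
  proof (rule tendsto_upperbound[OF slope[of "{..<0}"]])
    have "\<forall>\<^sub>F h in at_left 0. - S - s < h \<and> h < (0::real)"
      using that by (auto simp: eventually_at_left_field intro!: exI[of _ "- S - s"])
    then show "\<forall>\<^sub>F h in at_left 0. (G t (s + h) - G t s) / h \<le> 0"
      by eventually_elim (use min[of t] ts in \<open>auto intro!: divide_nonneg_neg\<close>)
  qed auto
  have tilt_ge: "0 \<le> p.tilt" if "s < S"
  proof (rule tendsto_lowerbound[OF slope[of "{0<..}"]])
    have "\<forall>\<^sub>F h in at_right 0. 0 < h \<and> h < S - s"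
      using that by (auto simp: eventually_at_right_field intro!: exI[of _ "S - s"])
    then show "\<forall>\<^sub>F h in at_right 0. 0 \<le> (G t (s + h) - G t s) / h"
      by eventually_elim (use min[of t] ts in \<open>auto intro!: divide_nonneg_pos\<close>)
  qed auto
  have incr: "\<bar>t * (V y - V x)\<bar> \<le> \<bar>k\<bar> * (y - x)" if "- R \<le> x" "x \<le> y" "y \<le> R" for x y
  proof -
    have "\<bar>t * (V y - V x)\<bar> \<le> 1 * \<bar>V y - V x\<bar>"
      unfolding abs_mult using ts by (intro mult_right_mono) auto
    also have "\<dots> \<le> k * \<bar>y - x\<bar>" using lip[of y x] that by auto
    also have "\<dots> \<le> \<bar>k\<bar> * \<bar>y - x\<bar>" by (intro mult_right_mono) auto
    finally show ?thesis using that by simp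
  qed
  have "s \<noteq> S"
  proof
    assume s: "s = S"
    have "0 < p.tilt"
    proof (rule p.tilt_pos_increasing[OF bc(2)[OF ts(1,2)] \<sigma>])
      show "\<sigma> * (y - x) \<le> Uf t s y - Uf t s x" if "- R \<le> x" "x \<le> y" "y \<le> R" for x y
        using incr[OF that] by (simp add: Uf_def s S_def algebra_simps)
    qed (simp add: \<sigma>_def)
    then show False using tilt_le s S by simp
  qed
  moreover have "s \<noteq> - S"
  proof
    assume s: "s = - S"
    have "p.tilt < 0"
    proof (rule p.tilt_neg_decreasing[OF bc(1)[OF ts(1,2)] \<sigma>])
      show "\<sigma> * (y - x) \<le> Uf t s x - Uf t s y" if "- R \<le> x" "x \<le> y" "y \<le> R" for x y
        using incr[OF that] by (simp add: Uf_def s S_def algebra_simps)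
    qed (simp add: \<sigma>_def)
    then show False using tilt_ge s S by simp
  qed
  ultimately have bal: "p.tilt = 0" using tilt_le tilt_ge ts by force
  show False
  proof (cases "t = 0")
    case True
    have "s = 0"
    proof (cases s "0 :: real" rule: linorder_cases)
      case greater
      have "0 < p.tilt"
        by (rule p.tilt_pos_increasing[OF bc(2)[OF ts(1,2)] greater])
          (auto simp: Af_def Bf_def Uf_def True algebra_simps)
      with bal show ?thesis by simp
    next
      case less
      have "p.tilt < 0"
        by (rule p.tilt_neg_decreasing[OF bc(1)[OF ts(1,2)], of "- s"])
          (use less in \<open>auto simp: Af_def Bf_def Uf_def True algebra_simps\<close>)
      with bal show ?thesis by simp
    qed
    then have "Uf t s = (\<lambda>_. 0)" using True by (simp add: Uf_def fun_eq_iff)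
    then show False using Gts by (simp add: G_def Af_def Bf_def True)
  next
    case False
    then have t: "0 < t" using ts by simp
    \<comment> \<open>Only smaller \<open>t\<close> are tested, which moves both angles back toward
      \<open>D\<close> and covers \<open>t = 1\<close>. The penalty makes this one-sided derivative
      at most - \<epsilon>, whereas its three terms turn out nonnegative.\<close>
    let ?H = "{- t<..<0}"
    have bot: "at 0 within ?H \<noteq> bot"
      using t by (simp add: trivial_limit_within islimpt_greaterThanLessThan2)
    have U_eq: "Uf (t + h) s = (\<lambda>x. Uf t s x + h * V x)" and A_eq: "Af (t + h) = Af t - h * (D - A)"
      and B_eq: "Bf (t + h) = Bf t - h * (D - B)" for h
      by (auto simp: Uf_def Af_def Bf_def algebra_simps)
    have "((\<lambda>h. (G (t + h) s - G t s) / h) \<longlongrightarrow>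
        I (\<lambda>x. V x * p.q x) + (D - B) * (R2\<^sup>2 - R1\<^sup>2) + (D - A) * (L2\<^sup>2 - L1\<^sup>2)) (at 0 within ?H)"
      unfolding G_def U_eq A_eq B_eq p.q_def
    proof (rule deriv[OF V(1) _ bot])
      show "admissible (Af t - h * (D - A)) \<and> admissible (Bf t - h * (D - B))" if "h \<in> ?H" for h
        using adm[of "t + h"] that ts unfolding A_eq B_eq by auto
    qed
    moreover have "\<forall>\<^sub>F h in at 0 within ?H. (G (t + h) s - G t s) / h \<le> - \<epsilon>"
    proof -
      have "(G (t + h) s - G t s) / h \<le> - \<epsilon>" if "- t < h" "h < 0" for h
        using min[of "t + h" s] that ts by (simp add: neg_divide_le_eq algebra_simps)
      then show ?thesis by (auto simp: eventually_at_filter)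
    qed
    ultimately have "I (\<lambda>x. V x * p.q x) + (D - B) * (R2\<^sup>2 - R1\<^sup>2) + (D - A) * (L2\<^sup>2 - L1\<^sup>2) \<le> - \<epsilon>"
      by (rule tendsto_upperbound) (rule bot)
    moreover have "0 \<le> I (\<lambda>x. V x * p.q x)" by (rule p.convex_response_nonneg[OF bal V])
    moreover have "0 \<le> (D - B) * (R2\<^sup>2 - R1\<^sup>2)"
      using B p.right_amplitude_le[OF bal] p.ampl by (intro mult_nonneg_nonneg) (auto intro: power_mono)
    moreover have "0 \<le> (D - A) * (L2\<^sup>2 - L1\<^sup>2)"
      using A p.left_amplitude_le[OF bal] p.ampl by (intro mult_nonneg_nonneg) (auto intro: power_mono)
    ultimately show False using \<epsilon> by linarith
  qed
qed

section \<open>From Lipschitz to bounded convex potentials\<close>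

text \<open>The slope of a chord inside [-r, r] lies between those of chords to the endpoints
  \<open>- R\<close> and \<open>R\<close>, which have length at least R - r and rise or fall by at
  most 2 M.\<close>

lemma convex_lipschitz_inside:
  assumes V: "convex_on {-R..R} V" and M: "\<And>x. x \<in> {-R..R} \<Longrightarrow> \<bar>V x\<bar> \<le> M"
    and r: "r < R" and xy: "x \<in> {-r..r}" "y \<in> {-r..r}"
  shows "\<bar>V x - V y\<bar> \<le> 2 * M / (R - r) * \<bar>x - y\<bar>"
proof -
  have main: "\<bar>V x - V y\<bar> \<le> 2 * M / (R - r) * \<bar>x - y\<bar>"
    if xy: "x \<in> {-r..r}" "y \<in> {-r..r}" "x < y" for x y
  proof -
    have I: "- R \<in> {-R..R}" "x \<in> {-R..R}" "y \<in> {-R..R}" "R \<in> {-R..R}" "- R < x" "y < R" using xy r by auto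
    have quot: "\<bar>(V p - V q) / (p - q)\<bar> \<le> 2 * M / (R - r)"
      if "p \<in> {-R..R}" "q \<in> {-R..R}" "R - r \<le> \<bar>p - q\<bar>" for p q
    proof -
      have "\<bar>V p - V q\<bar> \<le> 2 * M" using M[OF that(1)] M[OF that(2)] by linarith
      then show ?thesis unfolding abs_divide using that(3) r by (intro frac_le) auto
    qed
    have "(V x - V y) / (x - y) \<le> (V y - V R) / (y - R)"
      using convex_on_slope_le[OF V I(2,4) xy(3) I(6)] by linarith
    then have up: "(V x - V y) / (x - y) \<le> 2 * M / (R - r)"
      using abs_le_D1[OF quot[OF I(3,4)]] xy r by auto
    have "(V (- R) - V x) / (- R - x) \<le> (V x - V y) / (x - y)"
      using convex_on_slope_le[OF V I(1,3,5) xy(3)] by linarith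
    then have "- (2 * M / (R - r)) \<le> (V x - V y) / (x - y)"
      using abs_le_D2[OF quot[OF I(1,2)]] xy r by auto
    with up have "\<bar>(V x - V y) / (x - y)\<bar> \<le> 2 * M / (R - r)" by linarith
    then show ?thesis using xy(3) by (simp add: abs_divide divide_le_eq)
  qed
  show ?thesis
    using main[of x y] main[of y x] xy by (cases x y rule: linorder_cases) (auto simp: abs_minus_commute)
qed

text \<open>Chord slopes from 0 increase and are bounded by the slope to \<open>R\<close>, so they
  converge; the value \<open>V R\<close> may lie above the limit.\<close>

lemma convex_limit_left:
  fixes V :: "real \<Rightarrow> real"
  assumes V: "convex_on {-R..R} V"
  obtains l where "(V \<longlongrightarrow> l) (at_left R)"
proof -
  define g where "g x = (V x - V 0) / x" for x
  have I: "0 \<in> {-R..R}" "R \<in> {-R..R}" using R_pos by auto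
  have g: "(V 0 - V z) / (0 - z) = g z" for z
    using minus_divide_divide[of "V z - V 0" z] by (simp add: g_def)
  have mono: "g x \<le> g y" if "0 < x" "x < y" "y \<le> R" for x y
  proof -
    have "y \<in> {-R..R}" using that by auto
    from convex_on_slope_le(1)[OF V I(1) this that(1,2)] show ?thesis by (simp only: g)
  qed
  have bdd: "bdd_above (g ` {0<..<R})"
  proof (rule bdd_aboveI)
    show "z \<le> g R" if "z \<in> g ` {0<..<R}" for z using that mono[of _ R] by auto
  qed
  define l where "l = Sup (g ` {0<..<R})"
  have "(g \<longlongrightarrow> l) (at_left R)"
  proof (rule increasing_tendsto)
    have "\<forall>\<^sub>F x in at_left R. 0 < x \<and> x < R"
      using R_pos by (auto simp: eventually_at_left_field intro!: exI[of _ 0])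
    then show "\<forall>\<^sub>F x in at_left R. g x \<le> l"
      by eventually_elim (auto simp: l_def intro!: cSup_upper bdd)
    fix y assume "y < l"
    moreover have "g ` {0<..<R} \<noteq> {}" using R_pos by simp
    ultimately have "\<exists>z\<in>g ` {0<..<R}. y < z" unfolding l_def by (subst (asm) less_cSup_iff) (use bdd in auto)
    then obtain x0 where x0: "0 < x0" "x0 < R" "y < g x0" by auto
    have "\<forall>\<^sub>F x in at_left R. x0 < x \<and> x < R"
      using x0 by (auto simp: eventually_at_left_field intro!: exI[of _ x0])
    then show "\<forall>\<^sub>F x in at_left R. y < g x"
      by eventually_elim (use mono[of x0] x0 in \<open>auto intro: less_le_trans\<close>)
  qed
  then have "((\<lambda>x. V 0 + x * g x) \<longlongrightarrow> V 0 + R * l) (at_left R)"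
    by (intro tendsto_intros)
  moreover have "\<forall>\<^sub>F x in at_left R. V 0 + x * g x = V x"
    using R_pos by (auto simp: eventually_at_left_field g_def intro!: exI[of _ 0])
  ultimately have "(V \<longlongrightarrow> V 0 + R * l) (at_left R)" by (rule Lim_transform_eventually)
  then show ?thesis by (rule that)
qed

text \<open>Replacing the end values by one-sided limits removes possible jumps and leaves the open
  interval, where the differential equation is imposed, untouched.\<close>

lemma convex_continuous_extension:
  assumes V: "convex_on {-R..R} V"
  obtains W where "continuous_on {-R..R} W" "\<And>x. x \<in> {-R<..<R} \<Longrightarrow> V x = W x"
proof -
  obtain l where l: "(V \<longlongrightarrow> l) (at_left R)" using convex_limit_left[OF V] .
  have "convex_on {-R..R} (\<lambda>x. V (- x))"
    unfolding convex_on_def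
  proof (intro conjI ballI allI impI convex_real_interval)
    fix x y u v :: real assume *: "x \<in> {-R..R}" "y \<in> {-R..R}" "0 \<le> u" "0 \<le> v" "u + v = 1"
    have "- x \<in> {-R..R}" "- y \<in> {-R..R}" using * by auto
    then have "V (u *\<^sub>R (- x) + v *\<^sub>R (- y)) \<le> u * V (- x) + v * V (- y)"
      using V * unfolding convex_on_def by blast
    then show "V (- (u *\<^sub>R x + v *\<^sub>R y)) \<le> u * V (- x) + v * V (- y)" by simp
  qed
  then obtain l' where "((\<lambda>x. V (- x)) \<longlongrightarrow> l') (at_left R)" using convex_limit_left by blast
  then have l': "(V \<longlongrightarrow> l') (at_right (- R))" by (simp add: filterlim_at_left_to_right)
  define W where "W = V(R := l, - R := l')"
  have W_ends: "W (- R) = l'" "W R = l" using R_pos by (auto simp: W_def)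
  have eq: "V x = W x" if "x \<in> {-R<..<R}" for x using that by (auto simp: W_def)
  have "continuous_on {-R<..<R} V"
    by (intro convex_on_continuous convex_on_subset[OF V]) auto
  then have int: "V \<midarrow>x\<rightarrow> V x" if "x \<in> {-R<..<R}" for x
    using that by (simp add: continuous_on_eq_continuous_at isCont_def)
  have ev: "\<forall>\<^sub>F y in at x. V y = W y" if "x \<in> {-R<..<R}" for x
    using eventually_at_in_open'[OF open_greaterThanLessThan that] by eventually_elim (rule eq)
  have ends: "\<forall>\<^sub>F y in at_right (- R). V y = W y" "\<forall>\<^sub>F y in at_left R. V y = W y"
    using R_pos eq by (auto simp: eventually_at_right_field eventually_at_left_field intro!: exI[of _ 0])
  have "continuous_on {-R..R} W"
  proof (rule continuous_on_IccI)
    show "(W \<longlongrightarrow> W (- R)) (at_right (- R))"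
      unfolding W_ends by (rule Lim_transform_eventually[OF l' ends(1)])
    show "(W \<longlongrightarrow> W R) (at_left R)"
      unfolding W_ends by (rule Lim_transform_eventually[OF l ends(2)])
    show "W \<midarrow>x\<rightarrow> W x" if "- R < x" "x < R" for x
      using Lim_transform_eventually[OF int ev, of x] eq[of x] that by simp
  qed (use R_pos in auto)
  with eq show ?thesis using that by blast
qed

text \<open>Dilations W (c x) with c < 1 sample \<open>V\<close> on a smaller interval only: they
  stay convex and gain a Lipschitz constant from \<open>convex_lipschitz_inside\<close>. Uniform
  continuity of \<open>W\<close> gives uniform convergence as c tends to 1, hence convergence of the
  gaps at fixed angles.\<close>

lemma gap_bound_convex:
  assumes V: "convex_on {-R..R} V" and M: "\<And>x. x \<in> {-R..R} \<Longrightarrow> \<bar>V x\<bar> \<le> M"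
    and W: "continuous_on {-R..R} W" "\<And>x. x \<in> {-R<..<R} \<Longrightarrow> V x = W x"
    and A: "0 \<le> A" "A \<le> D" and B: "0 \<le> B" "B \<le> D" and D: "D < pi" "0 \<le> 2 * R * cos D + sin D"
  shows "gap_fun (\<lambda>_. 0) D D \<le> gap_fun W A B"
proof -
  \<comment> \<open>The double successor keeps every factor positive, beginning with 1/2.\<close>
  define c where "c j = 1 - inverse (real (Suc (Suc j)))" for j
  have c: "0 < c j" "c j < 1" for j by (auto simp: c_def field_simps)
  have c1: "c \<longlonglongrightarrow> 1"
  proof -
    have "(\<lambda>j. 1 - inverse (real (Suc j))) \<longlonglongrightarrow> 1 - 0"
      by (intro tendsto_intros LIMSEQ_inverse_real_of_nat)
    from LIMSEQ_Suc[OF this] show ?thesis by (simp add: c_def[abs_def])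
  qed
  define Wj where "Wj j x = W (c j * x)" for j x
  have shrink: "c j * x \<in> {- (c j * R)..c j * R}" "c j * R < R" if "x \<in> {-R..R}" for j x
    using that c[of j] R_pos mult_left_mono[of "- R" x "c j"] mult_left_mono[of x R "c j"] by auto
  have inside: "c j * x \<in> {-R<..<R}" if "x \<in> {-R..R}" for j x
    using shrink[OF that, of j] by auto
  have WV: "Wj j x = V (c j * x)" if "x \<in> {-R..R}" for j x
    using W(2)[OF inside[OF that]] by (simp add: Wj_def)
  have cont: "continuous_on {-R..R} (Wj j)" for j
    unfolding Wj_def[abs_def]
  proof (rule continuous_on_compose2[OF W(1)])
    show "continuous_on {-R..R} (\<lambda>x. c j * x)" by (intro continuous_intros)
    show "(\<lambda>x. c j * x) ` {-R..R} \<subseteq> {-R..R}"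
    proof
      fix y assume "y \<in> (\<lambda>x. c j * x) ` {-R..R}"
      then obtain x where x: "x \<in> {-R..R}" "y = c j * x" by blast
      show "y \<in> {-R..R}" using inside[OF x(1), of j] x(2) by auto
    qed
  qed
  have bound: "gap_fun (\<lambda>_. 0) D D \<le> gap_fun (Wj j) A B" for j
  proof (rule gap_bound_lipschitz[OF cont _ _ A B D])
    show "convex_on {-R..R} (Wj j)"
      unfolding convex_on_def
    proof (intro conjI ballI allI impI convex_real_interval)
      fix x y u v :: real assume *: "x \<in> {-R..R}" "y \<in> {-R..R}" "0 \<le> u" "0 \<le> v" "u + v = 1"
      have mem: "u *\<^sub>R x + v *\<^sub>R y \<in> {-R..R}"
        using convexD[OF convex_real_interval(5)[of "-R" R] *] by simp
      have in': "c j * z \<in> {-R..R}" if "z \<in> {-R..R}" for z using inside[OF that, of j] by auto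
      have "V (u *\<^sub>R (c j * x) + v *\<^sub>R (c j * y)) \<le> u * V (c j * x) + v * V (c j * y)"
        using V in'[OF *(1)] in'[OF *(2)] * unfolding convex_on_def by blast
      then show "Wj j (u *\<^sub>R x + v *\<^sub>R y) \<le> u * Wj j x + v * Wj j y"
        unfolding WV[OF mem] WV[OF *(1)] WV[OF *(2)] by (simp add: algebra_simps)
    qed
    fix x y assume xy: "x \<in> {-R..R}" "y \<in> {-R..R}"
    have "\<bar>Wj j x - Wj j y\<bar> \<le> 2 * M / (R - c j * R) * \<bar>c j * x - c j * y\<bar>"
      unfolding WV[OF xy(1)] WV[OF xy(2)]
      by (rule convex_lipschitz_inside[OF V M]) (use shrink xy in auto)
    also have "\<bar>c j * x - c j * y\<bar> = c j * \<bar>x - y\<bar>"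
      using c[of j] by (simp add: abs_mult flip: right_diff_distrib)
    finally show "\<bar>Wj j x - Wj j y\<bar> \<le> (2 * M / (R - c j * R) * c j) * \<bar>x - y\<bar>" by (simp add: mult_ac)
  qed
  have "uniformly_continuous_on {-R..R} W" by (rule compact_uniformly_continuous[OF W(1) compact_Icc])
  have lim: "uniform_limit {-R..R} Wj W sequentially"
  proof (rule uniform_limitI)
    fix e :: real assume "0 < e"
    then obtain d where d: "0 < d" "\<And>x y. x \<in> {-R..R} \<Longrightarrow> y \<in> {-R..R} \<Longrightarrow> dist y x < d \<Longrightarrow> dist (W y) (W x) < e"
      using \<open>uniformly_continuous_on {-R..R} W\<close> unfolding uniformly_continuous_on_def by metis
    have "\<forall>\<^sub>F j in sequentially. dist (c j) 1 < d / R"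
      by (rule tendstoD[OF c1]) (use d R_pos in simp)
    then show "\<forall>\<^sub>F j in sequentially. \<forall>x\<in>{-R..R}. dist (Wj j x) (W x) < e"
    proof eventually_elim
      case (elim j)
      show ?case
      proof
        fix x assume x: "x \<in> {-R..R}"
        have "dist (c j * x) x = dist (c j) 1 * \<bar>x\<bar>"
          by (simp add: dist_real_def flip: abs_mult) (simp add: algebra_simps)
        also have "\<dots> \<le> dist (c j) 1 * R" using x by (intro mult_left_mono) auto
        also have "\<dots> < d" using elim R_pos by (simp add: field_simps)
        finally show "dist (Wj j x) (W x) < e"
          unfolding Wj_def using inside[OF x, of j] x by (intro d(2)) auto
      qed
    qed
  qed
  have AB: "admissible A" "admissible B" using A B D by (auto simp: admissible_def)
  have "(\<lambda>j. gap_fun (Wj j) A B) \<longlonglongrightarrow> gap_fun W A B"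
    unfolding gap_fun_def
    by (rule tendsto_diff; rule eig_tendsto[OF W(1) cont lim tendsto_const tendsto_const AB]; simp add: AB)
  then show ?thesis by (rule LIMSEQ_le_const) (use bound in auto)
qed

lemma eig_constant:
  assumes A: "admissible A" and B: "admissible B" and n: "n \<in> {1, 2}"
  shows "eig n (\<lambda>_. c) A B = eig n (\<lambda>_. 0) A B + c"
proof -
  have "phase (\<lambda>_. c) (eig n (\<lambda>_. c) A B) A R = phase (\<lambda>_. c) (eig n (\<lambda>_. 0) A B + c) A R"
    using phase_eig[OF _ A B n, of "\<lambda>_. c"] phase_eig[OF _ A B n, of "\<lambda>_. 0"] by simp
  then show ?thesis by (rule phase_inj[rotated]) simp
qed

end

text \<open>The boundary condition with parameter \<open>\<alpha>\<close> reads \<open>u cos A = u' sin A\<close> for the angle \<open>A\<close>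
  with \<open>cot A = \<alpha>\<close>, so that the Dirichlet condition is the case \<open>A = 0\<close>.\<close>

definition bc_angle :: "ereal \<Rightarrow> real" where
  "bc_angle \<alpha> = (if \<alpha> = \<infinity> then 0 else pi / 2 - arctan (real_of_ereal \<alpha>))"

lemma bc_angle_range: "0 \<le> bc_angle \<alpha>" "bc_angle \<alpha> < pi"
  unfolding bc_angle_def
  by (cases "\<alpha> = \<infinity>"; use arctan_bounded[of "real_of_ereal \<alpha>"] pi_gt_zero in simp)+

text \<open>\<open>real_of_ereal\<close> sends minus infinity to 0, where \<open>bc_angle\<close> is
  pi / 2 instead of pi; hence the exclusion.\<close>

lemma bc_angle_antimono:
  assumes "\<alpha> \<le> \<beta>" "\<alpha> \<noteq> - \<infinity>"
  shows "bc_angle \<beta> \<le> bc_angle \<alpha>"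
proof (cases "\<beta> = \<infinity>")
  case True
  then show ?thesis using bc_angle_range(1) by (simp add: bc_angle_def[of "\<infinity>"])
next
  case False
  then show ?thesis using assms by (cases \<alpha>; cases \<beta>) (auto simp: bc_angle_def arctan_le_iff)
qed

lemma bc_angle_trig:
  "cos (pi / 2 - arctan a) = a * cos (arctan a)" "sin (pi / 2 - arctan a) = cos (arctan a)"
proof -
  show "cos (pi / 2 - arctan a) = a * cos (arctan a)"
    unfolding cos_diff by (simp only: cos_pi_half sin_pi_half sin_arctan cos_arctan) simp
  show "sin (pi / 2 - arctan a) = cos (arctan a)"
    by (simp add: sin_diff)
qed

lemma bc_infinity: "bc_left \<infinity> u du \<longleftrightarrow> u = 0" "bc_right \<infinity> u du \<longleftrightarrow> u = 0"
  by (simp_all only: infinity_ereal_def bc_left.simps bc_right.simps)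

lemma bc_left_iff:
  assumes "\<alpha> \<noteq> - \<infinity>"
  shows "bc_left \<alpha> u du \<longleftrightarrow> u * cos (bc_angle \<alpha>) = du * sin (bc_angle \<alpha>)"
proof (cases \<alpha>)
  case (real a)
  have "0 < cos (arctan a)" using arctan_bounded[of a] by (intro cos_gt_zero_pi) auto
  then show ?thesis using real by (auto simp: bc_angle_def bc_angle_trig)
qed (use assms in \<open>auto simp: bc_angle_def bc_infinity\<close>)

lemma bc_right_iff:
  assumes "\<alpha> \<noteq> - \<infinity>"
  shows "bc_right \<alpha> u du \<longleftrightarrow> u * cos (bc_angle \<alpha>) = - du * sin (bc_angle \<alpha>)"
proof (cases \<alpha>)
  case (real a)
  have c: "0 < cos (arctan a)" using arctan_bounded[of a] by (intro cos_gt_zero_pi) auto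
  have "du = - a * u \<longleftrightarrow> (u * a) * cos (arctan a) = (- du) * cos (arctan a)"
    by (subst mult_cancel_right) (use c in \<open>auto simp: mult.commute\<close>)
  then show ?thesis using real by (simp add: bc_angle_def bc_angle_trig mult_ac)
qed (use assms in \<open>auto simp: bc_angle_def bc_infinity\<close>)

text \<open>For real \<alpha> the expression is (L \<alpha> + 1) cos (arctan \<alpha>), and this
  cosine is positive.\<close>

lemma bc_angle_condition:
  assumes "0 < L" "ereal (- 1 / L) \<le> \<alpha>"
  shows "0 \<le> L * cos (bc_angle \<alpha>) + sin (bc_angle \<alpha>)"
proof (cases \<alpha>)
  case (real a)
  have c: "0 < cos (arctan a)" using arctan_bounded[of a] by (intro cos_gt_zero_pi) auto
  have "- 1 / L \<le> a" using assms real by simp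
  then have "0 \<le> L * a + 1" using assms(1) by (simp add: field_simps)
  then have "0 \<le> (L * a + 1) * cos (arctan a)" using c by simp
  then show ?thesis using real by (simp add: bc_angle_def bc_angle_trig algebra_simps)
qed (use assms in \<open>auto simp: bc_angle_def\<close>)

theorem theorem1p4:
  fixes V :: "real \<Rightarrow> real" and L :: real and \<alpha> \<beta> :: ereal
  assumes "L > 0"
    and "bounded (V ` {-L/2..L/2})"
    and "convex_on {-L/2..L/2} V"
    and "\<alpha> \<ge> ereal (-1/L)" and "\<beta> \<ge> ereal (-1/L)"
  shows "gap V L \<alpha> \<beta> \<ge> gap (\<lambda>_. 0) L (min \<alpha> \<beta>) (min \<alpha> \<beta>)
         \<and> ((\<exists>c. \<forall>x\<in>{-L/2..L/2}. V x = c) \<and> \<alpha> = \<beta> \<longrightarrow>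
              gap V L \<alpha> \<beta> = gap (\<lambda>_. 0) L \<alpha> \<alpha>)"
proof -
  define R where "R = L / 2"
  have L: "L = 2 * R" and ends: "- L / 2 = - R" "L / 2 = R" by (simp_all add: R_def)
  interpret symmetric_interval R by unfold_locales (use assms(1) R_def in simp)
  have ninf: "\<alpha> \<noteq> - \<infinity>" "\<beta> \<noteq> - \<infinity>" "min \<alpha> \<beta> \<noteq> - \<infinity>"
    using assms(4,5) by (auto simp: min_def)
  define D where "D = bc_angle (min \<alpha> \<beta>)"
  have adm: "admissible (bc_angle \<gamma>)" for \<gamma> using bc_angle_range by (simp add: admissible_def)
  have gap_eq: "gap U L \<gamma> \<delta> = gap_fun W (bc_angle \<gamma>) (bc_angle \<delta>)"
    if "continuous_on {-R..R} W" "\<And>x. x \<in> {-R<..<R} \<Longrightarrow> U x = W x" "\<gamma> \<noteq> - \<infinity>" "\<delta> \<noteq> - \<infinity>" for U W \<gamma> \<delta>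
    unfolding gap_def gap_fun_def L
    using eig1_eq[OF that(1,2) adm adm bc_left_iff[OF that(3)] bc_right_iff[OF that(4)]]
      eig2_eq[OF that(1,2) adm adm bc_left_iff[OF that(3)] bc_right_iff[OF that(4)]] by simp
  have zero: "gap (\<lambda>_. 0) L \<gamma> \<gamma> = gap_fun (\<lambda>_. 0) (bc_angle \<gamma>) (bc_angle \<gamma>)" if "\<gamma> \<noteq> - \<infinity>" for \<gamma>
    by (rule gap_eq) (use that in auto)
  have V: "convex_on {-R..R} V" using assms(3) unfolding ends .
  obtain W where W: "continuous_on {-R..R} W" "\<And>x. x \<in> {-R<..<R} \<Longrightarrow> V x = W x"
    using convex_continuous_extension[OF V] by blast
  obtain M where "\<forall>y\<in>V ` {-R..R}. norm y \<le> M"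
    using assms(2) unfolding ends bounded_iff by blast
  then have M: "\<bar>V x\<bar> \<le> M" if "x \<in> {-R..R}" for x using that by auto
  have "gap_fun (\<lambda>_. 0) D D \<le> gap_fun W (bc_angle \<alpha>) (bc_angle \<beta>)"
  proof (rule gap_bound_convex[OF V M W])
    show "bc_angle \<alpha> \<le> D" "bc_angle \<beta> \<le> D"
      unfolding D_def by (rule bc_angle_antimono[OF _ ninf(3)]; simp)+
    show "0 \<le> 2 * R * cos D + sin D"
      using bc_angle_condition[OF assms(1), of "min \<alpha> \<beta>"] assms(4,5) by (simp add: D_def L)
  qed (simp_all add: bc_angle_range D_def)
  then have "gap (\<lambda>_. 0) L (min \<alpha> \<beta>) (min \<alpha> \<beta>) \<le> gap V L \<alpha> \<beta>"
    by (simp only: zero[OF ninf(3)] gap_eq[OF W ninf(1,2)] D_def)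
  moreover have "gap V L \<alpha> \<beta> = gap (\<lambda>_. 0) L \<alpha> \<alpha>"
    if "\<forall>x\<in>{-L/2..L/2}. V x = c" "\<alpha> = \<beta>" for c
  proof -
    have "gap V L \<alpha> \<beta> = gap_fun (\<lambda>_. c) (bc_angle \<alpha>) (bc_angle \<beta>)"
      by (rule gap_eq) (use that(1) ninf in \<open>auto simp: ends\<close>)
    also have "\<dots> = gap_fun (\<lambda>_. 0) (bc_angle \<alpha>) (bc_angle \<alpha>)"
      using that(2) eig_constant[OF adm adm, of 1 c] eig_constant[OF adm adm, of 2 c]
      by (simp add: gap_fun_def)
    finally show ?thesis using zero[OF ninf(1)] by simp
  qed
  ultimately show ?thesis by blast
qed

end
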